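(* Let $\eta\in\mathcal P(\mathbb T^d)$ and let $\delta_n\to0^+$ be a sequence such that $\mathcal V_{\delta_n}(\cdot)-\mathcal V_{\delta_n}(\eta)$ converges uniformly on $\mathcal P(\mathbb T^d)$ to a function $\chi:\mathcal P(\mathbb T^d)\to\mathbb R$ and $\delta_n\mathcal V_{\delta_n}$ converges uniformly to a constant $-\lambda$. Then for any $m_0\in\mathcal P(\mathbb T^d)$ and any $t>0$, $$\chi(m_0)=\inf_{(m,\alpha)}\left(\int_0^t\Big(\int_{\mathbb T^d}H^*(x,\alpha(s,x))\,m(s,dx)+\mathcal F(m(s))\Big)ds+\chi(m(t))\right)+\lambda t,$$ where the infimum is over $m\in C^0([0,t],\mathcal P(\mathbb T^d))$ and $\alpha\in L^2_m([0,t]\times\mathbb T^d,\mathbb R^d)$ (i.e. $\int_0^t\int|\alpha|^2dm(s)\,ds<\infty$) such that $-\partial_tm+\Delta m+\mathrm{div}(m\alpha)=0$ in the sense of distributions with initial condition $m(0)=m_0$.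
   Context: $\mathbb T^d=\mathbb R^d/\mathbb Z^d$. $\mathcal P(\mathbb T^d)$ is the set of Borel probability measures on $\mathbb T^d$ with the distance $\mathbf d(\mu,\nu)=\sup\{\int_{\mathbb T^d}\phi\,d(\mu-\nu):\phi:\mathbb T^d\to\mathbb R,\ \mathrm{Lip}(\phi)\le1\}$. Derivatives: $\Phi:\mathcal P(\mathbb T^d)\to\mathbb R$ is $C^1$ if there is a continuous $\frac{\delta\Phi}{\delta m}:\mathcal P(\mathbb T^d)\times\mathbb T^d\to\mathbb R$ with $\Phi(m_2)-\Phi(m_1)=\int_0^1\int_{\mathbb T^d}\frac{\delta\Phi}{\delta m}((1-t)m_1+tm_2,x)(m_2-m_1)(dx)\,dt$ for all $m_1,m_2$, normalized by $\int_{\mathbb T^d}\frac{\delta\Phi}{\delta m}(m,x)\,m(dx)=0$; $C^2$ is understood in the same sense. Standing assumptions. (1) $H:\mathbb T^d\times\mathbb R^d\to\mathbb R$ is $C^2$, $p\mapsto D_{pp}H(x,p)$ is Lipschitz uniformly in $x$; there is $\bar C>0$ with $\bar C^{-1}I_d\le D_{pp}H(x,p)\le\bar C I_d$ for all $(x,p)$; there are $\theta\in(0,1)$, $C>0$ with $|D_{xx}H(x,p)|\le C(1+|p|)^{1+\theta}$ and $|D_{xp}H(x,p)|\le C(1+|p|)^\theta$ for all $(x,p)$. (2) $\mathcal F:\mathcal P(\mathbb T^d)\to\mathbb R$ is $C^2$; its derivative $F(x,m)=\frac{\delta\mathcal F}{\delta m}(m,x)$ is twice differentiable in $x$ and $D^2_{xx}F$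 is bounded. $H^*(x,q)=\sup_{p\in\mathbb R^d}\{p\cdot q-H(x,p)\}$. For $\delta>0$ and $m_0\in\mathcal P(\mathbb T^d)$, $$\mathcal V_\delta(m_0)=\inf_{(m,\alpha)}\int_0^\infty e^{-\delta t}\Big(\int_{\mathbb T^d}H^*(x,\alpha(t,x))\,m(t,dx)+\mathcal F(m(t))\Big)dt,$$ over $m\in C^0([0,\infty),\mathcal P(\mathbb T^d))$ and $\alpha:[0,\infty)\times\mathbb T^d\to\mathbb R^d$ with $\int_0^\infty e^{-\delta t}\int|\alpha|^2dm(t)\,dt<\infty$, such that $-\partial_tm+\Delta m+\mathrm{div}(m\alpha)=0$ in the sense of distributions on $[0,\infty)\times\mathbb T^d$ with $m(0)=m_0$. *)

theory Defs
  imports "HOL-Probability.Probability"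
begin

section \<open>The flat torus\<close>

definition int_congruent :: "real ^ 'n \<Rightarrow> real ^ 'n \<Rightarrow> bool" where
  "int_congruent a b \<longleftrightarrow> (\<forall>i. a $ i - b $ i \<in> \<int>)"

lemma int_congruent_refl [simp]: "int_congruent a a"
  by (simp add: int_congruent_def)

lemma int_congruent_sym: "int_congruent a b \<Longrightarrow> int_congruent b a"
  unfolding int_congruent_def using Ints_minus by fastforce

lemma int_congruent_trans: "int_congruent a b \<Longrightarrow> int_congruent b c \<Longrightarrow> int_congruent a c"
  unfolding int_congruent_def
proof
  fix i assume "\<forall>i. a $ i - b $ i \<in> \<int>" "\<forall>i. b $ i - c $ i \<in> \<int>"
  then have "(a $ i - b $ i) + (b $ i - c $ i) \<in> \<int>" by (intro Ints_add) auto
  then show "a $ i - c $ i \<in> \<int>" by simp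
qed

quotient_type 'n torus = "real ^ 'n::finite" / "int_congruent"
  morphisms torus_rep torus_proj
  by (intro equivpI reflpI sympI transpI)
     (auto intro: int_congruent_sym int_congruent_trans)

lemma torus_proj_eq_iff: "torus_proj a = torus_proj b \<longleftrightarrow> int_congruent a b"
  by (rule torus.abs_eq_iff)

definition torus_fibre :: "'n::finite torus \<Rightarrow> (real ^ 'n) set" where
  "torus_fibre x = {a. torus_proj a = x}"

lemma torus_proj_surj: "\<exists>a. torus_proj a = x"
  using Quotient_abs_rep[OF Quotient_torus] by blast

lemma torus_fibre_nonempty [simp]: "torus_fibre x \<noteq> {}"
  using torus_proj_surj by (auto simp: torus_fibre_def)

lemma torus_fibre_closed: "closed (torus_fibre x)"
proof -
  obtain a where a: "torus_proj a = x" using torus_proj_surj by blast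
  have "torus_fibre x = (\<Inter>i. (\<lambda>b. b $ i - a $ i) -` \<int>)"
    by (auto simp: torus_fibre_def a[symmetric] torus_proj_eq_iff int_congruent_def)
  also have "closed \<dots>"
    by (intro closed_INT ballI closed_vimage closed_Ints continuous_intros)
  finally show ?thesis .
qed

lemma torus_fibre_translate:
  assumes "b \<in> torus_fibre y" "torus_proj a = torus_proj a'"
  shows "b + (a' - a) \<in> torus_fibre y"
proof -
  have "int_congruent (b + (a' - a)) b"
    using assms(2)[symmetric] by (simp add: torus_proj_eq_iff int_congruent_def)
  then show ?thesis
    using assms(1) by (simp add: torus_fibre_def torus_proj_eq_iff[symmetric])
qed

instantiation torus :: (finite) metric_space
begin

definition dist_torus :: "'a torus \<Rightarrow> 'a torus \<Rightarrow> real" where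
  "dist_torus x y = setdist (torus_fibre x) (torus_fibre y)"

definition uniformity_torus :: "('a torus \<times> 'a torus) filter" where
  "uniformity_torus = (INF e\<in>{0 <..}. principal {(x, y). dist x y < e})"

definition open_torus :: "'a torus set \<Rightarrow> bool" where
  "open_torus U \<longleftrightarrow> (\<forall>x\<in>U. eventually (\<lambda>(x', y). x' = x \<longrightarrow> y \<in> U) uniformity)"

lemma dist_torus_le: "dist (torus_proj a) (torus_proj b) \<le> dist a b"
  unfolding dist_torus_def by (intro setdist_le_dist) (auto simp: torus_fibre_def)

lemma dist_torus_attained:
  "\<exists>b\<in>torus_fibre y. dist (torus_proj a) y = dist a b"
proof -
  obtain b where b: "b \<in> torus_fibre y" "infdist a (torus_fibre y) = dist a b"
    using infdist_attains_inf[OF torus_fibre_closed torus_fibre_nonempty] by metis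
  have "dist a b \<le> setdist (torus_fibre (torus_proj a)) (torus_fibre y)"
  proof (rule le_setdistI)
    fix a' c assume a': "a' \<in> torus_fibre (torus_proj a)" and c: "c \<in> torus_fibre y"
    have "c + (a - a') \<in> torus_fibre y"
      using a' c by (intro torus_fibre_translate) (auto simp: torus_fibre_def)
    then have "dist a b \<le> dist a (c + (a - a'))"
      using b(2) infdist_le by metis
    also have "\<dots> = dist a' c" by (simp add: dist_norm algebra_simps)
    finally show "dist a b \<le> dist a' c" .
  qed auto
  moreover have "dist (torus_proj a) y \<le> dist a b"
    using b(1) dist_torus_le[of a b] by (simp add: torus_fibre_def)
  ultimately show ?thesis using b(1) by (intro bexI[of _ b]) (auto simp: dist_torus_def)
qed

instance
proof
  show "(uniformity :: ('a torus \<times> 'a torus) filter) =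
      (INF e\<in>{0 <..}. principal {(x, y). dist x y < e})"
    by (rule uniformity_torus_def)
  show "open U \<longleftrightarrow> (\<forall>x\<in>U. eventually (\<lambda>(x', y). x' = x \<longrightarrow> y \<in> U) uniformity)"
    for U :: "'a torus set"
    by (rule open_torus_def)
next
  fix x y :: "'a torus"
  obtain a where a: "torus_proj a = x" using torus_proj_surj by blast
  obtain b where b: "b \<in> torus_fibre y" "dist x y = dist a b"
    using dist_torus_attained[of y a] a by blast
  show "dist x y = 0 \<longleftrightarrow> x = y"
  proof
    assume "dist x y = 0" then show "x = y" using a b by (simp add: torus_fibre_def)
  next
    assume "x = y" then show "dist x y = 0"
      using dist_torus_le[of a a] a b(2) by simp
  qed
next
  fix x y z :: "'a torus"
  obtain c where c: "torus_proj c = z" using torus_proj_surj by blast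
  obtain a where a: "a \<in> torus_fibre x" "dist z x = dist c a"
    using dist_torus_attained[of x c] c by blast
  obtain b where b: "b \<in> torus_fibre y" "dist z y = dist c b"
    using dist_torus_attained[of y c] c by blast
  have sym: "dist u v = dist v u" for u v :: "'a torus"
    by (simp add: dist_torus_def setdist_sym)
  have "dist x y \<le> dist a b"
    using dist_torus_le[of a b] a(1) b(1) by (simp add: torus_fibre_def)
  also have "\<dots> \<le> dist c a + dist c b" by (metis dist_commute dist_triangle)
  finally show "dist x y \<le> dist x z + dist y z"
    using a(2) b(2) sym by metis
qed

end

lemma torus_bounded: "dist x y \<le> real CARD('n)" for x y :: "'n::finite torus"
proof -
  obtain a b where ab: "torus_proj a = x" "torus_proj b = y" using torus_proj_surj by metis
  define c where "c = (\<chi> i. a $ i + frac (b $ i - a $ i))"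
  have "int_congruent c b"
    by (auto simp: int_congruent_def c_def frac_def)
  then have "torus_proj c = y" using ab by (simp add: torus_proj_eq_iff[symmetric])
  then have "dist x y \<le> norm (a - c)" using dist_torus_le[of a c] ab by (simp add: dist_norm)
  also have "\<dots> \<le> (\<Sum>i\<in>UNIV. \<bar>(a - c) $ i\<bar>)" by (rule norm_le_l1_cart)
  also have "\<dots> \<le> (\<Sum>i\<in>(UNIV::'n set). 1)"
    by (intro sum_mono) (auto simp: c_def abs_le_iff frac_lt_1 less_imp_le frac_ge_0 le_minus_iff
        intro: order_trans[OF _ frac_ge_0])
  finally show ?thesis by simp
qed


section \<open>Borel probability measures on the torus\<close>

typedef (overloaded) 'n torus_prob =
    "{M :: 'n::finite torus measure. sets M = sets borel \<and> prob_space M}"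
  morphisms meas Abs_torus_prob
  by (rule exI[of _ "return borel undefined"]) (auto intro!: prob_space_return)

lemma sets_meas [simp, measurable_cong]: "sets (meas \<mu>) = sets borel"
  and prob_space_meas: "prob_space (meas \<mu>)"
  using meas[of \<mu>] by auto

lemma space_meas [simp]: "space (meas \<mu>) = UNIV"
  using sets_eq_imp_space_eq[OF sets_meas[of \<mu>]] by simp

definition lip1 :: "('n::finite torus \<Rightarrow> real) set" where
  "lip1 = {\<phi>. 1-lipschitz_on UNIV \<phi>}"

lemma lip1_diff: "\<phi> \<in> lip1 \<Longrightarrow> \<bar>\<phi> x - \<phi> y\<bar> \<le> dist x y"
  unfolding lip1_def lipschitz_on_def by (auto simp: dist_real_def)

lemma lip1_integrable:
  fixes \<phi> :: "'n::finite torus \<Rightarrow> real"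
  assumes "\<phi> \<in> lip1" shows "integrable (meas \<mu>) \<phi>"
proof -
  interpret prob_space "meas \<mu>" by (rule prob_space_meas)
  have "continuous_on UNIV \<phi>"
    using assms lipschitz_on_continuous_on by (auto simp: lip1_def)
  then have [measurable]: "\<phi> \<in> borel_measurable borel"
    by (rule borel_measurable_continuous_onI)
  have "\<bar>\<phi> x\<bar> \<le> \<bar>\<phi> undefined\<bar> + real CARD('n)" for x
    using lip1_diff[OF assms, of x undefined] torus_bounded[of x undefined] by linarith
  then show ?thesis
    by (intro integrable_const_bound[where B = "\<bar>\<phi> undefined\<bar> + real CARD('n)"]) auto
qed

lemma lip1_bound:
  fixes \<phi> :: "'n::finite torus \<Rightarrow> real"
  assumes "\<phi> \<in> lip1"
  shows "(\<integral>x. \<phi> x \<partial>meas \<mu>) - (\<integral>x. \<phi> x \<partial>meas \<nu>) \<le> 2 * real CARD('n)"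
proof -
  have *: "\<bar>(\<integral>x. \<phi> x \<partial>meas \<rho>) - \<phi> undefined\<bar> \<le> real CARD('n)" for \<rho>
  proof -
    interpret prob_space "meas \<rho>" by (rule prob_space_meas)
    have "(\<integral>x. \<phi> x \<partial>meas \<rho>) - \<phi> undefined = (\<integral>x. \<phi> x - \<phi> undefined \<partial>meas \<rho>)"
      using lip1_integrable[OF assms] prob_space by simp
    also have "\<bar>\<dots>\<bar> \<le> (\<integral>x. \<bar>\<phi> x - \<phi> undefined\<bar> \<partial>meas \<rho>)"
      by (rule integral_abs_bound)
    also have "\<dots> \<le> (\<integral>x. real CARD('n) \<partial>meas \<rho>)"
      using lip1_integrable[OF assms]
      by (intro integral_mono) (auto intro!: order_trans[OF lip1_diff[OF assms] torus_bounded])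
    finally show ?thesis using prob_space by simp
  qed
  show ?thesis using *[of \<mu>] *[of \<nu>] by linarith
qed

instantiation torus_prob :: (finite) metric_space
begin

definition dist_torus_prob :: "'a torus_prob \<Rightarrow> 'a torus_prob \<Rightarrow> real" where
  "dist_torus_prob \<mu> \<nu> =
    (SUP \<phi>\<in>{\<phi>. 1-lipschitz_on UNIV \<phi>}. (\<integral>x. \<phi> x \<partial>meas \<mu>) - (\<integral>x. \<phi> x \<partial>meas \<nu>))"

definition uniformity_torus_prob :: "('a torus_prob \<times> 'a torus_prob) filter" where
  "uniformity_torus_prob = (INF e\<in>{0 <..}. principal {(x, y). dist x y < e})"

definition open_torus_prob :: "'a torus_prob set \<Rightarrow> bool" where
  "open_torus_prob U \<longleftrightarrow> (\<forall>x\<in>U. eventually (\<lambda>(x', y). x' = x \<longrightarrow> y \<in> U) uniformity)"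

lemma lip1_le_dist:
  assumes "\<phi> \<in> lip1"
  shows "(\<integral>x. \<phi> x \<partial>meas \<mu>) - (\<integral>x. \<phi> x \<partial>meas \<nu>) \<le> dist \<mu> \<nu>"
  unfolding dist_torus_prob_def lip1_def[symmetric]
  using assms lip1_bound by (intro cSUP_upper bdd_aboveI2) auto

lemma dist_torus_prob_leI:
  assumes "\<And>\<phi>. \<phi> \<in> lip1 \<Longrightarrow> (\<integral>x. \<phi> x \<partial>meas \<mu>) - (\<integral>x. \<phi> x \<partial>meas \<nu>) \<le> c"
  shows "dist \<mu> \<nu> \<le> c"
proof -
  have "(\<lambda>x. 0) \<in> lip1" by (simp add: lip1_def lipschitz_on_def)
  then show ?thesis
    unfolding dist_torus_prob_def lip1_def[symmetric]
    using assms by (intro cSUP_least) auto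
qed

lemma dist_torus_prob_sym: "dist \<mu> \<nu> \<le> dist \<nu> (\<mu> :: 'a torus_prob)"
proof (rule dist_torus_prob_leI)
  fix \<phi> :: "'a torus \<Rightarrow> real" assume "\<phi> \<in> lip1"
  then have "(\<lambda>x. - \<phi> x) \<in> lip1" by (simp add: lip1_def lipschitz_on_def dist_minus)
  from lip1_le_dist[OF this, of \<nu> \<mu>]
  show "(\<integral>x. \<phi> x \<partial>meas \<mu>) - (\<integral>x. \<phi> x \<partial>meas \<nu>) \<le> dist \<nu> \<mu>" by simp
qed

lemma torus_prob_eqI:
  fixes \<mu> \<nu> :: "'a torus_prob"
  assumes eq: "\<And>\<phi>. \<phi> \<in> lip1 \<Longrightarrow> (\<integral>x. \<phi> x \<partial>meas \<mu>) = (\<integral>x. \<phi> x \<partial>meas \<nu>)"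
  shows "\<mu> = \<nu>"
proof -
  interpret M: prob_space "meas \<mu>" by (rule prob_space_meas)
  interpret N: prob_space "meas \<nu>" by (rule prob_space_meas)
  have closed: "measure (meas \<mu>) C = measure (meas \<nu>) C" if C: "closed C" "C \<noteq> {}" for C
  proof -
    define f where "f k x = max 0 (1 - real (Suc k) * infdist x C)" for k and x :: "'a torus"
    have [measurable]: "f k \<in> borel_measurable borel" for k
      unfolding f_def by (intro borel_measurable_continuous_onI continuous_intros)
    have lip: "(\<lambda>x. f k x / real (Suc k)) \<in> lip1" for k
      unfolding lip1_def lipschitz_on_def mem_Collect_eq
    proof (intro conjI ballI)
      fix x y :: "'a torus"
      have "\<bar>f k x - f k y\<bar> \<le> \<bar>real (Suc k) * infdist x C - real (Suc k) * infdist y C\<bar>"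
        unfolding f_def by linarith
      also have "\<dots> = real (Suc k) * \<bar>infdist x C - infdist y C\<bar>"
        by (simp add: abs_mult flip: right_diff_distrib)
      also have "\<dots> \<le> real (Suc k) * dist x y"
        by (intro mult_left_mono infdist_triangle_abs) auto
      finally have "\<bar>f k x - f k y\<bar> / real (Suc k) \<le> dist x y"
        by (simp add: divide_le_eq mult.commute)
      then show "dist (f k x / real (Suc k)) (f k y / real (Suc k)) \<le> 1 * dist x y"
        by (simp add: dist_real_def flip: diff_divide_distrib)
    qed simp
    have lim: "(\<lambda>k. f k x) \<longlonglongrightarrow> indicator C x" for x
    proof (cases "x \<in> C")
      case True then show ?thesis by (simp add: f_def)
    next
      case False
      then have pos: "infdist x C > 0"
        using C infdist_nonneg[of x C] in_closed_iff_infdist_zero[of C x] by fastforce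
      obtain K :: nat where K: "1 / infdist x C < real K" using reals_Archimedean2 by blast
      have "f k x = 0" if "k \<ge> K" for k
      proof -
        have "1 / infdist x C \<le> real (Suc k)" using K that by simp
        then have "1 \<le> real (Suc k) * infdist x C" using pos by (simp add: divide_le_eq)
        then show ?thesis by (simp add: f_def)
      qed
      then show ?thesis using False
        by (intro tendsto_eventually) (auto simp: eventually_sequentially)
    qed
    have conv: "(\<lambda>k. \<integral>x. f k x \<partial>meas \<rho>) \<longlonglongrightarrow> measure (meas \<rho>) C" for \<rho> :: "'a torus_prob"
    proof -
      interpret prob_space "meas \<rho>" by (rule prob_space_meas)
      have [measurable]: "C \<in> sets borel" using C by auto
      have "(\<lambda>k. \<integral>x. f k x \<partial>meas \<rho>) \<longlonglongrightarrow> (\<integral>x. indicator C x \<partial>meas \<rho>)"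
      proof (rule integral_dominated_convergence[where w = "\<lambda>_. 1"])
        show "AE x in meas \<rho>. norm (f k x) \<le> 1" for k
          by (simp add: f_def infdist_nonneg)
      qed (use lim in auto)
      then show ?thesis by simp
    qed
    have "(\<integral>x. f k x \<partial>meas \<mu>) = (\<integral>x. f k x \<partial>meas \<nu>)" for k
      using eq[OF lip[of k]] by simp
    with conv[of \<mu>] conv[of \<nu>] show ?thesis using LIMSEQ_unique by simp
  qed
  have "meas \<mu> = meas \<nu>"
  proof (rule measure_eqI_generator_eq[where E = "Collect closed" and \<Omega> = UNIV and A = "\<lambda>_. UNIV"])
    show "Int_stable (Collect (closed :: 'a torus set \<Rightarrow> bool))"
      by (auto simp: Int_stable_def)
    show "emeasure (meas \<mu>) X = emeasure (meas \<nu>) X" if "X \<in> Collect closed" for X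
      using closed[of X] that
      by (cases "X = {}") (auto simp: M.emeasure_eq_measure N.emeasure_eq_measure)
  qed (auto simp: borel_eq_closed)
  then show ?thesis by (simp add: meas_inject)
qed

instance
proof
  show "(uniformity :: ('a torus_prob \<times> 'a torus_prob) filter) =
      (INF e\<in>{0 <..}. principal {(x, y). dist x y < e})"
    by (rule uniformity_torus_prob_def)
  show "open U \<longleftrightarrow> (\<forall>x\<in>U. eventually (\<lambda>(x', y). x' = x \<longrightarrow> y \<in> U) uniformity)"
    for U :: "'a torus_prob set"
    by (rule open_torus_prob_def)
next
  fix \<mu> \<nu> :: "'a torus_prob"
  show "dist \<mu> \<nu> = 0 \<longleftrightarrow> \<mu> = \<nu>"
  proof
    assume 0: "dist \<mu> \<nu> = 0"
    then have "dist \<nu> \<mu> \<le> 0" using dist_torus_prob_sym[of \<nu> \<mu>] by simp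
    then show "\<mu> = \<nu>"
      using 0 lip1_le_dist[of _ \<mu> \<nu>] lip1_le_dist[of _ \<nu> \<mu>]
      by (intro torus_prob_eqI antisym) force+
  next
    assume "\<mu> = \<nu>"
    moreover have "(\<lambda>x. 0) \<in> lip1" by (simp add: lip1_def lipschitz_on_def)
    ultimately show "dist \<mu> \<nu> = 0"
      using lip1_le_dist[of "\<lambda>x. 0" \<mu> \<nu>] dist_torus_prob_leI[of \<mu> \<nu> 0] by force
  qed
next
  fix \<mu> \<nu> \<rho> :: "'a torus_prob"
  show "dist \<mu> \<nu> \<le> dist \<mu> \<rho> + dist \<nu> \<rho>"
  proof (rule dist_torus_prob_leI)
    fix \<phi> :: "'a torus \<Rightarrow> real" assume "\<phi> \<in> lip1"
    from lip1_le_dist[OF this, of \<mu> \<rho>] lip1_le_dist[OF this, of \<rho> \<nu>] dist_torus_prob_sym[of \<rho> \<nu>]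
    show "(\<integral>x. \<phi> x \<partial>meas \<mu>) - (\<integral>x. \<phi> x \<partial>meas \<nu>) \<le> dist \<mu> \<rho> + dist \<nu> \<rho>" by linarith
  qed
qed

end

text \<open>The convex combination \<open>(1 - t) \<mu> + t \<nu>\<close>, meant for \<open>0 \<le> t \<le> 1\<close>.\<close>

definition mix :: "real \<Rightarrow> 'n::finite torus_prob \<Rightarrow> 'n torus_prob \<Rightarrow> 'n torus_prob" where
  "mix t \<mu> \<nu> = Abs_torus_prob (measure_of UNIV (sets borel)
     (\<lambda>A. ennreal (1 - t) * emeasure (meas \<mu>) A + ennreal t * emeasure (meas \<nu>) A))"

lemma emeasure_mix:
  assumes t: "0 \<le> t" "t \<le> 1" and A: "A \<in> sets borel"
  shows "emeasure (meas (mix t \<mu> \<nu>)) A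
    = ennreal (1 - t) * emeasure (meas \<mu>) A + ennreal t * emeasure (meas \<nu>) A"
proof -
  let ?f = "\<lambda>A. ennreal (1 - t) * emeasure (meas \<mu>) A + ennreal t * emeasure (meas \<nu>) A"
  let ?M = "measure_of UNIV (sets borel) ?f"
  have ca: "countably_additive (sets borel) ?f"
    by (auto simp: countably_additive_def ennreal_suminf_cmult suminf_add[symmetric]
        suminf_emeasure)
  have sets: "sets ?M = sets borel" by (simp add: sets_measure_of_conv sets.sigma_sets_eq[of borel, simplified])
  have em: "emeasure ?M B = ?f B" if "B \<in> sets borel" for B
    using sets.sigma_algebra_axioms[of borel] that ca
    by (intro emeasure_measure_of_sigma) (auto simp: positive_def)
  have "emeasure ?M UNIV = ennreal (1 - t) + ennreal t"
    using em[of UNIV] prob_space.emeasure_space_1[OF prob_space_meas[of \<mu>]]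
      prob_space.emeasure_space_1[OF prob_space_meas[of \<nu>]] by simp
  also have "\<dots> = 1" using t by (simp flip: ennreal_plus)
  finally have "prob_space ?M" by (intro prob_spaceI) (simp add: space_measure_of_conv)
  then have "meas (mix t \<mu> \<nu>) = ?M"
    unfolding mix_def using sets by (intro Abs_torus_prob_inverse) simp
  then show ?thesis using em[OF A] by simp
qed


section \<open>Derivatives with respect to the measure\<close>

text \<open>\<open>is_flat_deriv \<Phi> D\<close>: \<open>\<Phi>\<close> is continuously differentiable with (normalised, hence unique)
  derivative \<open>D m x\<close>.\<close>

definition is_flat_deriv ::
    "('n::finite torus_prob \<Rightarrow> real) \<Rightarrow> ('n torus_prob \<Rightarrow> 'n torus \<Rightarrow> real) \<Rightarrow> bool" where
  "is_flat_deriv \<Phi> D \<longleftrightarrow>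
     continuous_on UNIV (\<lambda>(m, x). D m x) \<and>
     (\<forall>m\<^sub>1 m\<^sub>2. \<Phi> m\<^sub>2 - \<Phi> m\<^sub>1 =
        (LINT t:{0..1}|lborel.
          (\<integral>x. D (mix t m\<^sub>1 m\<^sub>2) x \<partial>meas m\<^sub>2) - (\<integral>x. D (mix t m\<^sub>1 m\<^sub>2) x \<partial>meas m\<^sub>1))) \<and>
     (\<forall>m. (\<integral>x. D m x \<partial>meas m) = 0)"

definition flat_C2 :: "('n::finite torus_prob \<Rightarrow> real) \<Rightarrow> bool" where
  "flat_C2 \<Phi> \<longleftrightarrow> (\<exists>D D2. is_flat_deriv \<Phi> D \<and>
     (\<forall>x. is_flat_deriv (\<lambda>m. D m x) (\<lambda>m y. D2 m x y)) \<and>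
     continuous_on UNIV (\<lambda>(m, x, y). D2 m x y))"


section \<open>Derivatives in the space variables\<close>

definition grad :: "(real ^ 'n::finite \<Rightarrow> real) \<Rightarrow> real ^ 'n \<Rightarrow> real ^ 'n" where
  "grad f v = (\<chi> i. frechet_derivative f (at v) (axis i 1))"

definition jacobian :: "(real ^ 'n::finite \<Rightarrow> real ^ 'n) \<Rightarrow> real ^ 'n \<Rightarrow> real ^ 'n ^ 'n" where
  "jacobian f v = matrix (frechet_derivative f (at v))"

definition hess :: "(real ^ 'n::finite \<Rightarrow> real) \<Rightarrow> real ^ 'n \<Rightarrow> real ^ 'n ^ 'n" where
  "hess f v = jacobian (grad f) v"

text \<open>Functions on the torus are differentiated through their periodic lifts.\<close>

abbreviation lift :: "('n::finite torus \<Rightarrow> 'b) \<Rightarrow> real ^ 'n \<Rightarrow> 'b" where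
  "lift f \<equiv> \<lambda>v. f (torus_proj v)"

definition tgrad :: "('n::finite torus \<Rightarrow> real) \<Rightarrow> 'n torus \<Rightarrow> real ^ 'n" where
  "tgrad f x = grad (lift f) (torus_rep x)"

definition thess :: "('n::finite torus \<Rightarrow> real) \<Rightarrow> 'n torus \<Rightarrow> real ^ 'n ^ 'n" where
  "thess f x = hess (lift f) (torus_rep x)"

definition tlaplace :: "('n::finite torus \<Rightarrow> real) \<Rightarrow> 'n torus \<Rightarrow> real" where
  "tlaplace f x = trace (thess f x)"

definition twice_differentiable :: "('n::finite torus \<Rightarrow> real) \<Rightarrow> bool" where
  "twice_differentiable f \<longleftrightarrow>
     (\<forall>v. lift f differentiable (at v)) \<and> (\<forall>v. grad (lift f) differentiable (at v))"

definition C2_fun :: "('a::real_normed_vector \<Rightarrow> real) \<Rightarrow> bool" where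
  "C2_fun f \<longleftrightarrow> (\<exists>(f' :: 'a \<Rightarrow> 'a \<Rightarrow>\<^sub>L real) (f'' :: 'a \<Rightarrow> 'a \<Rightarrow>\<^sub>L ('a \<Rightarrow>\<^sub>L real)).
     (\<forall>z. (f has_derivative blinfun_apply (f' z)) (at z)) \<and>
     (\<forall>z. (f' has_derivative blinfun_apply (f'' z)) (at z)) \<and>
     continuous_on UNIV f'')"

text \<open>In finite dimension this is \<open>C\<^sup>\<infinity>\<close>: all iterated directional derivatives exist and are
  again differentiable.\<close>

coinductive smooth_fun :: "('a::real_normed_vector \<Rightarrow> real) \<Rightarrow> bool" where
  "(\<And>z. f differentiable (at z)) \<Longrightarrow>
   (\<And>v. smooth_fun (\<lambda>z. frechet_derivative f (at z) v)) \<Longrightarrow> smooth_fun f"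

definition D_pp :: "('n::finite torus \<Rightarrow> real ^ 'n \<Rightarrow> real) \<Rightarrow> 'n torus \<Rightarrow> real ^ 'n \<Rightarrow> real ^ 'n ^ 'n"
  where "D_pp H x p = hess (\<lambda>q. H x q) p"

definition D_xx :: "('n::finite torus \<Rightarrow> real ^ 'n \<Rightarrow> real) \<Rightarrow> 'n torus \<Rightarrow> real ^ 'n \<Rightarrow> real ^ 'n ^ 'n"
  where "D_xx H x p = thess (\<lambda>y. H y p) x"

definition D_xp :: "('n::finite torus \<Rightarrow> real ^ 'n \<Rightarrow> real) \<Rightarrow> 'n torus \<Rightarrow> real ^ 'n \<Rightarrow> real ^ 'n ^ 'n"
  where "D_xp H x p = jacobian (\<lambda>q. tgrad (\<lambda>y. H y q) x) p"

text \<open>The order on symmetric matrices.\<close>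

definition matrix_le :: "real ^ 'n ^ 'n::finite \<Rightarrow> real ^ 'n ^ 'n \<Rightarrow> bool" where
  "matrix_le A B \<longleftrightarrow> (\<forall>\<xi>. \<xi> \<bullet> (A *v \<xi>) \<le> \<xi> \<bullet> (B *v \<xi>))"


section \<open>The control problem\<close>

definition Hstar :: "('n::finite torus \<Rightarrow> real ^ 'n \<Rightarrow> real) \<Rightarrow> 'n torus \<Rightarrow> real ^ 'n \<Rightarrow> real" where
  "Hstar H x q = (SUP p. p \<bullet> q - H x p)"

text \<open>For a time interval \<open>I\<close> of the form \<open>{0..}\<close> or \<open>{0..T}\<close>: smooth functions on time-space
  with compact support in \<open>[0, \<infinity>)\<close>, respectively \<open>[0, T)\<close>, times the torus.  They need not
  vanish at time \<open>0\<close>.\<close>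

definition test_fun :: "real set \<Rightarrow> (real \<Rightarrow> 'n::finite torus \<Rightarrow> real) \<Rightarrow> bool" where
  "test_fun I \<phi> \<longleftrightarrow>
     smooth_fun (\<lambda>(s, v). \<phi> s (torus_proj v)) \<and>
     (\<exists>a\<in>interior I. \<forall>s\<ge>a. \<forall>x. \<phi> s x = 0)"

text \<open>Continuous curves of measures solving \<open>- \<partial>\<^sub>t m + \<Delta> m + div (m \<alpha>) = 0\<close> in the sense of
  distributions on \<open>I\<close> times the torus, with \<open>m(0) = m\<^sub>0\<close>.\<close>

definition fp_solution ::
    "real set \<Rightarrow> 'n::finite torus_prob \<Rightarrow> (real \<Rightarrow> 'n torus_prob) \<Rightarrow>
     (real \<Rightarrow> 'n torus \<Rightarrow> real ^ 'n) \<Rightarrow> bool" where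
  "fp_solution I m\<^sub>0 m \<alpha> \<longleftrightarrow>
     continuous_on I m \<and> m 0 = m\<^sub>0 \<and>
     (\<forall>\<phi>. test_fun I \<phi> \<longrightarrow>
        (LINT s:I|lborel. (\<integral>x. deriv (\<lambda>r. \<phi> r x) s + tlaplace (\<phi> s) x
             - \<alpha> s x \<bullet> tgrad (\<phi> s) x \<partial>meas (m s)))
        + (\<integral>x. \<phi> 0 x \<partial>meas m\<^sub>0) = 0)"

text \<open>Admissible pairs \<open>(m, \<alpha>)\<close>, with the square integrability of \<open>\<alpha>\<close> weighted by \<open>w\<close> in time.\<close>

definition admissible ::
    "(real \<Rightarrow> real) \<Rightarrow> real set \<Rightarrow> 'n::finite torus_prob \<Rightarrow>
     ((real \<Rightarrow> 'n torus_prob) \<times> (real \<Rightarrow> 'n torus \<Rightarrow> real ^ 'n)) set" where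
  "admissible w I m\<^sub>0 = {(m, \<alpha>).
     (\<lambda>(s, x). \<alpha> s x) \<in> borel_measurable (restrict_space borel I \<Otimes>\<^sub>M borel) \<and>
     (\<integral>\<^sup>+s\<in>I. ennreal (w s) * (\<integral>\<^sup>+x. ennreal ((norm (\<alpha> s x))\<^sup>2) \<partial>meas (m s)) \<partial>lborel) < \<infinity> \<and>
     fp_solution I m\<^sub>0 m \<alpha>}"

definition running_cost ::
    "('n::finite torus \<Rightarrow> real ^ 'n \<Rightarrow> real) \<Rightarrow> ('n torus_prob \<Rightarrow> real) \<Rightarrow>
     'n torus_prob \<Rightarrow> ('n torus \<Rightarrow> real ^ 'n) \<Rightarrow> real" where
  "running_cost H \<F> \<mu> a = (\<integral>x. Hstar H x (a x) \<partial>meas \<mu>) + \<F> \<mu>"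

text \<open>The infimum is taken in the extended reals, so that it needs no side conditions.\<close>

definition value_fun ::
    "('n::finite torus \<Rightarrow> real ^ 'n \<Rightarrow> real) \<Rightarrow> ('n torus_prob \<Rightarrow> real) \<Rightarrow> real \<Rightarrow>
     'n torus_prob \<Rightarrow> ereal" where
  "value_fun H \<F> \<delta> m\<^sub>0 = (INF (m, \<alpha>) \<in> admissible (\<lambda>s. exp (- \<delta> * s)) {0..} m\<^sub>0.
     ereal (LINT s:{0..}|lborel. exp (- \<delta> * s) * running_cost H \<F> (m s) (\<alpha> s)))"

text \<open>Uniform convergence of extended real valued functions to a real valued function; it forces
  the approximating functions to be eventually finite.\<close>

definition uniformly_converges :: "(nat \<Rightarrow> 'a \<Rightarrow> ereal) \<Rightarrow> ('a \<Rightarrow> real) \<Rightarrow> bool" where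
  "uniformly_converges f g \<longleftrightarrow>
     (\<forall>\<epsilon>>0. \<forall>\<^sub>F n in sequentially. \<forall>x. \<bar>f n x - ereal (g x)\<bar> < ereal \<epsilon>)"

end

theory Submission
  imports Defs
begin

text \<open>The discounted problem satisfies the dynamic programming principle: \<open>V\<^sub>\<delta>(m\<^sub>0)\<close> is the infimum of
  \<open>\<integral>\<^sub>0\<^sup>t e\<^sup>-\<^sup>\<delta>\<^sup>s L ds + e\<^sup>-\<^sup>\<delta>\<^sup>t V\<^sub>\<delta>(m(t))\<close> over the controlled curves on \<open>[0, t]\<close>, where \<open>L\<close> is the running
  cost. Subtracting \<open>V\<^sub>\<delta>(\<eta>)\<close> on both sides turns \<open>V\<^sub>\<delta>\<close> into \<open>V\<^sub>\<delta> - V\<^sub>\<delta>(\<eta>)\<close>, which converges to \<open>\<chi>\<close>,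
  and leaves behind the term \<open>(1 - e\<^sup>-\<^sup>\<delta>\<^sup>t) V\<^sub>\<delta>(\<eta>) = ((1 - e\<^sup>-\<^sup>\<delta>\<^sup>t) / \<delta>) \<delta> V\<^sub>\<delta>(\<eta>)\<close>, which converges to
  \<open>- \<lambda> t\<close>. The limit of the principle is therefore the claim.

  The two inequalities pass to the limit for different reasons. In the upper one (\<open>dpp_upper\<close>) the
  curve on \<open>[0, t]\<close> is fixed and dominated convergence removes the discount. In the lower one the
  nearly optimal curves vary with \<open>\<delta>\<close>, so that every estimate has to be uniform over curves. The
  discount on \<open>[0, t]\<close> can be removed uniformly because \<open>L\<close> is bounded below
  (\<open>undiscounted_cost_le\<close>), and the convergence to \<open>\<chi>\<close> is uniform in the end point \<open>m(t)\<close>. Both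
  inequalities are combined in \<open>ergodic_dpp\<close>.

  The dynamic programming principle itself amounts to cutting and gluing weak solutions of the
  Fokker-Planck equation at time \<open>t\<close> (\<open>admissible_restrict\<close>, \<open>admissible_shift\<close>,
  \<open>admissible_concat\<close>). The test functions on \<open>[0, t)\<close> vanish before \<open>t\<close>, so the heart of the
  matter is the identity with a boundary term at time \<open>t\<close> for smooth functions that do not vanish
  there (\<open>fp_terminal\<close>). It follows by multiplying with smooth cutoffs in time that concentrate at \<open>t\<close>
  (\<open>smooth_cutoff\<close>).

  All splittings of time integrals need integrability. A continuous curve of measures is a measurable
  kernel (\<open>curve_kernel\<close>), and every integrand that occurs is dominated by a multiple of \<open>1 + |\<alpha>|\<^sup>2\<close>
  (\<open>flow_integrable\<close>). For the running cost this rests on the quadratic bound for \<open>H\<^sup>*\<close>, which follows from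
  the uniform convexity of \<open>H\<close> in \<open>p\<close> (\<open>hamiltonian_bounds\<close>, \<open>Hstar_bounds\<close>), and on the
  boundedness of the coupling cost (\<open>coupling_cost_regular\<close>).\<close>

section \<open>The torus\<close>

lemma torus_proj_rep [simp]: "torus_proj (torus_rep x) = x"
  using Quotient_abs_rep[OF Quotient_torus] .

text \<open>The compact unit cube contains a representative of every point, so continuous functions on the
  torus are bounded.\<close>

lemma torus_proj_cube: "\<exists>v\<in>cbox 0 (\<Sum>b\<in>Basis. b). torus_proj v = (x :: 'n::finite torus)"
proof -
  obtain a where a: "torus_proj a = x" using torus_proj_surj by blast
  define c where "c = (\<chi> i. frac (a $ i))"
  have "int_congruent c a" by (auto simp: int_congruent_def c_def frac_def)
  moreover have "c \<in> cbox 0 (\<Sum>b\<in>Basis. b)"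
  proof -
    have "(\<Sum>b\<in>Basis. b) = (\<chi> i. 1 :: real ^ 'n)"
      by (rule euclidean_eqI) (auto simp: inner_sum_left inner_Basis if_distrib cong: if_cong,
          auto simp: Basis_vec_def inner_axis)
    then show ?thesis
      by (auto simp: mem_box_cart c_def frac_lt_1 less_imp_le)
  qed
  ultimately show ?thesis using a by (metis torus_proj_eq_iff)
qed

lemma torus_proj_lift_near: "\<exists>b. torus_proj b = y \<and> dist a b = dist (torus_proj a) y"
  using dist_torus_attained[of y a] by (auto simp: torus_fibre_def)

text \<open>A point of the torus that is close to the image of \<open>a\<close> has a representative equally close to
  \<open>a\<close>, because the quotient distance is attained. Hence continuity can be tested on periodic lifts.\<close>

lemma continuous_on_lift:
  fixes f :: "'a::metric_space \<Rightarrow> 'n::finite torus \<Rightarrow> 'b::metric_space"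
  assumes "continuous_on (S \<times> UNIV) (\<lambda>(s, v). f s (torus_proj v))"
  shows "continuous_on (S \<times> UNIV) (\<lambda>(s, x). f s x)"
  unfolding continuous_on_iff
proof clarsimp
  fix s :: 'a and x :: "'n torus" and e :: real assume s: "s \<in> S" "0 < e"
  obtain a where a: "torus_proj a = x" using torus_proj_surj by blast
  obtain d where d: "d > 0" "\<And>s' v. s' \<in> S \<Longrightarrow> dist (s', v) (s, a) < d \<Longrightarrow>
      dist (f s' (torus_proj v)) (f s (torus_proj a)) < e"
    using assms s unfolding continuous_on_iff by (fastforce simp: Ball_def)
  show "\<exists>d>0. \<forall>s'\<in>S. \<forall>y. dist (s', y) (s, x) < d \<longrightarrow> dist (f s' y) (f s x) < e"
  proof (intro exI[of _ d] conjI ballI allI impI)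
    fix s' y assume s': "s' \<in> S" "dist (s', y) (s, x) < d"
    obtain b where b: "torus_proj b = y" "dist a b = dist x y"
      using torus_proj_lift_near[of y a] a by auto
    have "dist (s', b) (s, a) < d" using s' b by (simp add: dist_Pair_Pair dist_commute)
    from d(2)[OF s'(1) this] show "dist (f s' y) (f s x) < e" using a b by simp
  qed (rule d)
qed

lemma continuous_on_lift1:
  fixes f :: "'n::finite torus \<Rightarrow> 'b::metric_space"
  assumes "continuous_on UNIV (\<lambda>v. f (torus_proj v))"
  shows "continuous_on UNIV f"
proof -
  have "continuous_on (UNIV \<times> UNIV) (\<lambda>(s::real, v). f (torus_proj v))"
    unfolding split_beta by (intro continuous_on_compose2[OF assms] continuous_intros) auto
  from continuous_on_lift[OF this] have *: "continuous_on UNIV (\<lambda>z :: real \<times> 'n torus. f (snd z))"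
    by (simp add: split_beta)
  have "continuous_on UNIV (\<lambda>x. f (snd (0::real, x)))"
    by (rule continuous_on_compose2[OF *]) (auto intro!: continuous_intros)
  then show ?thesis by simp
qed

lemma lift_bounded:
  fixes f :: "'a::metric_space \<Rightarrow> 'n::finite torus \<Rightarrow> 'b::real_normed_vector"
  assumes cont: "continuous_on (S \<times> UNIV) (\<lambda>(s, v). f s (torus_proj v))" and S: "compact S"
  shows "\<exists>B>0. \<forall>s\<in>S. \<forall>x. norm (f s x) \<le> B"
proof -
  let ?C = "cbox (0::real^'n) (\<Sum>b\<in>Basis. b)"
  have "compact ((\<lambda>(s, v). f s (torus_proj v)) ` (S \<times> ?C))"
    by (intro compact_continuous_image continuous_on_subset[OF cont] compact_Times S compact_cbox) auto
  then obtain B where B: "B > 0" "\<And>y. y \<in> (\<lambda>(s, v). f s (torus_proj v)) ` (S \<times> ?C) \<Longrightarrow> norm y \<le> B"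
    using compact_imp_bounded bounded_pos by metis
  show ?thesis
  proof (intro exI[of _ B] conjI ballI allI)
    fix s and x :: "'n torus" assume "s \<in> S"
    moreover obtain v where "v \<in> ?C" "torus_proj v = x" using torus_proj_cube by blast
    ultimately show "norm (f s x) \<le> B" by (intro B(2)) force
  qed (rule B)
qed

text \<open>Rounding the first argument down to a multiple of \<open>1 / (k + 1)\<close> leaves countably many measurable
  slices, and continuity in that argument recovers \<open>f\<close> as \<open>k\<close> grows.\<close>

lemma caratheodory_measurable:
  fixes f :: "real \<Rightarrow> 'a::topological_space \<Rightarrow> 'b::metric_space"
  assumes cont: "\<And>x. continuous_on UNIV (\<lambda>s. f s x)"
    and meas: "\<And>s. f s \<in> borel_measurable borel"
  shows "(\<lambda>(s, x). f s x) \<in> borel_measurable (borel \<Otimes>\<^sub>M borel)"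
proof (rule borel_measurable_LIMSEQ_metric)
  let ?a = "\<lambda>k s. real_of_int \<lfloor>s * real (Suc k)\<rfloor> / real (Suc k)"
  have [measurable]: "(\<lambda>z. f (real_of_int i / c) (snd z)) \<in> borel_measurable (borel \<Otimes>\<^sub>M borel)"
    for i c by (rule measurable_compose[OF measurable_snd meas])
  show "(\<lambda>(s, x). f (?a k s) x) \<in> borel_measurable (borel \<Otimes>\<^sub>M borel)" for k
    unfolding split_beta
    by (rule measurable_compose_countable[where f = "\<lambda>i z. f (real_of_int i / real (Suc k)) (snd z)"
          and g = "\<lambda>z. \<lfloor>fst z * real (Suc k)\<rfloor>"]) measurable
  fix z :: "real \<times> 'a" assume "z \<in> space (borel \<Otimes>\<^sub>M borel)"
  obtain s x where z: "z = (s, x)" by (cases z)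
  have "(\<lambda>k. ?a k s) \<longlonglongrightarrow> s"
  proof (rule real_tendsto_sandwich)
    show "\<forall>\<^sub>F k in sequentially. s - 1 / real (Suc k) \<le> ?a k s"
    proof (rule always_eventually, rule allI)
      fix k
      have "s * real (Suc k) - 1 \<le> real_of_int \<lfloor>s * real (Suc k)\<rfloor>" by linarith
      then have "(s * real (Suc k) - 1) / real (Suc k) \<le> ?a k s"
        by (rule divide_right_mono) simp
      then show "s - 1 / real (Suc k) \<le> ?a k s" by (simp add: diff_divide_distrib)
    qed
    show "\<forall>\<^sub>F k in sequentially. ?a k s \<le> s"
      by (rule always_eventually) (simp add: divide_le_eq)
    show "(\<lambda>k. s - 1 / real (Suc k)) \<longlonglongrightarrow> s"
      using tendsto_diff[OF tendsto_const LIMSEQ_Suc[OF lim_1_over_n]] by simp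
  qed simp
  then have "(\<lambda>k. f (?a k s) x) \<longlonglongrightarrow> f s x"
    using cont[of x] continuous_on_tendsto_compose[of UNIV "\<lambda>s. f s x"] by simp
  then show "(\<lambda>k. (\<lambda>(s, x). f (?a k s) x) z) \<longlonglongrightarrow> (\<lambda>(s, x). f s x) z"
    by (simp add: z)
qed

section \<open>Curves of measures as kernels\<close>

text \<open>Rescaling extends the duality that defines the distance from \<open>1\<close>-Lipschitz to all Lipschitz
  functions.\<close>

lemma lipschitz_integral_diff:
  fixes \<phi> :: "'n::finite torus \<Rightarrow> real"
  assumes L: "\<And>x y. \<bar>\<phi> x - \<phi> y\<bar> \<le> L * dist x y" and "L > 0"
  shows "integrable (meas \<mu>) \<phi>" "\<bar>(\<integral>x. \<phi> x \<partial>meas \<mu>) - (\<integral>x. \<phi> x \<partial>meas \<nu>)\<bar> \<le> L * dist \<mu> \<nu>"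
proof -
  have lip: "(\<lambda>x. \<phi> x / L) \<in> lip1"
    unfolding lip1_def lipschitz_on_def mem_Collect_eq
  proof (intro conjI ballI)
    fix x y
    have "\<bar>\<phi> x - \<phi> y\<bar> / L \<le> dist x y" using L[of x y] \<open>L > 0\<close> by (simp add: divide_le_eq mult.commute)
    then show "dist (\<phi> x / L) (\<phi> y / L) \<le> 1 * dist x y"
      using \<open>L > 0\<close> by (simp add: dist_real_def flip: diff_divide_distrib)
  qed simp
  have *: "\<phi> = (\<lambda>x. L * (\<phi> x / L))" using \<open>L > 0\<close> by auto
  have "integrable (meas \<mu>) (\<lambda>x. L * (\<phi> x / L))" for \<mu>
    by (rule integrable_mult_right[OF lip1_integrable[OF lip]])
  then show "integrable (meas \<mu>) \<phi>" using \<open>L > 0\<close> by simp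
  have "(\<integral>x. \<phi> x / L \<partial>meas \<mu>) - (\<integral>x. \<phi> x / L \<partial>meas \<nu>) \<le> dist \<mu> \<nu>"
    "(\<integral>x. \<phi> x / L \<partial>meas \<nu>) - (\<integral>x. \<phi> x / L \<partial>meas \<mu>) \<le> dist \<mu> \<nu>"
    using lip1_le_dist[OF lip, of \<mu> \<nu>] lip1_le_dist[OF lip, of \<nu> \<mu>] by (auto simp: dist_commute)
  then have "\<bar>(\<integral>x. \<phi> x \<partial>meas \<mu>) / L - (\<integral>x. \<phi> x \<partial>meas \<nu>) / L\<bar> \<le> dist \<mu> \<nu>" by simp
  then show "\<bar>(\<integral>x. \<phi> x \<partial>meas \<mu>) - (\<integral>x. \<phi> x \<partial>meas \<nu>)\<bar> \<le> L * dist \<mu> \<nu>"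
    using \<open>L > 0\<close> by (simp add: divide_le_eq mult.commute flip: diff_divide_distrib)
qed

text \<open>The indicator of \<open>C\<close> is the limit of the Lipschitz functions \<open>max 0 (1 - k d(x, C))\<close>, and
  the integrals of those are continuous along the curve.\<close>

lemma measure_closed_measurable:
  fixes m :: "real \<Rightarrow> 'n::finite torus_prob"
  assumes m: "continuous_on I m" and C: "closed C" "C \<noteq> {}"
  shows "(\<lambda>s. measure (meas (m s)) C) \<in> borel_measurable (restrict_space borel I)"
proof (rule borel_measurable_LIMSEQ_real)
  define f where "f k x = max 0 (1 - real (Suc k) * infdist x C)" for k and x :: "'n torus"
  have [measurable]: "f k \<in> borel_measurable borel" for k
    unfolding f_def by (intro borel_measurable_continuous_onI continuous_intros)
  have lip: "\<bar>f k x - f k y\<bar> \<le> real (Suc k) * dist x y" for k x y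
  proof -
    have "\<bar>f k x - f k y\<bar> \<le> \<bar>real (Suc k) * infdist x C - real (Suc k) * infdist y C\<bar>"
      unfolding f_def by linarith
    also have "\<dots> = real (Suc k) * \<bar>infdist x C - infdist y C\<bar>"
      by (simp add: abs_mult flip: right_diff_distrib)
    also have "\<dots> \<le> real (Suc k) * dist x y"
      by (intro mult_left_mono infdist_triangle_abs) auto
    finally show ?thesis .
  qed
  have "continuous_on I (\<lambda>s. \<integral>x. f k x \<partial>meas (m s))" for k
  proof -
    have "continuous_on UNIV (\<lambda>\<mu> :: 'n torus_prob. \<integral>x. f k x \<partial>meas \<mu>)"
    proof -
      have "(real (Suc k))-lipschitz_on UNIV (\<lambda>\<mu> :: 'n torus_prob. \<integral>x. f k x \<partial>meas \<mu>)"
        using lipschitz_integral_diff(2)[OF lip, of k]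
        unfolding lipschitz_on_def dist_real_def by simp
      then show ?thesis by (rule lipschitz_on_continuous_on)
    qed
    from continuous_on_compose2[OF this m] show ?thesis by simp
  qed
  then show "(\<lambda>s. \<integral>x. f k x \<partial>meas (m s)) \<in> borel_measurable (restrict_space borel I)" for k
    by (rule borel_measurable_continuous_on_restrict)
  have lim: "(\<lambda>k. f k x) \<longlonglongrightarrow> indicator C x" for x
  proof (cases "x \<in> C")
    case True then show ?thesis by (simp add: f_def)
  next
    case False
    then have pos: "infdist x C > 0"
      using C infdist_nonneg[of x C] in_closed_iff_infdist_zero[of C x] by fastforce
    have "filterlim (\<lambda>k. real (Suc k)) at_top sequentially"
      by (rule filterlim_compose[OF filterlim_real_sequentially filterlim_Suc])
    then have "\<forall>\<^sub>F k in sequentially. 1 / infdist x C \<le> real (Suc k)"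
      unfolding filterlim_at_top by blast
    then have "\<forall>\<^sub>F k in sequentially. f k x = 0"
      by eventually_elim (use pos in \<open>simp add: f_def divide_le_eq\<close>)
    then show ?thesis using False by (auto intro: tendsto_eventually)
  qed
  fix s
  interpret prob_space "meas (m s)" by (rule prob_space_meas)
  have [measurable]: "C \<in> sets borel" using C by auto
  have "(\<lambda>k. \<integral>x. f k x \<partial>meas (m s)) \<longlonglongrightarrow> (\<integral>x. indicator C x \<partial>meas (m s))"
  proof (rule integral_dominated_convergence[where w = "\<lambda>_. 1"])
    show "AE x in meas (m s). norm (f k x) \<le> 1" for k
      by (simp add: f_def infdist_nonneg)
  qed (use lim in auto)
  then show "(\<lambda>k. \<integral>x. f k x \<partial>meas (m s)) \<longlonglongrightarrow> measure (meas (m s)) C" by simp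
qed

text \<open>The closed sets generate the Borel sets and are stable under intersection, so it is enough that
  their masses are measurable in time. Integrals over space are then measurable functions of time.\<close>

lemma curve_kernel:
  fixes m :: "real \<Rightarrow> 'n::finite torus_prob"
  assumes m: "continuous_on I m"
  shows "(\<lambda>s. meas (m s)) \<in> restrict_space borel I \<rightarrow>\<^sub>M subprob_algebra borel"
proof (rule measurable_subprob_algebra_generated[where G = "Collect closed" and \<Omega> = UNIV])
  show "sets (borel :: 'n torus measure) = sigma_sets UNIV (Collect closed)"
    by (subst borel_eq_closed) simp
  show "Int_stable (Collect (closed :: 'n torus set \<Rightarrow> bool))" by (auto simp: Int_stable_def)
  show "subprob_space (meas (m s))" for s
    by (rule prob_space_imp_subprob_space[OF prob_space_meas])
  have em: "emeasure (meas (m s)) A = ennreal (measure (meas (m s)) A)" for s A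
  proof -
    interpret prob_space "meas (m s)" by (rule prob_space_meas)
    show ?thesis by (rule emeasure_eq_measure)
  qed
  show *: "(\<lambda>s. emeasure (meas (m s)) A) \<in> borel_measurable (restrict_space borel I)"
    if "A \<in> Collect closed" for A
    unfolding em using measure_closed_measurable[OF m] that by (cases "A = {}") auto
  show "(\<lambda>s. emeasure (meas (m s)) UNIV) \<in> borel_measurable (restrict_space borel I)"
    by (rule *) simp
qed auto

lemma curve_energy_measurable:
  fixes m :: "real \<Rightarrow> 'n::finite torus_prob" and \<alpha> :: "real \<Rightarrow> 'n torus \<Rightarrow> real ^ 'n"
  assumes "continuous_on I m" "I \<in> sets borel"
    and "(\<lambda>(s, x). \<alpha> s x) \<in> borel_measurable (restrict_space borel I \<Otimes>\<^sub>M borel)"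
  shows "(\<lambda>s. (\<integral>\<^sup>+x. ennreal ((norm (\<alpha> s x))\<^sup>2) \<partial>meas (m s)) * indicator I s) \<in> borel_measurable borel"
proof -
  have "(\<lambda>s. \<integral>\<^sup>+x. ennreal ((norm (\<alpha> s x))\<^sup>2) \<partial>meas (m s)) \<in> borel_measurable (restrict_space borel I)"
    by (rule nn_integral_measurable_subprob_algebra2[OF _ curve_kernel[OF assms(1)]])
       (use assms(3) in measurable)
  then show ?thesis using assms(2) by (simp add: borel_measurable_restrict_space_iff_ennreal)
qed

lemma curve_integral_measurable:
  fixes m :: "real \<Rightarrow> 'n::finite torus_prob" and f :: "real \<Rightarrow> 'n torus \<Rightarrow> real"
  assumes "continuous_on I m"
    and "(\<lambda>(s, x). f s x) \<in> borel_measurable (restrict_space borel I \<Otimes>\<^sub>M borel)"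
  shows "(\<lambda>s. \<integral>x. f s x \<partial>meas (m s)) \<in> borel_measurable (restrict_space borel I)"
proof -
  let ?M = "restrict_space borel I :: real measure"
  note [measurable] = assms(2) curve_kernel[OF assms(1)] integral_measurable_subprob_algebra measurable_distr2
  have "(\<lambda>s. \<integral>z. (\<lambda>(s, x). f s x) z \<partial>distr (meas (m s)) (?M \<Otimes>\<^sub>M borel) (\<lambda>x. (s, x))) \<in> borel_measurable ?M"
    by measurable
  then show ?thesis
    by (rule measurable_cong[THEN iffD1, rotated]) (use assms(2) in \<open>simp add: integral_distr\<close>)
qed

text \<open>Both the running cost and the Fokker-Planck operator applied to a test function grow at most
  quadratically in the control. The energy bound in the definition of an admissible pair therefore
  makes them integrable in time, and in space at almost every time. The weight \<open>w\<close> is \<open>1\<close> on bounded time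
  intervals and the discount factor on the half line.\<close>

lemma flow_integrable:
  fixes m :: "real \<Rightarrow> 'n::finite torus_prob" and f :: "real \<Rightarrow> 'n torus \<Rightarrow> real"
    and \<alpha> :: "real \<Rightarrow> 'n torus \<Rightarrow> real ^ 'n" and w :: "real \<Rightarrow> real"
  assumes m: "continuous_on I m" and I [measurable]: "I \<in> sets borel"
    and \<alpha>: "(\<lambda>(s, x). \<alpha> s x) \<in> borel_measurable (restrict_space borel I \<Otimes>\<^sub>M borel)"
    and f: "(\<lambda>(s, x). f s x) \<in> borel_measurable (restrict_space borel I \<Otimes>\<^sub>M borel)"
    and bound: "\<And>s x. s \<in> I \<Longrightarrow> \<bar>f s x\<bar> \<le> K * (1 + (norm (\<alpha> s x))\<^sup>2)"
    and w: "\<And>s. s \<in> I \<Longrightarrow> w s > 0" "set_integrable lborel I w"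
    and fin: "(\<integral>\<^sup>+s\<in>I. ennreal (w s) * (\<integral>\<^sup>+x. ennreal ((norm (\<alpha> s x))\<^sup>2) \<partial>meas (m s)) \<partial>lborel) < \<infinity>"
  shows "set_integrable lborel I (\<lambda>s. w s * (\<integral>x. f s x \<partial>meas (m s)))"
    and "AE s in lborel. s \<in> I \<longrightarrow> integrable (meas (m s)) (f s)"
proof -
  define A where "A s = (\<integral>\<^sup>+x. ennreal ((norm (\<alpha> s x))\<^sup>2) \<partial>meas (m s))" for s
  have K: "K \<ge> 0" if "s \<in> I" for s
  proof -
    have "0 \<le> K * (1 + (norm (\<alpha> s undefined))\<^sup>2)" using bound[OF that, of undefined] by linarith
    moreover have "0 < 1 + (norm (\<alpha> s undefined))\<^sup>2" by (simp add: add_pos_nonneg)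
    ultimately show ?thesis by (simp add: zero_le_mult_iff)
  qed
  have sec: "\<alpha> s \<in> borel_measurable borel" "f s \<in> borel_measurable borel" if "s \<in> I" for s
    using measurable_compose[OF measurable_Pair1' \<alpha>, of s] measurable_compose[OF measurable_Pair1' f, of s] that
    by (auto simp: space_restrict_space)
  have wm: "(\<lambda>s. indicator I s * w s) \<in> borel_measurable borel"
    using w(2) unfolding set_integrable_def by (simp add: borel_measurable_integrable)
  have AIm: "(\<lambda>s. A s * indicator I s) \<in> borel_measurable borel"
    unfolding A_def by (rule curve_energy_measurable[OF m I \<alpha>])
  have wAm: "(\<lambda>s. ennreal (w s) * A s * indicator I s) \<in> borel_measurable lborel"
  proof -
    have "(\<lambda>s. ennreal (w s) * A s * indicator I s) = (\<lambda>s. ennreal (indicator I s * w s) * (A s * indicator I s))"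
      by (auto simp: fun_eq_iff indicator_def)
    also have "\<dots> \<in> borel_measurable lborel" using wm AIm by simp
    finally show ?thesis .
  qed
  have fin': "(\<integral>\<^sup>+s. ennreal (w s) * A s * indicator I s \<partial>lborel) < \<infinity>" using fin by (simp add: A_def)
  have "AE s in lborel. ennreal (w s) * A s * indicator I s \<noteq> \<infinity>"
    by (rule nn_integral_PInf_AE[OF wAm]) (use fin' in auto)
  then have Afin: "AE s in lborel. s \<in> I \<longrightarrow> A s < \<infinity>"
  proof eventually_elim
    case (elim s)
    then show ?case using w(1)[of s]
      by (auto simp: ennreal_mult_eq_top_iff top.not_eq_extremum)
  qed
  have int2: "integrable (meas (m s)) (\<lambda>x. (norm (\<alpha> s x))\<^sup>2)" if "s \<in> I" "A s < \<infinity>" for s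
    using that sec[of s] by (intro integrableI_bounded) (auto simp: A_def)
  have intf: "integrable (meas (m s)) (f s)" if "s \<in> I" "A s < \<infinity>" for s
  proof -
    interpret prob_space "meas (m s)" by (rule prob_space_meas)
    show ?thesis
      by (rule Bochner_Integration.integrable_bound[where f = "\<lambda>x. K * (1 + (norm (\<alpha> s x))\<^sup>2)"])
        (use that sec[of s] bound[of s] int2[of s] in \<open>auto intro!: AE_I2 order_trans[OF bound abs_ge_self]\<close>)
  qed
  show "AE s in lborel. s \<in> I \<longrightarrow> integrable (meas (m s)) (f s)"
    using Afin by eventually_elim (use intf in auto)
  have bd: "ennreal \<bar>w s * (\<integral>x. f s x \<partial>meas (m s))\<bar> \<le> ennreal (K * w s) + ennreal K * (ennreal (w s) * A s)"
    if "s \<in> I" "A s < \<infinity>" for s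
  proof -
    interpret prob_space "meas (m s)" by (rule prob_space_meas)
    have "\<bar>\<integral>x. f s x \<partial>meas (m s)\<bar> \<le> (\<integral>x. \<bar>f s x\<bar> \<partial>meas (m s))" by (rule integral_abs_bound)
    also have "\<dots> \<le> (\<integral>x. K * (1 + (norm (\<alpha> s x))\<^sup>2) \<partial>meas (m s))"
      by (rule integral_mono) (use that int2[of s] intf[of s] bound[of s] in auto)
    also have "\<dots> = K * (1 + (\<integral>x. (norm (\<alpha> s x))\<^sup>2 \<partial>meas (m s)))"
      using int2[of s] that prob_space by simp
    also have "(\<integral>x. (norm (\<alpha> s x))\<^sup>2 \<partial>meas (m s)) = enn2real (A s)"
      unfolding A_def by (rule integral_eq_nn_integral) (use sec[of s] that in auto)
    finally have "\<bar>w s * (\<integral>x. f s x \<partial>meas (m s))\<bar> \<le> w s * (K * (1 + enn2real (A s)))"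
      using w(1)[OF that(1)] by (simp add: abs_mult)
    also have "\<dots> = K * w s + K * (w s * enn2real (A s))" by (simp add: algebra_simps)
    finally have "ennreal \<bar>w s * (\<integral>x. f s x \<partial>meas (m s))\<bar> \<le> ennreal (K * w s + K * (w s * enn2real (A s)))"
      by (rule ennreal_leI)
    also have "\<dots> = ennreal (K * w s) + ennreal K * (ennreal (w s) * A s)"
      using w(1)[OF that(1)] K[OF that(1)] that(2)
      by (simp add: ennreal_plus ennreal_mult')
    finally show ?thesis .
  qed
  show "set_integrable lborel I (\<lambda>s. w s * (\<integral>x. f s x \<partial>meas (m s)))"
    unfolding set_integrable_def
  proof (rule integrableI_bounded)
    have "(\<lambda>s. indicator I s *\<^sub>R (\<integral>x. f s x \<partial>meas (m s))) \<in> borel_measurable borel"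
      using curve_integral_measurable[OF m f] by (simp add: borel_measurable_restrict_space_iff)
    with wm have "(\<lambda>s. (indicator I s * w s) * (indicator I s *\<^sub>R (\<integral>x. f s x \<partial>meas (m s)))) \<in> borel_measurable borel"
      by measurable
    also have "(\<lambda>s. (indicator I s * w s) * (indicator I s *\<^sub>R (\<integral>x. f s x \<partial>meas (m s)))) =
       (\<lambda>s. indicator I s *\<^sub>R (w s * (\<integral>x. f s x \<partial>meas (m s))))" by (auto simp: fun_eq_iff indicator_def)
    finally show "(\<lambda>s. indicator I s *\<^sub>R (w s * (\<integral>x. f s x \<partial>meas (m s)))) \<in> borel_measurable lborel"
      by simp
    have "(\<integral>\<^sup>+ s. ennreal (norm (indicator I s *\<^sub>R (w s * (\<integral>x. f s x \<partial>meas (m s))))) \<partial>lborel)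
       \<le> (\<integral>\<^sup>+ s. ennreal (norm (K * (indicator I s * w s))) + ennreal K * (ennreal (w s) * A s * indicator I s) \<partial>lborel)"
    proof (rule nn_integral_mono_AE, use Afin in eventually_elim)
      case (elim s)
      show ?case using elim bd[of s] w(1)[of s] K[of s] by (auto simp: indicator_def)
    qed
    also have "\<dots> = (\<integral>\<^sup>+ s. ennreal (norm (K * (indicator I s * w s))) \<partial>lborel)
        + ennreal K * (\<integral>\<^sup>+ s. ennreal (w s) * A s * indicator I s \<partial>lborel)"
      using wm wAm by (subst nn_integral_add) (auto simp: nn_integral_cmult)
    also have "\<dots> < \<infinity>"
    proof -
      have "integrable lborel (\<lambda>s. K * (indicator I s * w s))"
        using w(2) by (simp add: set_integrable_def)
      then have "(\<integral>\<^sup>+ s. ennreal (norm (K * (indicator I s * w s))) \<partial>lborel) < \<infinity>"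
        unfolding integrable_iff_bounded by blast
      then show ?thesis using fin' by (simp add: ennreal_mult_less_top)
    qed
    finally show "(\<integral>\<^sup>+ s. ennreal (norm (indicator I s *\<^sub>R (w s * (\<integral>x. f s x \<partial>meas (m s))))) \<partial>lborel) < \<infinity>" .
  qed
qed

section \<open>Smooth functions\<close>

text \<open>Fixing the direction makes the derivative a scalar function of the base point, to which the same
  operation applies again.\<close>

definition dird :: "'a::real_normed_vector \<Rightarrow> ('a \<Rightarrow> real) \<Rightarrow> 'a \<Rightarrow> real" where
  "dird w f z = frechet_derivative f (at z) w"

lemma has_derivative_dird:
  "f differentiable (at z) \<Longrightarrow> (f has_derivative (\<lambda>w. dird w f z)) (at z)"
  unfolding dird_def frechet_derivative_works .

lemma dird_eqI: "(f has_derivative f') (at z) \<Longrightarrow> dird w f z = f' w"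
  unfolding dird_def using frechet_derivative_at by metis

lemma smooth_fun_differentiable: "smooth_fun f \<Longrightarrow> f differentiable (at z)"
  by (erule smooth_fun.cases) blast

lemma smooth_fun_dird: "smooth_fun f \<Longrightarrow> smooth_fun (dird w f)"
  unfolding dird_def by (erule smooth_fun.cases) blast

lemma smooth_funI:
  assumes "\<And>z. f differentiable (at z)" "\<And>w. smooth_fun (dird w f)"
  shows "smooth_fun f"
  using assms unfolding dird_def by (rule smooth_fun.intros)

lemma smooth_fun_has_derivative: "smooth_fun f \<Longrightarrow> (f has_derivative (\<lambda>w. dird w f z)) (at z)"
  by (intro has_derivative_dird smooth_fun_differentiable)

lemma smooth_fun_continuous: "smooth_fun f \<Longrightarrow> continuous_on UNIV f"
  by (intro continuous_at_imp_continuous_on ballI)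
     (rule has_derivative_continuous[OF smooth_fun_has_derivative])

lemma smooth_fun_coinduct:
  assumes "X f" and "\<And>g z. X g \<Longrightarrow> g differentiable (at z)"
    and "\<And>g w. X g \<Longrightarrow> X (dird w g)"
  shows "smooth_fun f"
  using assms(1)
proof (coinduction arbitrary: f rule: smooth_fun.coinduct)
  case (smooth_fun f)
  have "\<And>z. f differentiable (at z)" "\<And>w. X (\<lambda>z. frechet_derivative f (at z) w)"
    using assms(2,3)[OF smooth_fun] unfolding dird_def by auto
  then show ?case by blast
qed

lemma dird_affine:
  assumes "smooth_fun f" "bounded_linear L"
  shows "((\<lambda>z. f (L z + c)) has_derivative (\<lambda>w. dird (L w) f (L z + c))) (at z)"
proof -
  have L: "((\<lambda>z. L z + c) has_derivative L) (at z)"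
    by (rule has_derivative_add_const[OF bounded_linear_imp_has_derivative[OF assms(2)]])
  show ?thesis
    by (rule has_derivative_compose[OF L smooth_fun_has_derivative[OF assms(1)]])
qed

lemma smooth_fun_affine:
  assumes "smooth_fun f" "bounded_linear L"
  shows "smooth_fun (\<lambda>z. f (L z + c))"
proof (rule smooth_fun_coinduct[where X = "\<lambda>h. \<exists>f. smooth_fun f \<and> h = (\<lambda>z. f (L z + c))"])
  fix g and z assume "\<exists>f. smooth_fun f \<and> g = (\<lambda>z. f (L z + c))"
  then show "g differentiable at z" using dird_affine[OF _ assms(2)] differentiable_def by blast
next
  fix g w assume "\<exists>f. smooth_fun f \<and> g = (\<lambda>z. f (L z + c))"
  then obtain f where f: "smooth_fun f" "g = (\<lambda>z. f (L z + c))" by blast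
  have "dird w g = (\<lambda>z. dird (L w) f (L z + c))"
    unfolding f(2) by (rule ext, rule dird_eqI[OF dird_affine[OF f(1) assms(2)]])
  then show "\<exists>f. smooth_fun f \<and> dird w g = (\<lambda>z. f (L z + c))"
    using smooth_fun_dird[OF f(1)] by blast
qed (use assms in blast)

text \<open>Differentiating a product of smooth functions gives a sum of products, so products alone are not
  an invariant for coinduction. The algebra generated by the smooth functions is one.\<close>

inductive smooth_alg :: "('a::real_normed_vector \<Rightarrow> real) \<Rightarrow> bool" where
  base: "smooth_fun f \<Longrightarrow> smooth_alg f"
| add: "smooth_alg f \<Longrightarrow> smooth_alg g \<Longrightarrow> smooth_alg (\<lambda>z. f z + g z)"
| mult: "smooth_alg f \<Longrightarrow> smooth_alg g \<Longrightarrow> smooth_alg (\<lambda>z. f z * g z)"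

lemma smooth_alg_derivative:
  assumes "smooth_alg f"
  shows "f differentiable (at z) \<and> smooth_alg (dird w f)"
  using assms
proof (induction arbitrary: z rule: smooth_alg.induct)
  case (base f)
  then show ?case by (auto intro: smooth_fun_differentiable smooth_fun_dird smooth_alg.base)
next
  case (add f g)
  have "dird w (\<lambda>z. f z + g z) = (\<lambda>z. dird w f z + dird w g z)"
    by (rule ext, rule dird_eqI[OF has_derivative_add[OF has_derivative_dird has_derivative_dird]])
       (use add in auto)
  then show ?case using add by (auto intro: smooth_alg.add)
next
  case (mult f g)
  have "dird w (\<lambda>z. f z * g z) = (\<lambda>z. f z * dird w g z + dird w f z * g z)"
    by (rule ext, rule dird_eqI[OF has_derivative_mult[OF has_derivative_dird has_derivative_dird]])
       (use mult in auto)
  then have "smooth_alg (dird w (\<lambda>z. f z * g z))"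
    using mult by (simp add: smooth_alg.add smooth_alg.mult)
  then show ?case using mult by simp
qed

lemma smooth_fun_mult:
  assumes "smooth_fun f" "smooth_fun g"
  shows "smooth_fun (\<lambda>z. f z * g z)"
  by (rule smooth_fun_coinduct[where X = smooth_alg])
     (use smooth_alg_derivative assms in \<open>auto intro: smooth_alg.intros\<close>)

lemma smooth_fun_const: "smooth_fun (\<lambda>z. c)"
  by (rule smooth_fun_coinduct[where X = "\<lambda>h. \<exists>c. h = (\<lambda>z. c)"])
     (force simp: dird_def)+

section \<open>A smooth cutoff\<close>

text \<open>For \<open>p = 1\<close> this is the classical flat function \<open>exp (- 1 / x)\<close>. The family over all polynomials is
  closed under differentiation, including at the origin, and this makes it smooth.\<close>

definition flat :: "real poly \<Rightarrow> real \<Rightarrow> real" where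
  "flat p x = (if x > 0 then poly p (1 / x) * exp (- (1 / x)) else 0)"

text \<open>The additional power of \<open>y\<close> absorbs the factor that appears when the induction splits off a
  coefficient of \<open>p\<close>.\<close>

lemma poly_exp_decay: "((\<lambda>y::real. y ^ k * poly p y * exp (- y)) \<longlongrightarrow> 0) at_top"
proof (induction p arbitrary: k)
  case 0 then show ?case by simp
next
  case (pCons a p)
  have "((\<lambda>y::real. a * (y ^ k / exp y) + y ^ Suc k * poly p y * exp (- y)) \<longlongrightarrow> a * 0 + 0) at_top"
    by (intro tendsto_intros pCons tendsto_power_div_exp_0)
  moreover have "a * (y ^ k / exp y) + y ^ Suc k * poly p y * exp (- y)
      = y ^ k * poly (pCons a p) y * exp (- y)" for y :: real
    by (simp add: exp_minus field_simps)
  ultimately show ?case by simp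
qed

lemma flat_has_derivative:
  "(flat p has_real_derivative flat (pCons 0 (pCons 0 (p - pderiv p))) x) (at x)"
proof -
  consider "x > 0" | "x < 0" | "x = 0" by linarith
  then show ?thesis
  proof cases
    case 1
    have "((\<lambda>x. poly p (1 / x) * exp (- (1 / x))) has_real_derivative
        flat (pCons 0 (pCons 0 (p - pderiv p))) x) (at x)"
    proof -
      have inv: "((\<lambda>x. 1 / x) has_real_derivative - (1 / x\<^sup>2)) (at x)"
        using 1 by (auto intro!: derivative_eq_intros simp: power2_eq_square)
      have "((\<lambda>x. poly p (1 / x) * exp (- (1 / x))) has_real_derivative
          (poly (pderiv p) (1 / x) * - (1 / x\<^sup>2)) * exp (- (1 / x))
          + (exp (- (1 / x)) * - (- (1 / x\<^sup>2))) * poly p (1 / x)) (at x)"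
        by (intro DERIV_mult DERIV_chain2[OF poly_DERIV inv] DERIV_chain2[OF DERIV_exp] DERIV_minus inv)
      then show ?thesis
        using 1 by (simp add: flat_def algebra_simps power2_eq_square)
    qed
    then show ?thesis
      by (rule has_field_derivative_transform_within_open[where S = "{0<..}"])
         (use 1 in \<open>auto simp: flat_def\<close>)
  next
    case 2
    have "((\<lambda>x. 0) has_real_derivative flat (pCons 0 (pCons 0 (p - pderiv p))) x) (at x)"
      using 2 by (simp add: flat_def)
    then show ?thesis
      by (rule has_field_derivative_transform_within_open[where S = "{..<0}"])
         (use 2 in \<open>auto simp: flat_def\<close>)
  next
    case 3
    have right: "((\<lambda>h. flat p h / h) \<longlongrightarrow> 0) (at_right 0)"
    proof -
      have "filterlim (\<lambda>h::real. 1 / h) at_top (at_right 0)"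
        using filterlim_inverse_at_top_right by (simp add: inverse_eq_divide)
      from filterlim_compose[OF poly_exp_decay[of 1 p] this]
      have "((\<lambda>h::real. (1 / h) ^ 1 * poly p (1 / h) * exp (- (1 / h))) \<longlongrightarrow> 0) (at_right 0)" .
      then show ?thesis
        by (rule Lim_transform_eventually)
           (auto simp: flat_def eventually_at_filter)
    qed
    have left: "((\<lambda>h. flat p h / h) \<longlongrightarrow> 0) (at_left 0)"
      by (rule tendsto_eventually) (auto simp: flat_def eventually_at_filter)
    have "((\<lambda>h. flat p h / h) \<longlongrightarrow> 0) (at 0)"
      using left right by (simp add: filterlim_at_split)
    then show ?thesis using 3 by (simp add: DERIV_def flat_def[of _ 0])
  qed
qed

lemma smooth_flat: "smooth_fun (flat p)"
proof (rule smooth_fun_coinduct[where X = "\<lambda>h. \<exists>p. h = flat p"])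
  fix g :: "real \<Rightarrow> real" and z :: real assume "\<exists>p. g = flat p"
  then show "g differentiable at z"
    using flat_has_derivative real_differentiable_def by blast
next
  fix g and w :: real assume "\<exists>p. g = flat p"
  then obtain p where g: "g = flat p" by blast
  have "dird w (flat p) = flat (smult w (pCons 0 (pCons 0 (p - pderiv p))))"
  proof
    fix z
    have "dird w (flat p) z = flat (pCons 0 (pCons 0 (p - pderiv p))) z * w"
      by (rule dird_eqI) (use flat_has_derivative[of p z] in \<open>simp add: has_field_derivative_def\<close>)
    also have "\<dots> = flat (smult w (pCons 0 (pCons 0 (p - pderiv p)))) z"
      by (simp add: flat_def)
    finally show "dird w (flat p) z = flat (smult w (pCons 0 (pCons 0 (p - pderiv p)))) z" .
  qed
  then show "\<exists>p. dird w g = flat p" using g by blast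
qed blast

text \<open>\<open>R\<close> is an antiderivative of a nonpositive bump \<open>r\<close> on \<open>[-2, -1]\<close>, normalised to decrease from
  \<open>1\<close> to \<open>0\<close>. Obtaining \<open>R\<close> by integration makes the sign and the support of its derivative
  evident; after rescaling, \<open>- r\<close> is an approximate unit mass.\<close>

lemma smooth_cutoff:
  obtains R r :: "real \<Rightarrow> real" where "smooth_fun R" "\<And>x. (R has_real_derivative r x) (at x)"
    "continuous_on UNIV r" "\<And>x. r x \<le> 0" "\<And>x. x \<notin> {-2<..<-1} \<Longrightarrow> r x = 0"
    "\<And>x. x \<le> -2 \<Longrightarrow> R x = 1" "\<And>x. x \<ge> -1 \<Longrightarrow> R x = 0"
    "\<And>x. 0 \<le> R x" "\<And>x. R x \<le> 1"
proof -
  define b where "b x = flat 1 (x + 2) * flat 1 (- x + (- 1))" for x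
  have b: "smooth_fun b"
    unfolding b_def
    by (intro smooth_fun_mult smooth_fun_affine[OF smooth_flat] bounded_linear_minus bounded_linear_ident)
  have b_pos: "b x > 0" if "x \<in> {-2<..<-1}" for x using that by (simp add: b_def flat_def)
  have b_zero: "b x = 0" if "x \<notin> {-2<..<-1}" for x using that by (auto simp: b_def flat_def)
  have b_nonneg: "b x \<ge> 0" for x using b_pos[of x] b_zero[of x] by (cases "x \<in> {-2<..<-1}") auto
  have cb: "continuous_on UNIV b" using smooth_fun_continuous[OF b] .
  then have "isCont b x" for x by (simp add: continuous_on_eq_continuous_at)
  then obtain B where B: "\<And>x. (B has_real_derivative b x) (at x)"
    using einterval_antiderivative[of "- \<infinity>" "\<infinity>" b]
    unfolding has_real_derivative_iff_has_vector_derivative by auto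
  define c where "c = B (-1) - B (-2)"
  have c: "c > 0"
  proof -
    have "B (-2) < B (-1)"
      by (rule DERIV_pos_imp_increasing_open)
         (use B b_pos in \<open>auto intro!: DERIV_continuous_on[OF has_field_derivative_at_within]\<close>)
    then show ?thesis by (simp add: c_def)
  qed
  have const: "B x = B y" if "\<And>z. z \<in> {x<..<y} \<Longrightarrow> b z = 0" "x \<le> y" for x y
  proof (cases "x = y")
    case False
    then have "x < y" using that by simp
    have der: "(B has_real_derivative 0) (at z)" if "x < z" "z < y" for z
      using B[of z] \<open>\<And>z. z \<in> {x<..<y} \<Longrightarrow> b z = 0\<close>[of z] that by simp
    have "continuous_on {x..y} B"
      by (rule DERIV_continuous_on[OF has_field_derivative_at_within[OF B]])
    from DERIV_isconst_end[OF \<open>x < y\<close> this der] show ?thesis by simp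
  qed simp
  define R where "R x = (B (-1) - B x) / c" for x
  define r where "r x = - b x / c" for x
  have R: "(R has_real_derivative r x) (at x)" for x
    unfolding R_def r_def by (rule derivative_eq_intros B refl | use c in simp)+
  show ?thesis
  proof (rule that)
    show "smooth_fun R"
    proof (rule smooth_funI)
      fix w
      have "dird w R = (\<lambda>z. (- w / c) * b z)"
        using R by (intro ext, subst dird_eqI[OF R[unfolded has_field_derivative_def]]) (simp add: r_def)
      then show "smooth_fun (dird w R)"
        using smooth_fun_mult[OF smooth_fun_const b, of "- w / c"] by simp
    qed (use R real_differentiable_def in blast)
    show "continuous_on UNIV r" unfolding r_def using c by (intro continuous_intros cb) auto
    show "r x \<le> 0" for x using b_nonneg[of x] c by (simp add: r_def)
    show "r x = 0" if "x \<notin> {-2<..<-1}" for x using b_zero[OF that] by (simp add: r_def)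
    have mono: "B x \<le> B y" if "x \<le> y" for x y
      by (rule DERIV_nonneg_imp_nondecreasing[OF that]) (use B b_nonneg in blast)
    have ends: "B (-2) \<le> B x" "B x \<le> B (-1)" for x
    proof -
      have "B (max x (-1)) = B (-1)" "B (min x (-2)) = B (-2)"
        using const[of "-1" "max x (-1)"] const[of "min x (-2)" "-2"] b_zero by auto
      then show "B (-2) \<le> B x" "B x \<le> B (-1)"
        using mono[of x "max x (-1)"] mono[of "min x (-2)" x] by auto
    qed
    show "0 \<le> R x" "R x \<le> 1" for x
      using ends[of x] c by (auto simp: R_def c_def divide_le_eq)
    show "R x = 1" if "x \<le> -2" for x
      using const[of x "-2"] that b_zero c by (simp add: R_def c_def)
    show "R x = 0" if "x \<ge> -1" for x
      using const[of "-1" x] that b_zero by (simp add: R_def)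
  qed (rule R)
qed

section \<open>Test functions and the Fokker-Planck operator\<close>

text \<open>The operators \<open>grad\<close> and \<open>hess\<close> select the Frechet derivative by a choice operator; any known
  derivatives determine their values.\<close>

lemma hess_eq:
  fixes f :: "real ^ 'n::finite \<Rightarrow> real"
  assumes f: "\<And>v. (f has_derivative f' v) (at v)"
    and f': "\<And>i. ((\<lambda>v. f' v (axis i 1)) has_derivative g i) (at v)"
  shows "grad f v = (\<chi> i. f' v (axis i 1))"
    and "(grad f has_derivative (\<lambda>h. \<chi> i. g i h)) (at v)"
    and "hess f v = (\<chi> i j. g i (axis j 1))"
proof -
  have grad: "grad f = (\<lambda>v. \<chi> i. f' v (axis i 1))"
    unfolding grad_def using frechet_derivative_at[OF f] by metis
  then show "grad f v = (\<chi> i. f' v (axis i 1))" by simp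
  show der: "(grad f has_derivative (\<lambda>h. \<chi> i. g i h)) (at v)"
    unfolding grad by (subst has_derivative_componentwise_within)
      (auto simp: Basis_vec_def inner_axis f')
  show "hess f v = (\<chi> i j. g i (axis j 1))"
    unfolding hess_def jacobian_def frechet_derivative_at[OF der, symmetric] matrix_def by simp
qed

abbreviation tlift :: "(real \<Rightarrow> 'n::finite torus \<Rightarrow> real) \<Rightarrow> real \<times> (real ^ 'n) \<Rightarrow> real" where
  "tlift \<phi> \<equiv> \<lambda>(s, v). \<phi> s (torus_proj v)"

text \<open>All directional derivatives of a periodic lift are periodic, so the choice of the representative
  does not matter. In terms of these operators the time derivative, the gradient and the Laplacian of
  a test function are again functions with smooth lifts, or sums and vectors of such functions.\<close>

definition tdir :: "real \<times> (real ^ 'n) \<Rightarrow> (real \<Rightarrow> 'n::finite torus \<Rightarrow> real) \<Rightarrow> real \<Rightarrow> 'n torus \<Rightarrow> real" where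
  "tdir w \<phi> s x = dird w (tlift \<phi>) (s, torus_rep x)"

lemma tlift_tdir:
  fixes \<phi> :: "real \<Rightarrow> 'n::finite torus \<Rightarrow> real"
  assumes "smooth_fun (tlift \<phi>)"
  shows "tlift (tdir w \<phi>) = dird w (tlift \<phi>)"
proof (rule ext, clarify)
  fix s and v :: "real ^ 'n"
  define c where "c = (0 :: real, torus_rep (torus_proj v) - v)"
  have per: "tlift \<phi> (z + c) = tlift \<phi> z" for z
  proof -
    have "int_congruent (torus_rep (torus_proj v)) v" by (simp flip: torus_proj_eq_iff)
    then have "torus_proj (snd z + (torus_rep (torus_proj v) - v)) = torus_proj (snd z)"
      by (simp add: torus_proj_eq_iff int_congruent_def)
    then show ?thesis by (simp add: c_def split_beta)
  qed
  have "((\<lambda>z. tlift \<phi> (z + c)) has_derivative (\<lambda>w. dird w (tlift \<phi>) ((s, v) + c))) (at (s, v))"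
    using dird_affine[OF assms bounded_linear_ident] .
  then have "dird w (tlift \<phi>) (s, v) = dird w (tlift \<phi>) ((s, v) + c)"
    unfolding per by (rule dird_eqI)
  then show "tdir w \<phi> s (torus_proj v) = dird w (tlift \<phi>) (s, v)"
    by (simp add: tdir_def c_def)
qed

lemma smooth_tdir: "smooth_fun (tlift \<phi>) \<Longrightarrow> smooth_fun (tlift (tdir w \<phi>))"
  by (simp add: tlift_tdir smooth_fun_dird)

lemma smooth_lift_continuous:
  assumes "smooth_fun (tlift \<phi>)"
  shows "continuous_on UNIV (\<lambda>(s, x). \<phi> s x)"
  using continuous_on_lift[of UNIV \<phi>] smooth_fun_continuous[OF assms] by simp

lemma smooth_lift_measurable:
  assumes "smooth_fun (tlift \<phi>)"
  shows "(\<lambda>(s, x). \<phi> s x) \<in> borel_measurable (borel \<Otimes>\<^sub>M borel)"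
    and "\<phi> s \<in> borel_measurable borel"
proof -
  note c = smooth_lift_continuous[OF assms, unfolded split_beta]
  have x: "continuous_on UNIV (\<phi> s)" for s
    using continuous_on_compose2[OF c, of UNIV "\<lambda>x. (s, x)"] by (simp add: continuous_on_Pair)
  have s: "continuous_on UNIV (\<lambda>s. \<phi> s x)" for x
    using continuous_on_compose2[OF c, of UNIV "\<lambda>s. (s, x)"] by (simp add: continuous_on_Pair)
  show "\<phi> s \<in> borel_measurable borel" for s by (rule borel_measurable_continuous_onI[OF x])
  then show "(\<lambda>(s, x). \<phi> s x) \<in> borel_measurable (borel \<Otimes>\<^sub>M borel)"
    by (intro caratheodory_measurable s)
qed

lemma smooth_lift_bounded:
  assumes "smooth_fun (tlift \<phi>)" "compact S"
  shows "\<exists>B>0. \<forall>s\<in>S. \<forall>x. \<bar>\<phi> s x\<bar> \<le> B"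
  using lift_bounded[OF continuous_on_subset[OF smooth_fun_continuous[OF assms(1)]] assms(2)]
  by (simp add: split_beta)

lemma deriv_eq_tdir:
  assumes "smooth_fun (tlift \<phi>)"
  shows "((\<lambda>r. \<phi> r x) has_real_derivative tdir (1, 0) \<phi> s x) (at s)"
    and "deriv (\<lambda>r. \<phi> r x) s = tdir (1, 0) \<phi> s x"
proof -
  have "((\<lambda>r. tlift \<phi> (r, torus_rep x)) has_derivative
      (\<lambda>h. dird (h, 0) (tlift \<phi>) (s, torus_rep x))) (at s)"
    by (rule has_derivative_compose[OF has_derivative_Pair[OF has_derivative_ident has_derivative_const]
          smooth_fun_has_derivative[OF assms]])
  moreover have "(\<lambda>h. dird (h, 0) (tlift \<phi>) z) = (\<lambda>h. dird (1, 0) (tlift \<phi>) z * h)" for z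
  proof -
    interpret linear "\<lambda>w. dird w (tlift \<phi>) z"
      by (rule has_derivative_linear[OF smooth_fun_has_derivative[OF assms]])
    have "dird (h, 0) (tlift \<phi>) z = dird (1, 0) (tlift \<phi>) z * h" for h
      using scale[of h "(1, 0)"] by (simp only: scaleR_Pair scaleR_zero_right real_scaleR_def mult.right_neutral mult.left_neutral mult.commute)
    then show ?thesis by blast
  qed
  ultimately show *: "((\<lambda>r. \<phi> r x) has_real_derivative tdir (1, 0) \<phi> s x) (at s)"
    by (simp only: has_field_derivative_def tdir_def torus_proj_rep prod.case)
  then show "deriv (\<lambda>r. \<phi> r x) s = tdir (1, 0) \<phi> s x" by (rule DERIV_imp_deriv)
qed

lemma slice_has_derivative:
  assumes "smooth_fun (tlift \<phi>)"
  shows "((\<lambda>v. \<phi> s (torus_proj v)) has_derivative (\<lambda>h. tdir (0, h) \<phi> s (torus_proj v))) (at v)"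
proof -
  have "((\<lambda>v. tlift \<phi> (s, v)) has_derivative (\<lambda>h. dird (0, h) (tlift \<phi>) (s, v))) (at v)"
    by (rule has_derivative_compose[OF has_derivative_Pair[OF has_derivative_const has_derivative_ident]
          smooth_fun_has_derivative[OF assms]])
  then show ?thesis by (simp flip: tlift_tdir[OF assms])
qed

lemma tgrad_eq_tdir:
  assumes "smooth_fun (tlift \<phi>)"
  shows "tgrad (\<phi> s) x = (\<chi> i. tdir (0, axis i 1) \<phi> s x)"
  using hess_eq(1)[OF slice_has_derivative[OF assms] slice_has_derivative[OF smooth_tdir[OF assms]]]
  unfolding tgrad_def by simp

lemma tlaplace_eq_tdir:
  assumes "smooth_fun (tlift \<phi>)"
  shows "tlaplace (\<phi> s) x = (\<Sum>i\<in>UNIV. tdir (0, axis i 1) (tdir (0, axis i 1) \<phi>) s x)"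
  using hess_eq(3)[OF slice_has_derivative[OF assms] slice_has_derivative[OF smooth_tdir[OF assms]]]
  unfolding tlaplace_def thess_def trace_def by simp

text \<open>The backward operator \<open>\<partial>\<^sub>t + \<Delta> - a \<cdot> \<nabla>\<close>, that is, the integrand of the weak formulation for the
  control value \<open>a\<close>.\<close>

definition fp_gen :: "(real \<Rightarrow> 'n::finite torus \<Rightarrow> real) \<Rightarrow> real \<Rightarrow> 'n torus \<Rightarrow> real ^ 'n \<Rightarrow> real" where
  "fp_gen \<phi> s x a = deriv (\<lambda>r. \<phi> r x) s + tlaplace (\<phi> s) x - a \<bullet> tgrad (\<phi> s) x"

text \<open>On a compact set of times the derivatives of \<open>\<phi>\<close> are bounded, and \<open>|a| \<le> 1 + |a|\<^sup>2\<close> brings the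
  transport term into the form required by \<open>flow_integrable\<close>.\<close>

lemma fp_gen_bound:
  assumes \<phi>: "smooth_fun (tlift \<phi>)" and S: "compact S"
  shows "\<exists>K>0. \<forall>s\<in>S. \<forall>x a. \<bar>fp_gen \<phi> s x a\<bar> \<le> K * (1 + (norm a)\<^sup>2)"
proof -
  obtain B1 where B1: "B1 > 0" "\<And>s x. s \<in> S \<Longrightarrow> \<bar>tdir (1, 0) \<phi> s x\<bar> \<le> B1"
    using smooth_lift_bounded[OF smooth_tdir[OF \<phi>] S] by blast
  have "\<exists>B. \<forall>i. B i > 0 \<and> (\<forall>s\<in>S. \<forall>x. \<bar>tdir (0, axis i 1) (tdir (0, axis i 1) \<phi>) s x\<bar> \<le> B i)"
    by (intro choice allI smooth_lift_bounded[OF smooth_tdir[OF smooth_tdir[OF \<phi>]] S])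
  then obtain B2 where B2: "\<And>i. B2 i > 0"
    "\<And>i s x. s \<in> S \<Longrightarrow> \<bar>tdir (0, axis i 1) (tdir (0, axis i 1) \<phi>) s x\<bar> \<le> B2 i" by metis
  have "\<exists>B. \<forall>i. B i > 0 \<and> (\<forall>s\<in>S. \<forall>x. \<bar>tdir (0, axis i 1) \<phi> s x\<bar> \<le> B i)"
    by (intro choice allI smooth_lift_bounded[OF smooth_tdir[OF \<phi>] S])
  then obtain B3 where B3: "\<And>i. B3 i > 0" "\<And>i s x. s \<in> S \<Longrightarrow> \<bar>tdir (0, axis i 1) \<phi> s x\<bar> \<le> B3 i"
    by metis
  define K where "K = B1 + sum B2 UNIV + sum B3 UNIV"
  show ?thesis
  proof (intro exI[of _ K] conjI ballI allI)
    show "K > 0" unfolding K_def using B1(1) B2(1) B3(1)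
      by (intro add_pos_nonneg sum_nonneg) (auto intro: less_imp_le)
    fix s x and a :: "real ^ 'a" assume s: "s \<in> S"
    have 1: "\<bar>deriv (\<lambda>r. \<phi> r x) s\<bar> \<le> B1" unfolding deriv_eq_tdir(2)[OF \<phi>] by (rule B1(2)[OF s])
    have 2: "\<bar>tlaplace (\<phi> s) x\<bar> \<le> sum B2 UNIV"
      unfolding tlaplace_eq_tdir[OF \<phi>] by (rule order_trans[OF sum_abs]) (intro sum_mono B2(2)[OF s])
    have "norm (tgrad (\<phi> s) x) \<le> sum B3 UNIV"
      unfolding tgrad_eq_tdir[OF \<phi>]
      by (rule order_trans[OF norm_le_l1_cart]) (auto intro!: sum_mono B3(2)[OF s])
    then have "\<bar>a \<bullet> tgrad (\<phi> s) x\<bar> \<le> norm a * sum B3 UNIV"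
      by (intro order_trans[OF Cauchy_Schwarz_ineq2] mult_left_mono) auto
    moreover have "norm a \<le> 1 + (norm a)\<^sup>2"
      using zero_le_power2[of "norm a - 1 / 2"] by (simp add: power2_eq_square algebra_simps)
    moreover have nn: "0 \<le> sum B3 UNIV" "0 \<le> B1 + sum B2 UNIV" using B1(1) B2(1) B3(1)
      by (auto intro!: sum_nonneg add_nonneg_nonneg intro: less_imp_le)
    ultimately have 3: "\<bar>a \<bullet> tgrad (\<phi> s) x\<bar> \<le> (1 + (norm a)\<^sup>2) * sum B3 UNIV"
      by (meson mult_right_mono order_trans)
    have "\<bar>fp_gen \<phi> s x a\<bar> \<le> (B1 + sum B2 UNIV) * 1 + (1 + (norm a)\<^sup>2) * sum B3 UNIV"
    proof -
      have tri: "\<bar>p + q - r\<bar> \<le> P * 1 + R" if "\<bar>p\<bar> \<le> P1" "\<bar>q\<bar> \<le> P2" "\<bar>r\<bar> \<le> R" "P = P1 + P2"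
        for p q r P P1 P2 R :: real using that by linarith
      show ?thesis unfolding fp_gen_def by (rule tri[OF 1 2 3 refl])
    qed
    also have "\<dots> \<le> (B1 + sum B2 UNIV) * (1 + (norm a)\<^sup>2) + (1 + (norm a)\<^sup>2) * sum B3 UNIV"
      by (intro add_right_mono mult_left_mono nn) auto
    finally show "\<bar>fp_gen \<phi> s x a\<bar> \<le> K * (1 + (norm a)\<^sup>2)" by (simp add: K_def algebra_simps)
  qed
qed

lemma fp_gen_measurable:
  assumes \<phi>: "smooth_fun (tlift \<phi>)"
    and \<alpha>: "(\<lambda>(s, x). \<alpha> s x) \<in> borel_measurable (restrict_space borel I \<Otimes>\<^sub>M borel)"
  shows "(\<lambda>(s, x). fp_gen \<phi> s x (\<alpha> s x)) \<in> borel_measurable (restrict_space borel I \<Otimes>\<^sub>M borel)"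
proof -
  let ?M = "restrict_space borel I \<Otimes>\<^sub>M borel :: (real \<times> 'a torus) measure"
  have id: "(\<lambda>z. (fst z, snd z)) \<in> ?M \<rightarrow>\<^sub>M borel \<Otimes>\<^sub>M borel"
    by (intro measurable_Pair measurable_snd
        measurable_compose[OF measurable_fst measurable_restrict_space1[OF measurable_ident_sets[OF refl]]])
  have sm: "(\<lambda>z. \<psi> (fst z) (snd z)) \<in> borel_measurable ?M" if "smooth_fun (tlift \<psi>)" for \<psi>
    using measurable_compose[OF id smooth_lift_measurable(1)[OF that]] by (simp add: split_beta)
  note [measurable] = sm[OF smooth_tdir[OF \<phi>]] sm[OF smooth_tdir[OF smooth_tdir[OF \<phi>]]]
  have "(\<lambda>z. \<alpha> (fst z) (snd z)) \<in> borel_measurable ?M" using \<alpha> by (simp add: split_beta)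
  then have [measurable]: "(\<lambda>z. \<alpha> (fst z) (snd z) $ i) \<in> borel_measurable ?M" for i
    by (rule measurable_compose) (auto intro!: borel_measurable_continuous_onI continuous_intros)
  show ?thesis
    unfolding fp_gen_def split_beta deriv_eq_tdir(2)[OF \<phi>] tlaplace_eq_tdir[OF \<phi>] tgrad_eq_tdir[OF \<phi>]
      inner_vec_def vec_lambda_beta inner_real_def
    by measurable
qed

lemma cutoff_tdir:
  assumes \<phi>: "smooth_fun (tlift \<phi>)" and \<rho>: "smooth_fun \<rho>" and d: "\<And>s. (\<rho> has_real_derivative \<rho>' s) (at s)"
  shows "smooth_fun (tlift (\<lambda>s x. \<rho> s * \<phi> s x))"
    and "tdir w (\<lambda>s x. \<rho> s * \<phi> s x) s x = \<rho>' s * fst w * \<phi> s x + \<rho> s * tdir w \<phi> s x"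
proof -
  have eq: "tlift (\<lambda>s x. \<rho> s * \<phi> s x) = (\<lambda>z. \<rho> (fst z + 0) * tlift \<phi> z)" by auto
  show "smooth_fun (tlift (\<lambda>s x. \<rho> s * \<phi> s x))"
    unfolding eq by (intro smooth_fun_mult \<phi> smooth_fun_affine[OF \<rho>] bounded_linear_fst)
  have "((\<lambda>z. \<rho> (fst z)) has_derivative (\<lambda>w. \<rho>' (fst z) * fst w)) (at z)" for z :: "real \<times> (real ^ 'a)"
    by (rule has_derivative_compose[OF has_derivative_fst[OF has_derivative_ident] d[unfolded has_field_derivative_def]])
  then have "((\<lambda>z. \<rho> (fst z) * tlift \<phi> z) has_derivative
     (\<lambda>w. \<rho> (fst z) * dird w (tlift \<phi>) z + \<rho>' (fst z) * fst w * tlift \<phi> z)) (at z)" for z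
    by (rule has_derivative_mult[OF _ smooth_fun_has_derivative[OF \<phi>]])
  from dird_eqI[OF this] show "tdir w (\<lambda>s x. \<rho> s * \<phi> s x) s x = \<rho>' s * fst w * \<phi> s x + \<rho> s * tdir w \<phi> s x"
    unfolding tdir_def eq by simp
qed

text \<open>The space derivatives do not see a factor that depends on time alone, so the product rule adds only
  the term in which the time derivative falls on the cutoff.\<close>

lemma fp_gen_cutoff:
  assumes \<phi>: "smooth_fun (tlift \<phi>)" and \<rho>: "smooth_fun \<rho>" and d: "\<And>s. (\<rho> has_real_derivative \<rho>' s) (at s)"
  shows "fp_gen (\<lambda>s x. \<rho> s * \<phi> s x) s x a = \<rho>' s * \<phi> s x + \<rho> s * fp_gen \<phi> s x a"
proof -
  note [simp] = cutoff_tdir[OF \<phi> \<rho> d] cutoff_tdir[OF smooth_tdir[OF \<phi>] \<rho> d]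
  have space: "tdir (0, h) (\<lambda>s x. \<rho> s * \<phi> s x) = (\<lambda>s x. \<rho> s * tdir (0, h) \<phi> s x)" for h
    by (intro ext) simp
  have "tgrad (\<lambda>x. \<rho> s * \<phi> s x) x = \<rho> s *\<^sub>R tgrad (\<phi> s) x"
    using tgrad_eq_tdir[OF cutoff_tdir(1)[OF \<phi> \<rho> d], of s x] tgrad_eq_tdir[OF \<phi>, of s x]
    by (simp add: vec_eq_iff)
  moreover have "tlaplace (\<lambda>x. \<rho> s * \<phi> s x) x = \<rho> s * tlaplace (\<phi> s) x"
    using tlaplace_eq_tdir[OF cutoff_tdir(1)[OF \<phi> \<rho> d], of s x] tlaplace_eq_tdir[OF \<phi>, of s x]
    by (simp add: space sum_distrib_left)
  moreover have "deriv (\<lambda>r. \<rho> r * \<phi> r x) s = \<rho>' s * \<phi> s x + \<rho> s * deriv (\<lambda>r. \<phi> r x) s"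
    using deriv_eq_tdir(2)[OF cutoff_tdir(1)[OF \<phi> \<rho> d]] deriv_eq_tdir(2)[OF \<phi>] by simp
  ultimately show ?thesis by (simp add: fp_gen_def algebra_simps)
qed

lemma fp_gen_shift: "fp_gen (\<lambda>s. \<phi> (s + c)) s x a = fp_gen \<phi> (s + c) x a"
  unfolding fp_gen_def deriv_def by (simp add: DERIV_shift)

lemma smooth_shift:
  assumes "smooth_fun (tlift \<phi>)"
  shows "smooth_fun (tlift (\<lambda>s. \<phi> (s + c)))"
proof -
  have "tlift (\<lambda>s. \<phi> (s + c)) = (\<lambda>z. tlift \<phi> (z + (c, 0)))" by auto
  then show ?thesis using smooth_fun_affine[OF assms bounded_linear_ident] by simp
qed

text \<open>The time derivative sees a neighbourhood of \<open>s\<close>, hence the strict inequality.\<close>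

lemma fp_gen_vanish:
  assumes "\<And>s x. s \<ge> a \<Longrightarrow> \<phi> s x = 0" "s > a"
  shows "fp_gen \<phi> s x v = 0"
proof -
  have "((\<lambda>r. 0) has_real_derivative 0) (at s)" by simp
  then have "((\<lambda>r. \<phi> r x) has_real_derivative 0) (at s)"
    by (rule has_field_derivative_transform_within_open[where S = "{a<..}"]) (use assms in auto)
  then have "deriv (\<lambda>r. \<phi> r x) s = 0" by (rule DERIV_imp_deriv)
  moreover have z: "\<phi> s = (\<lambda>x. 0)" using assms by (intro ext) auto
  have h: "grad (\<lambda>v :: real ^ 'a. 0) v = (\<chi> i. 0)" "hess (\<lambda>v :: real ^ 'a. 0) v = (\<chi> i j. 0)" for v
    using hess_eq(1,3)[where f = "\<lambda>v. 0" and f' = "\<lambda>v h. 0" and g = "\<lambda>i h. 0"] by simp_all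
  have "tgrad (\<phi> s) x = 0" "tlaplace (\<phi> s) x = 0"
    unfolding z tgrad_def tlaplace_def thess_def h by (simp_all add: trace_def vec_eq_iff)
  ultimately show ?thesis by (simp add: fp_gen_def)
qed

lemma smooth_lift_lipschitz:
  assumes \<phi>: "smooth_fun (tlift \<phi>)"
  shows "\<exists>L>0. \<forall>s\<in>{a..b}. \<forall>s'\<in>{a..b}. \<forall>x y. \<bar>\<phi> s x - \<phi> s' y\<bar> \<le> L * (\<bar>s - s'\<bar> + dist x y)"
proof -
  obtain B1 where B1: "B1 > 0" "\<And>s x. s \<in> {a..b} \<Longrightarrow> \<bar>tdir (1, 0) \<phi> s x\<bar> \<le> B1"
    using smooth_lift_bounded[OF smooth_tdir[OF \<phi>] compact_Icc] by blast
  have "\<exists>B. \<forall>i. B i > 0 \<and> (\<forall>s\<in>{a..b}. \<forall>x. \<bar>tdir (0, axis i 1) \<phi> s x\<bar> \<le> B i)"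
    by (intro choice allI smooth_lift_bounded[OF smooth_tdir[OF \<phi>] compact_Icc])
  then obtain B3 where B3: "\<And>i. B3 i > 0" "\<And>i s x. s \<in> {a..b} \<Longrightarrow> \<bar>tdir (0, axis i 1) \<phi> s x\<bar> \<le> B3 i"
    by metis
  define L where "L = B1 + sum B3 UNIV"
  have B3s: "0 \<le> sum B3 UNIV" using B3(1) by (auto intro!: sum_nonneg intro: less_imp_le)
  have L: "L > 0" using B1(1) B3s by (simp add: L_def)
  show ?thesis
  proof (intro exI[of _ L] conjI ballI allI L)
    fix s s' x y assume s: "s \<in> {a..b}" "s' \<in> {a..b}"
    have "\<bar>\<phi> s x - \<phi> s' x\<bar> \<le> B1 * \<bar>s - s'\<bar>"
    proof -
      have "norm (\<phi> s x - \<phi> s' x) \<le> B1 * norm (s - s')"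
        by (rule field_differentiable_bound[of "{a..b}"])
           (use s B1(2) in \<open>auto intro: has_field_derivative_at_within[OF deriv_eq_tdir(1)[OF \<phi>]]\<close>)
      then show ?thesis by simp
    qed
    moreover
    obtain u where u: "torus_proj u = x" using torus_proj_surj by blast
    obtain v where v: "torus_proj v = y" "dist u v = dist x y" using torus_proj_lift_near u by blast
    have "norm (\<phi> s' (torus_proj u) - \<phi> s' (torus_proj v)) \<le> sum B3 UNIV * norm (u - v)"
    proof (rule differentiable_bound[of UNIV])
      show "((\<lambda>v. \<phi> s' (torus_proj v)) has_derivative (\<lambda>h. tdir (0, h) \<phi> s' (torus_proj v)))
        (at v within UNIV)" for v
        using slice_has_derivative[OF \<phi>] by simp
      show "onorm (\<lambda>h. tdir (0, h) \<phi> s' (torus_proj v)) \<le> sum B3 UNIV" for v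
      proof (rule onorm_le)
        fix h :: "real ^ 'a"
        interpret linear "\<lambda>h. tdir (0, h) \<phi> s' (torus_proj v)"
          by (rule has_derivative_linear[OF slice_has_derivative[OF \<phi>]])
        have "tdir (0, h) \<phi> s' (torus_proj v) = tdir (0, \<Sum>i\<in>UNIV. (h $ i) *\<^sub>R axis i 1) \<phi> s' (torus_proj v)"
          using basis_expansion[of h] by (simp add: scalar_mult_eq_scaleR)
        also have "\<dots> = (\<Sum>i\<in>UNIV. h $ i * tdir (0, axis i 1) \<phi> s' (torus_proj v))"
          by (simp add: sum scale)
        also have "norm \<dots> \<le> (\<Sum>i\<in>UNIV. norm h * B3 i)"
          by (rule order_trans[OF norm_sum], rule sum_mono)
             (auto simp: abs_mult intro!: mult_mono B3(2)[OF s(2)] component_le_norm_cart)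
        finally show "norm (tdir (0, h) \<phi> s' (torus_proj v)) \<le> sum B3 UNIV * norm h"
          by (simp add: sum_distrib_left mult.commute)
      qed
    qed auto
    then have "\<bar>\<phi> s' x - \<phi> s' y\<bar> \<le> sum B3 UNIV * dist x y"
      using u v by (simp add: dist_norm)
    ultimately have "\<bar>\<phi> s x - \<phi> s' y\<bar> \<le> B1 * \<bar>s - s'\<bar> + sum B3 UNIV * dist x y" by linarith
    also have "\<dots> \<le> L * (\<bar>s - s'\<bar> + dist x y)"
      unfolding L_def distrib_left distrib_right using B1(1) B3s
      by (simp add: mult_nonneg_nonneg)
    finally show "\<bar>\<phi> s x - \<phi> s' y\<bar> \<le> L * (\<bar>s - s'\<bar> + dist x y)" .
  qed
qed

text \<open>The Lipschitz bound in time controls the change of the integrand, and the one in space the change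
  of the measure.\<close>

lemma curve_integral_continuous:
  assumes \<phi>: "smooth_fun (tlift \<phi>)" and m: "continuous_on {a..b} m"
  shows "continuous_on {a..b} (\<lambda>s. \<integral>x. \<phi> s x \<partial>meas (m s))"
proof -
  obtain L where L: "L > 0" "\<And>s s' x y. s \<in> {a..b} \<Longrightarrow> s' \<in> {a..b} \<Longrightarrow>
      \<bar>\<phi> s x - \<phi> s' y\<bar> \<le> L * (\<bar>s - s'\<bar> + dist x y)"
    using smooth_lift_lipschitz[OF \<phi>] by meson
  have lip: "\<bar>\<phi> s x - \<phi> s y\<bar> \<le> L * dist x y" if "s \<in> {a..b}" for s x y
    using L(2)[OF that that] by simp
  have bd: "\<bar>(\<integral>x. \<phi> s x \<partial>meas (m s)) - (\<integral>x. \<phi> s' x \<partial>meas (m s'))\<bar> \<le> L * (\<bar>s - s'\<bar> + dist (m s) (m s'))"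
    if s: "s \<in> {a..b}" "s' \<in> {a..b}" for s s'
  proof -
    interpret prob_space "meas (m s)" by (rule prob_space_meas)
    note int = lipschitz_integral_diff(1)[OF lip[OF s(1)] L(1), of "m s"]
      lipschitz_integral_diff(1)[OF lip[OF s(2)] L(1), of "m s"]
    have "\<bar>(\<integral>x. \<phi> s x \<partial>meas (m s)) - (\<integral>x. \<phi> s' x \<partial>meas (m s))\<bar> = \<bar>\<integral>x. \<phi> s x - \<phi> s' x \<partial>meas (m s)\<bar>"
      using int by simp
    also have "\<dots> \<le> (\<integral>x. \<bar>\<phi> s x - \<phi> s' x\<bar> \<partial>meas (m s))" by (rule integral_abs_bound)
    also have "\<dots> \<le> (\<integral>x. L * \<bar>s - s'\<bar> \<partial>meas (m s))"
    proof (rule integral_mono)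
      show "\<bar>\<phi> s x - \<phi> s' x\<bar> \<le> L * \<bar>s - s'\<bar>" for x using L(2)[OF s, of x x] by simp
    qed (use int in auto)
    also have "\<dots> = L * \<bar>s - s'\<bar>" using prob_space by simp
    finally show ?thesis
      using lipschitz_integral_diff(2)[OF lip[OF s(2)] L(1), of "m s" "m s'"] by (simp add: distrib_left)
  qed
  show ?thesis
    unfolding continuous_on_def
  proof
    fix s assume s: "s \<in> {a..b}"
    have "(m \<longlongrightarrow> m s) (at s within {a..b})" using m s by (simp add: continuous_on_def)
    then have "((\<lambda>s'. L * (\<bar>s' - s\<bar> + dist (m s') (m s))) \<longlongrightarrow> L * (\<bar>s - s\<bar> + dist (m s) (m s))) (at s within {a..b})"
      by (intro tendsto_intros)
    then have lim: "((\<lambda>s'. L * (\<bar>s' - s\<bar> + dist (m s') (m s))) \<longlongrightarrow> 0) (at s within {a..b})"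
      by simp
    have "\<forall>\<^sub>F s' in at s within {a..b}. norm ((\<integral>x. \<phi> s' x \<partial>meas (m s')) - (\<integral>x. \<phi> s x \<partial>meas (m s)))
        \<le> L * (\<bar>s' - s\<bar> + dist (m s') (m s))"
      unfolding eventually_at_filter by (rule always_eventually) (use bd[OF _ s] in simp)
    from LIM_zero_cancel[OF Lim_null_comparison[OF this lim]]
    show "((\<lambda>s. \<integral>x. \<phi> s x \<partial>meas (m s)) \<longlongrightarrow> (\<integral>x. \<phi> s x \<partial>meas (m s))) (at s within {a..b})" .
  qed
qed

section \<open>Integrals over adjacent time intervals\<close>

lemma set_integral_glue:
  fixes f :: "real \<Rightarrow> real"
  assumes A: "set_integrable lborel A f" and B: "set_integrable lborel B f" and AB: "A \<inter> B = {b}"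
  shows "set_integrable lborel (A \<union> B) f"
    and "(LINT s:A \<union> B|lborel. f s) = (LINT s:A|lborel. f s) + (LINT s:B|lborel. f s)"
proof -
  have "set_integrable lborel {b} f"
    by (rule set_integrable_subset[OF A]) (use AB in auto)
  then have b: "integrable lborel (\<lambda>s. indicator {b} s *\<^sub>R f s)"
    unfolding set_integrable_def .
  have "(LINT s|lborel. indicator {b} s *\<^sub>R f s) = 0"
    by (rule integral_eq_zero_AE, use AE_lborel_singleton[of b] in eventually_elim) simp
  moreover have "(\<lambda>s. indicator (A \<union> B) s *\<^sub>R f s) =
      (\<lambda>s. indicator A s *\<^sub>R f s + indicator B s *\<^sub>R f s - indicator {b} s *\<^sub>R f s)"
    using AB by (auto simp: fun_eq_iff indicator_def)
  ultimately show "set_integrable lborel (A \<union> B) f"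
      "(LINT s:A \<union> B|lborel. f s) = (LINT s:A|lborel. f s) + (LINT s:B|lborel. f s)"
    using A B b unfolding set_integrable_def set_lebesgue_integral_def by simp_all
qed

lemma set_integral_shift:
  fixes f :: "real \<Rightarrow> real"
  shows "set_integrable lborel A (\<lambda>s. f (c + s)) \<longleftrightarrow> set_integrable lborel ((+) c ` A) f"
    and "(LINT s:A|lborel. f (c + s)) = (LINT s:(+) c ` A|lborel. f s)"
proof -
  have ind: "indicator A s = (indicator ((+) c ` A) (c + s) :: real)" for s
    by (auto simp: indicator_def)
  show "set_integrable lborel A (\<lambda>s. f (c + s)) \<longleftrightarrow> set_integrable lborel ((+) c ` A) f"
    using lborel_integrable_real_affine_iff[of 1 "\<lambda>s. indicator ((+) c ` A) s *\<^sub>R f s" c]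
    unfolding set_integrable_def ind by simp
  show "(LINT s:A|lborel. f (c + s)) = (LINT s:(+) c ` A|lborel. f s)"
    using lborel_integral_real_affine[of 1 "\<lambda>s. indicator ((+) c ` A) s *\<^sub>R f s" c]
    unfolding set_lebesgue_integral_def ind by simp
qed

lemma set_integral_vanish:
  fixes f :: "real \<Rightarrow> real"
  assumes "A \<subseteq> B" "\<And>s. s \<in> B \<Longrightarrow> s \<notin> A \<Longrightarrow> f s = 0"
  shows "set_integrable lborel B f \<longleftrightarrow> set_integrable lborel A f"
    and "(LINT s:B|lborel. f s) = (LINT s:A|lborel. f s)"
proof -
  have "(\<lambda>s. indicator B s *\<^sub>R f s) = (\<lambda>s. indicator A s *\<^sub>R f s)"
    using assms by (auto simp: fun_eq_iff indicator_def)
  then show "set_integrable lborel B f \<longleftrightarrow> set_integrable lborel A f"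
    "(LINT s:B|lborel. f s) = (LINT s:A|lborel. f s)"
    unfolding set_integrable_def set_lebesgue_integral_def by simp_all
qed

section \<open>Test functions that do not vanish at the final time\<close>

lemma fp_solution_gen:
  "fp_solution I m\<^sub>0 m \<alpha> \<longleftrightarrow> continuous_on I m \<and> m 0 = m\<^sub>0 \<and>
     (\<forall>\<phi>. test_fun I \<phi> \<longrightarrow> (LINT s:I|lborel. \<integral>x. fp_gen \<phi> s x (\<alpha> s x) \<partial>meas (m s))
        + (\<integral>x. \<phi> 0 x \<partial>meas m\<^sub>0) = 0)"
  unfolding fp_solution_def fp_gen_def ..

lemma admissibleD:
  assumes "(m, \<alpha>) \<in> admissible w I m\<^sub>0"
  shows "continuous_on I m" "m 0 = m\<^sub>0"
    "(\<lambda>(s, x). \<alpha> s x) \<in> borel_measurable (restrict_space borel I \<Otimes>\<^sub>M borel)"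
    "(\<integral>\<^sup>+s\<in>I. ennreal (w s) * (\<integral>\<^sup>+x. ennreal ((norm (\<alpha> s x))\<^sup>2) \<partial>meas (m s)) \<partial>lborel) < \<infinity>"
    "\<And>\<phi>. test_fun I \<phi> \<Longrightarrow> (LINT s:I|lborel. \<integral>x. fp_gen \<phi> s x (\<alpha> s x) \<partial>meas (m s))
        + (\<integral>x. \<phi> 0 x \<partial>meas m\<^sub>0) = 0"
  using assms unfolding admissible_def fp_solution_gen by auto

lemma fp_gen_integrable:
  fixes \<alpha> :: "real \<Rightarrow> 'n::finite torus \<Rightarrow> real ^ 'n"
  assumes adm: "(m, \<alpha>) \<in> admissible (\<lambda>_. 1) {0..t} m\<^sub>0" and \<phi>: "smooth_fun (tlift \<phi>)"
  shows "set_integrable lborel {0..t} (\<lambda>s. \<integral>x. fp_gen \<phi> s x (\<alpha> s x) \<partial>meas (m s))"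
    and "AE s in lborel. s \<in> {0..t} \<longrightarrow> integrable (meas (m s)) (\<lambda>x. fp_gen \<phi> s x (\<alpha> s x))"
proof -
  note D = admissibleD[OF adm]
  obtain K where K: "\<And>s x a. s \<in> {0..t} \<Longrightarrow> \<bar>fp_gen \<phi> s x a\<bar> \<le> K * (1 + (norm a)\<^sup>2)"
    using fp_gen_bound[OF \<phi> compact_Icc] by metis
  have one: "set_integrable lborel {0..t} (\<lambda>_. 1 :: real)"
    by (intro borel_integrable_atLeastAtMost' continuous_intros)
  note * = flow_integrable[OF D(1) _ D(3) fp_gen_measurable[OF \<phi> D(3)] K _ one D(4)]
  show "set_integrable lborel {0..t} (\<lambda>s. \<integral>x. fp_gen \<phi> s x (\<alpha> s x) \<partial>meas (m s))"
    "AE s in lborel. s \<in> {0..t} \<longrightarrow> integrable (meas (m s)) (\<lambda>x. fp_gen \<phi> s x (\<alpha> s x))"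
    using * by simp_all
qed

text \<open>Integration by parts up to the final time. The functions \<open>\<rho>\<^sub>j(s) \<phi>(s, x)\<close> are test functions
  on \<open>[0, t)\<close> when the cutoff \<open>\<rho>\<^sub>j\<close> drops from \<open>1\<close> to \<open>0\<close> shortly before \<open>t\<close>. The product
  rule gives two terms. In the one with \<open>\<rho>\<^sub>j\<close> the cutoff disappears by dominated convergence. In the one
  with \<open>\<rho>\<^sub>j'\<close> the weight has total mass \<open>-1\<close> and concentrates at \<open>t\<close>, so that continuity of
  \<open>s \<mapsto> \<integral> \<phi>(s) dm(s)\<close> turns it into the boundary term.\<close>

lemma fp_terminal:
  fixes \<alpha> :: "real \<Rightarrow> 'n::finite torus \<Rightarrow> real ^ 'n"
  assumes adm: "(m, \<alpha>) \<in> admissible (\<lambda>_. 1) {0..t} m\<^sub>0" and t: "t > 0"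
    and \<phi>: "smooth_fun (tlift \<phi>)"
  shows "(LINT s:{0..t}|lborel. \<integral>x. fp_gen \<phi> s x (\<alpha> s x) \<partial>meas (m s))
     + (\<integral>x. \<phi> 0 x \<partial>meas m\<^sub>0) = (\<integral>x. \<phi> t x \<partial>meas (m t))"
proof -
  note D = admissibleD[OF adm]
  define g where "g s = (\<integral>x. fp_gen \<phi> s x (\<alpha> s x) \<partial>meas (m s))" for s
  define P where "P s = (\<integral>x. \<phi> s x \<partial>meas (m s))" for s
  have g: "set_integrable lborel {0..t} g" unfolding g_def by (rule fp_gen_integrable[OF adm \<phi>])
  have P: "continuous_on {0..t} P" unfolding P_def by (rule curve_integral_continuous[OF \<phi> D(1)])
  obtain R r :: "real \<Rightarrow> real" where R: "smooth_fun R" "\<And>x. (R has_real_derivative r x) (at x)"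
    "continuous_on UNIV r" "\<And>x. r x \<le> 0" "\<And>x. x \<notin> {-2<..<-1} \<Longrightarrow> r x = 0"
    "\<And>x. x \<le> -2 \<Longrightarrow> R x = 1" "\<And>x. x \<ge> -1 \<Longrightarrow> R x = 0" "\<And>x. 0 \<le> R x" "\<And>x. R x \<le> 1"
    by (rule smooth_cutoff) blast
  \<comment> \<open>The cutoff \<open>\<rho> j\<close> drops between \<open>t - 2 / k j\<close> and \<open>t - 1 / k j\<close>; the summand \<open>2 / t\<close> keeps this
    interval inside \<open>[0, t)\<close>.\<close>
  define k where "k j = 2 / t + real j" for j
  have k: "k j > 0" "k j * t \<ge> 2" for j
    using t by (auto simp: k_def distrib_right intro!: add_pos_nonneg)
  define \<rho> where "\<rho> j s = R (k j * s + (- (k j * t)))" for j s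
  define \<rho>' where "\<rho>' j s = k j * r (k j * s + (- (k j * t)))" for j s
  have \<rho>: "smooth_fun (\<rho> j)" for j
    unfolding \<rho>_def by (rule smooth_fun_affine[OF R(1) bounded_linear_mult_right])
  have \<rho>d: "(\<rho> j has_real_derivative \<rho>' j s) (at s)" for j s
    unfolding \<rho>_def \<rho>'_def
    by (rule DERIV_cong[OF DERIV_chain2[OF R(2)]]) (auto intro!: derivative_eq_intros)
  have \<rho>c: "continuous_on S (\<rho> j)" for j S
    using smooth_fun_continuous[OF \<rho>] continuous_on_subset by blast
  have \<rho>'c: "continuous_on S (\<rho>' j)" for j S
    unfolding \<rho>'_def by (intro continuous_intros continuous_on_compose2[OF R(3)]) auto
  have \<rho>0: "\<rho> j 0 = 1" and \<rho>t: "\<rho> j t = 0" for j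
    using k[of j] by (auto simp: \<rho>_def R(6,7))
  have test: "test_fun {0..t} (\<lambda>s x. \<rho> j s * \<phi> s x)" for j
  proof -
    have "1 / k j < t" using k[of j] by (simp add: divide_less_eq mult.commute)
    then have "t - 1 / k j \<in> interior {0..t}" using k[of j] by simp
    moreover have "\<rho> j s * \<phi> s x = 0" if "s \<ge> t - 1 / k j" for s x
    proof -
      have "k j * (t - 1 / k j) \<le> k j * s" using that k(1)[of j] by (intro mult_left_mono) auto
      then have "k j * s + (- (k j * t)) \<ge> -1" using k(1)[of j] by (simp add: right_diff_distrib)
      then show ?thesis by (simp add: \<rho>_def R(7))
    qed
    ultimately show ?thesis
      unfolding test_fun_def using cutoff_tdir(1)[OF \<phi> \<rho> \<rho>d] by blast
  qed
  have \<rho>P: "set_integrable lborel {0..t} (\<lambda>s. \<rho>' j s * P s)" for j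
    by (intro borel_integrable_atLeastAtMost' continuous_intros \<rho>'c P)
  have \<rho>g: "set_integrable lborel {0..t} (\<lambda>s. \<rho> j s * g s)" for j
    unfolding set_integrable_def
  proof (rule Bochner_Integration.integrable_bound)
    show "integrable lborel (\<lambda>s. indicator {0..t} s *\<^sub>R g s)" using g by (simp add: set_integrable_def)
    have "(\<lambda>s. \<rho> j s * (indicator {0..t} s *\<^sub>R g s)) \<in> borel_measurable lborel"
      using borel_measurable_continuous_onI[OF \<rho>c, of j] borel_measurable_integrable[OF g[unfolded set_integrable_def]]
      by simp
    then show "(\<lambda>s. indicator {0..t} s *\<^sub>R (\<rho> j s * g s)) \<in> borel_measurable lborel"
      by (simp add: mult.left_commute)
    show "AE s in lborel. norm (indicator {0..t} s *\<^sub>R (\<rho> j s * g s)) \<le> norm (indicator {0..t} s *\<^sub>R g s)"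
      using R(8,9) by (intro AE_I2) (auto simp: indicator_def \<rho>_def abs_mult mult_left_le_one_le)
  qed
  have split: "(LINT s:{0..t}|lborel. \<rho>' j s * P s) + (LINT s:{0..t}|lborel. \<rho> j s * g s)
      + (\<integral>x. \<phi> 0 x \<partial>meas m\<^sub>0) = 0" for j
  proof -
    let ?G = "\<lambda>s. \<integral>x. fp_gen (\<lambda>s x. \<rho> j s * \<phi> s x) s x (\<alpha> s x) \<partial>meas (m s)"
    have G: "set_integrable lborel {0..t} ?G"
      by (rule fp_gen_integrable(1)[OF adm cutoff_tdir(1)[OF \<phi> \<rho> \<rho>d]])
    \<comment> \<open>Only at almost every time is the operator integrable in space, so that the space integral splits.\<close>
    have "AE s in lborel. s \<in> {0..t} \<longrightarrow> ?G s = \<rho>' j s * P s + \<rho> j s * g s"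
      using fp_gen_integrable(2)[OF adm \<phi>]
    proof eventually_elim
      case (elim s)
      show ?case
      proof
        assume s: "s \<in> {0..t}"
        interpret prob_space "meas (m s)" by (rule prob_space_meas)
        obtain B where "\<And>x. \<bar>\<phi> s x\<bar> \<le> B"
          using smooth_lift_bounded[OF \<phi> compact_Icc[of 0 t]] s by blast
        then have "integrable (meas (m s)) (\<phi> s)"
          by (intro integrable_const_bound[where B = B]) (use smooth_lift_measurable(2)[OF \<phi>] in auto)
        then show "?G s = \<rho>' j s * P s + \<rho> j s * g s"
          using elim s by (simp add: fp_gen_cutoff[OF \<phi> \<rho> \<rho>d] P_def g_def)
      qed
    qed
    then have "(LINT s:{0..t}|lborel. ?G s) = (LINT s:{0..t}|lborel. \<rho>' j s * P s + \<rho> j s * g s)"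
      unfolding set_lebesgue_integral_def
      by (intro integral_cong_AE borel_measurable_integrable)
         (use G set_integral_add(1)[OF \<rho>P[of j] \<rho>g[of j]] in \<open>auto simp: set_integrable_def indicator_def\<close>)
    also have "\<dots> = (LINT s:{0..t}|lborel. \<rho>' j s * P s) + (LINT s:{0..t}|lborel. \<rho> j s * g s)"
      by (rule set_integral_add(2)[OF \<rho>P \<rho>g])
    finally show ?thesis using D(5)[OF test[of j]] by (simp add: \<rho>0)
  qed
  have k_top: "filterlim k at_top sequentially"
    unfolding k_def by (rule filterlim_tendsto_add_at_top[OF tendsto_const filterlim_real_sequentially])
  have lim_g: "(\<lambda>j. LINT s:{0..t}|lborel. \<rho> j s * g s) \<longlonglongrightarrow> (LINT s:{0..t}|lborel. g s)"
    unfolding set_lebesgue_integral_def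
  proof (rule integral_dominated_convergence[where w = "\<lambda>s. norm (indicator {0..t} s *\<^sub>R g s)"])
    show "(\<lambda>s. indicator {0..t} s *\<^sub>R g s) \<in> borel_measurable lborel"
      using g unfolding set_integrable_def by (rule borel_measurable_integrable)
    show "(\<lambda>s. indicator {0..t} s *\<^sub>R (\<rho> j s * g s)) \<in> borel_measurable lborel" for j
      using \<rho>g[of j] unfolding set_integrable_def by (rule borel_measurable_integrable)
    show "integrable lborel (\<lambda>s. norm (indicator {0..t} s *\<^sub>R g s))"
      using g unfolding set_integrable_def by (rule integrable_norm)
    show "AE s in lborel. norm (indicator {0..t} s *\<^sub>R (\<rho> j s * g s)) \<le> norm (indicator {0..t} s *\<^sub>R g s)" for j
      using R(8,9) by (intro AE_I2) (auto simp: indicator_def \<rho>_def abs_mult mult_left_le_one_le)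
    show "AE s in lborel. (\<lambda>j. indicator {0..t} s *\<^sub>R (\<rho> j s * g s)) \<longlonglongrightarrow> indicator {0..t} s *\<^sub>R g s"
      using AE_lborel_singleton[of t]
    proof eventually_elim
      case (elim s)
      show ?case
      proof (cases "s < t")
        case True
        have "\<forall>\<^sub>F j in sequentially. 2 / (t - s) \<le> k j" using k_top by (simp add: filterlim_at_top)
        then have "\<forall>\<^sub>F j in sequentially. indicator {0..t} s *\<^sub>R (\<rho> j s * g s) = indicator {0..t} s *\<^sub>R g s"
        proof eventually_elim
          case (elim j)
          then have "2 \<le> k j * (t - s)" using True by (simp add: divide_le_eq)
          then have "k j * s + (- (k j * t)) \<le> -2" by (simp add: right_diff_distrib)
          then show ?case by (simp add: \<rho>_def R(6))
        qed
        then show ?thesis by (rule tendsto_eventually)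
      qed (use elim in simp)
    qed
  qed
  have lim_P: "(\<lambda>j. LINT s:{0..t}|lborel. \<rho>' j s * P s) \<longlonglongrightarrow> - P t"
    unfolding LIMSEQ_def
  proof (intro allI impI)
    fix e :: real assume e: "e > 0"
    obtain d where d: "d > 0" "\<And>s. s \<in> {0..t} \<Longrightarrow> dist s t < d \<Longrightarrow> dist (P s) (P t) < e / 2"
      using P t e unfolding continuous_on_iff by (metis atLeastAtMost_iff half_gt_zero less_eq_real_def)
    obtain N where N: "\<And>j. j \<ge> N \<Longrightarrow> 2 / d \<le> k j"
      using k_top unfolding filterlim_at_top eventually_sequentially by meson
    show "\<exists>N. \<forall>j\<ge>N. dist (LINT s:{0..t}|lborel. \<rho>' j s * P s) (- P t) < e"
    proof (intro exI[of _ N] allI impI)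
      fix j assume j: "j \<ge> N"
      have mass: "(LINT s:{0..t}|lborel. \<rho>' j s) = -1"
        using integral_FTC_Icc_real[of 0 t "\<rho> j" "\<rho>' j"] t \<rho>d[of j] \<rho>'c[of UNIV j]
        by (simp add: set_lebesgue_integral_def \<rho>0 \<rho>t mult.commute continuous_on_eq_continuous_at)
      have int': "set_integrable lborel {0..t} (\<rho>' j)"
        by (rule borel_integrable_atLeastAtMost'[OF \<rho>'c])
      have le0: "\<rho>' j s \<le> 0" for s
        using k(1)[of j] R(4) by (simp add: \<rho>'_def mult_nonneg_nonpos)
      have near: "\<bar>\<rho>' j s * (P s - P t)\<bar> \<le> (e / 2) * - \<rho>' j s" if s: "s \<in> {0..t}" for s
      proof (cases "\<rho>' j s = 0")
        case False
        then have "k j * s + (- (k j * t)) \<in> {-2<..<-1}" using R(5) by (auto simp: \<rho>'_def)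
        then have "k j * (t - s) < 2" by (simp add: right_diff_distrib)
        also have "2 \<le> k j * d" using N[OF j] d(1) by (simp add: divide_le_eq)
        finally have "t - s < d" using k(1)[of j] by simp
        then have "\<bar>P s - P t\<bar> \<le> e / 2" using d(2)[OF s] s by (simp add: dist_real_def)
        then show ?thesis using le0[of s]
            mult_left_mono[of "\<bar>P s - P t\<bar>" "e / 2" "- \<rho>' j s"]
          by (simp add: abs_mult abs_of_nonpos mult.commute)
      qed simp
      have "(LINT s:{0..t}|lborel. \<rho>' j s * P s) - (- P t) = (LINT s:{0..t}|lborel. \<rho>' j s * (P s - P t))"
        unfolding right_diff_distrib
        by (subst set_integral_diff(2)) (use \<rho>P int' mass in \<open>auto simp: mult.commute[of _ "P t"]\<close>)
      also have "\<bar>\<dots>\<bar> \<le> (LINT s:{0..t}|lborel. (e / 2) * - \<rho>' j s)"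
      proof -
        have i1: "set_integrable lborel {0..t} (\<lambda>s. \<rho>' j s * (P s - P t))"
          by (intro borel_integrable_atLeastAtMost' continuous_intros \<rho>'c P)
        have i2: "set_integrable lborel {0..t} (\<lambda>s. (e / 2) * - \<rho>' j s)"
          by (intro borel_integrable_atLeastAtMost' continuous_intros \<rho>'c)
        show ?thesis
          unfolding set_lebesgue_integral_def
          by (rule integral_abs_bound[THEN order_trans], rule integral_mono)
             (use i1 i2 near in \<open>auto simp: set_integrable_def indicator_def\<close>)
      qed
      also have "\<dots> = e / 2"
        using mass by (simp only: set_integral_mult_right set_integral_uminus[OF int'] minus_minus mult_1_right)
      finally show "dist (LINT s:{0..t}|lborel. \<rho>' j s * P s) (- P t) < e"
        using e by (simp add: dist_real_def)
    qed
  qed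
  have "(\<lambda>j. 0 :: real) \<longlonglongrightarrow> - P t + (LINT s:{0..t}|lborel. g s) + (\<integral>x. \<phi> 0 x \<partial>meas m\<^sub>0)"
    using tendsto_add[OF tendsto_add[OF lim_P lim_g] tendsto_const[of "\<integral>x. \<phi> 0 x \<partial>meas m\<^sub>0"]]
    by (simp only: split)
  from LIMSEQ_unique[OF this tendsto_const] show ?thesis by (simp add: g_def P_def)
qed

section \<open>Restriction, shift and concatenation of controlled curves\<close>

lemma measurable_time_restrict:
  assumes "(\<lambda>(s, x). \<alpha> s x) \<in> borel_measurable (restrict_space borel I \<Otimes>\<^sub>M borel)"
    and f: "f \<in> borel \<rightarrow>\<^sub>M borel" "\<And>s. s \<in> J \<Longrightarrow> f s \<in> I"
  shows "(\<lambda>(s, x). \<alpha> (f s) x) \<in> borel_measurable (restrict_space borel J \<Otimes>\<^sub>M borel)"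
proof -
  have "f \<in> restrict_space borel J \<rightarrow>\<^sub>M restrict_space borel I"
    using f by (intro measurable_restrict_space3) auto
  then have "(\<lambda>z. (f (fst z), snd z)) \<in> restrict_space borel J \<Otimes>\<^sub>M borel \<rightarrow>\<^sub>M restrict_space borel I \<Otimes>\<^sub>M borel"
    by (intro measurable_Pair measurable_snd measurable_compose[OF measurable_fst])
  from measurable_compose[OF this assms(1)] show ?thesis by (simp add: split_beta)
qed

lemma test_fun_vanish: "test_fun I \<phi> \<Longrightarrow> \<exists>a\<in>interior I. \<forall>s\<ge>a. \<forall>x. \<phi> s x = 0"
  and test_fun_smooth: "test_fun I \<phi> \<Longrightarrow> smooth_fun (tlift \<phi>)"
  by (auto simp: test_fun_def)

text \<open>Test functions on \<open>[0, T)\<close> are also test functions on the half line, and the discount factor is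
  bounded below on \<open>[0, T]\<close>.\<close>

lemma admissible_restrict:
  fixes \<alpha> :: "real \<Rightarrow> 'n::finite torus \<Rightarrow> real ^ 'n"
  assumes adm: "(m, \<alpha>) \<in> admissible (\<lambda>s. exp (- \<delta> * s)) {0..} m\<^sub>0" and "\<delta> > 0" "T > 0"
  shows "(m, \<alpha>) \<in> admissible (\<lambda>_. 1) {0..T} m\<^sub>0"
proof -
  note D = admissibleD[OF adm]
  define A where "A s = (\<integral>\<^sup>+x. ennreal ((norm (\<alpha> s x))\<^sup>2) \<partial>meas (m s))" for s
  have "(\<integral>\<^sup>+s\<in>{0..T}. ennreal 1 * A s \<partial>lborel)
      \<le> (\<integral>\<^sup>+s. ennreal (exp (\<delta> * T)) * (ennreal (exp (- \<delta> * s)) * A s * indicator {0..} s) \<partial>lborel)"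
  proof (rule nn_integral_mono)
    fix s
    have "1 \<le> exp (\<delta> * T) * exp (- \<delta> * s)" if "s \<le> T"
      using that \<open>\<delta> > 0\<close> by (simp flip: exp_add add: mult_left_mono)
    then have "ennreal 1 \<le> ennreal (exp (\<delta> * T)) * ennreal (exp (- \<delta> * s))" if "s \<le> T"
      using that by (subst ennreal_mult[symmetric]) (auto intro: ennreal_leI)
    then have "ennreal 1 * A s \<le> ennreal (exp (\<delta> * T)) * ennreal (exp (- \<delta> * s)) * A s" if "s \<le> T"
      using that by (intro mult_right_mono) auto
    then show "ennreal 1 * A s * indicator {0..T} s
      \<le> ennreal (exp (\<delta> * T)) * (ennreal (exp (- \<delta> * s)) * A s * indicator {0..} s)"
      by (auto simp: indicator_def mult.assoc)
  qed
  also have "\<dots> < \<infinity>"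
  proof -
    have Am: "(\<lambda>s. ennreal (exp (- \<delta> * s)) * A s * indicator {0..} s) \<in> borel_measurable lborel"
    proof -
      have "(\<lambda>s. A s * indicator {0..} s) \<in> borel_measurable borel"
        unfolding A_def by (rule curve_energy_measurable[OF D(1) _ D(3)]) simp
      then have "(\<lambda>s. ennreal (exp (- \<delta> * s)) * (A s * indicator {0..} s)) \<in> borel_measurable borel"
        by measurable
      then show ?thesis by (simp add: mult.assoc)
    qed
    show ?thesis
      using D(4) by (subst nn_integral_cmult[OF Am]) (simp add: A_def ennreal_mult_less_top)
  qed
  finally have fin: "(\<integral>\<^sup>+s\<in>{0..T}. ennreal 1 * A s \<partial>lborel) < \<infinity>" .
  have weak: "(LINT s:{0..T}|lborel. \<integral>x. fp_gen \<phi> s x (\<alpha> s x) \<partial>meas (m s)) + (\<integral>x. \<phi> 0 x \<partial>meas m\<^sub>0) = 0"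
    if \<phi>: "test_fun {0..T} \<phi>" for \<phi>
  proof -
    obtain a where a: "a \<in> interior {0..T}" "\<And>s x. s \<ge> a \<Longrightarrow> \<phi> s x = 0" using test_fun_vanish[OF \<phi>] by blast
    then have "a \<in> interior {0..}" by auto
    then have "test_fun {0..} \<phi>" using \<phi> a(2) by (auto simp: test_fun_def)
    note D(5)[OF this]
    moreover have "(LINT s:{0..}|lborel. \<integral>x. fp_gen \<phi> s x (\<alpha> s x) \<partial>meas (m s))
       = (LINT s:{0..T}|lborel. \<integral>x. fp_gen \<phi> s x (\<alpha> s x) \<partial>meas (m s))"
      by (rule set_integral_vanish(2)) (use a fp_gen_vanish[of a \<phi>] in auto)
    ultimately show ?thesis by simp
  qed
  show ?thesis
    unfolding admissible_def fp_solution_gen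
    using fin weak D(2) continuous_on_subset[OF D(1)] measurable_time_restrict[OF D(3), of "\<lambda>s. s" "{0..T}"]
    by (auto simp: A_def)
qed

text \<open>For a test function \<open>\<phi>\<close> with \<open>\<phi>(s) = 0\<close> for \<open>s \<ge> a\<close>, let \<open>\<psi>(s) = \<phi>(s - t)\<close>. The identity
  \<open>fp_terminal\<close> for \<open>\<psi>\<close> has the boundary term \<open>\<integral> \<phi>(0) dm(t)\<close> at time \<open>t\<close> and none at time
  \<open>t + a\<close>. The difference of the two identities is the weak formulation from time \<open>t\<close> on.\<close>

lemma admissible_shift:
  fixes \<alpha> :: "real \<Rightarrow> 'n::finite torus \<Rightarrow> real ^ 'n"
  assumes adm: "(m, \<alpha>) \<in> admissible (\<lambda>s. exp (- \<delta> * s)) {0..} m\<^sub>0" and "\<delta> > 0" "t > 0"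
  shows "(\<lambda>s. m (t + s), \<lambda>s. \<alpha> (t + s)) \<in> admissible (\<lambda>s. exp (- \<delta> * s)) {0..} (m t)"
proof -
  note D = admissibleD[OF adm]
  define A where "A s = (\<integral>\<^sup>+x. ennreal ((norm (\<alpha> s x))\<^sup>2) \<partial>meas (m s))" for s
  define W where "W s = ennreal (exp (- \<delta> * s)) * A s * indicator {0..} s" for s
  have Wm: "W \<in> borel_measurable borel"
  proof -
    have "(\<lambda>s. A s * indicator {0..} s) \<in> borel_measurable borel"
      unfolding A_def by (rule curve_energy_measurable[OF D(1) _ D(3)]) simp
    then have "(\<lambda>s. ennreal (exp (- \<delta> * s)) * (A s * indicator {0..} s)) \<in> borel_measurable borel"
      by measurable
    then show ?thesis by (simp add: W_def[abs_def] mult.assoc)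
  qed
  have "(\<integral>\<^sup>+s\<in>{0..}. ennreal (exp (- \<delta> * s)) * A (t + s) \<partial>lborel)
     \<le> (\<integral>\<^sup>+s. ennreal (exp (\<delta> * t)) * W (t + 1 * s) \<partial>lborel)"
  proof (rule nn_integral_mono)
    fix s
    have "exp (\<delta> * t) * exp (- \<delta> * (t + s)) = exp (- \<delta> * s)"
      by (simp flip: exp_add add: algebra_simps)
    then have "ennreal (exp (\<delta> * t)) * ennreal (exp (- \<delta> * (t + s))) = ennreal (exp (- \<delta> * s))"
      by (simp flip: ennreal_mult)
    then show "ennreal (exp (- \<delta> * s)) * A (t + s) * indicator {0..} s \<le> ennreal (exp (\<delta> * t)) * W (t + 1 * s)"
      using \<open>t > 0\<close> by (auto simp: W_def indicator_def simp flip: mult.assoc)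
  qed
  also have "\<dots> = ennreal (exp (\<delta> * t)) * (\<integral>\<^sup>+s. W s \<partial>lborel)"
    using Wm by (subst nn_integral_cmult) (auto simp: nn_integral_real_affine[of W 1 t])
  also have "\<dots> < \<infinity>" using D(4) by (simp add: W_def A_def ennreal_mult_less_top)
  finally have fin: "(\<integral>\<^sup>+s\<in>{0..}. ennreal (exp (- \<delta> * s)) * A (t + s) \<partial>lborel) < \<infinity>" .
  have weak: "(LINT s:{0..}|lborel. \<integral>x. fp_gen \<phi> s x (\<alpha> (t + s) x) \<partial>meas (m (t + s))) + (\<integral>x. \<phi> 0 x \<partial>meas (m t)) = 0"
    if \<phi>: "test_fun {0..} \<phi>" for \<phi>
  proof -
    obtain a where a: "a > 0" "\<And>s x. s \<ge> a \<Longrightarrow> \<phi> s x = 0" using test_fun_vanish[OF \<phi>] by auto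
    define \<psi> where "\<psi> = (\<lambda>s. \<phi> (s + (- t)))"
    define G where "G s = (\<integral>x. fp_gen \<psi> s x (\<alpha> s x) \<partial>meas (m s))" for s
    have \<psi>: "smooth_fun (tlift \<psi>)" unfolding \<psi>_def by (rule smooth_shift[OF test_fun_smooth[OF \<phi>]])
    have adm_t: "(m, \<alpha>) \<in> admissible (\<lambda>_. 1) {0..t} m\<^sub>0" and adm_T: "(m, \<alpha>) \<in> admissible (\<lambda>_. 1) {0..t + a} m\<^sub>0"
      using admissible_restrict[OF adm] assms a(1) by auto
    have 1: "(LINT s:{0..t}|lborel. G s) + (\<integral>x. \<psi> 0 x \<partial>meas m\<^sub>0) = (\<integral>x. \<phi> 0 x \<partial>meas (m t))"
      using fp_terminal[OF adm_t \<open>t > 0\<close> \<psi>] by (simp add: G_def \<psi>_def)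
    have 2: "(LINT s:{0..t + a}|lborel. G s) + (\<integral>x. \<psi> 0 x \<partial>meas m\<^sub>0) = 0"
      using fp_terminal[OF adm_T _ \<psi>] \<open>t > 0\<close> a by (simp add: G_def \<psi>_def)
    have iG: "set_integrable lborel {0..t + a} G"
      unfolding G_def by (rule fp_gen_integrable(1)[OF adm_T \<psi>])
    have u: "{0..t} \<union> {t..t + a} = {0..t + a}" "{0..t} \<inter> {t..t + a} = {t}" using \<open>t > 0\<close> a(1) by auto
    have "(LINT s:{0..t} \<union> {t..t + a}|lborel. G s) = (LINT s:{0..t}|lborel. G s) + (LINT s:{t..t + a}|lborel. G s)"
      by (rule set_integral_glue(2)[OF _ _ u(2)]) (use u in \<open>auto intro!: set_integrable_subset[OF iG]\<close>)
    moreover have "(LINT s:{t..t + a}|lborel. G s) = (LINT s:{0..a}|lborel. G (t + s))"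
      using set_integral_shift(2)[of "{0..a}" G t] by (simp add: add.commute)
    moreover have "G (t + s) = (\<integral>x. fp_gen \<phi> s x (\<alpha> (t + s) x) \<partial>meas (m (t + s)))" for s
      unfolding G_def \<psi>_def fp_gen_shift by simp
    moreover have "(LINT s:{0..}|lborel. \<integral>x. fp_gen \<phi> s x (\<alpha> (t + s) x) \<partial>meas (m (t + s)))
       = (LINT s:{0..a}|lborel. \<integral>x. fp_gen \<phi> s x (\<alpha> (t + s) x) \<partial>meas (m (t + s)))"
      by (rule set_integral_vanish(2)) (use fp_gen_vanish[of a \<phi>, OF a(2)] in auto)
    ultimately show ?thesis using 1 2 u(1) by simp
  qed
  show ?thesis
    unfolding admissible_def fp_solution_gen
    using fin weak measurable_time_restrict[OF D(3), of "\<lambda>s. t + s" "{0..}"] \<open>t > 0\<close>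
    by (auto simp: A_def intro!: continuous_on_compose2[OF D(1)] continuous_intros)
qed

text \<open>At the junction the first function wins. For curves the two values agree there, and for controls a
  single time is negligible.\<close>

definition concat_at :: "real \<Rightarrow> (real \<Rightarrow> 'a) \<Rightarrow> (real \<Rightarrow> 'a) \<Rightarrow> real \<Rightarrow> 'a" where
  "concat_at t f g s = (if s \<le> t then f s else g (s - t))"

text \<open>The first curve contributes the boundary term at time \<open>t\<close> from \<open>fp_terminal\<close>, and the second one
  contributes the same term, with the opposite sign, as its initial term.\<close>

lemma admissible_concat:
  fixes \<alpha> \<beta> :: "real \<Rightarrow> 'n::finite torus \<Rightarrow> real ^ 'n"
  assumes adm1: "(m, \<alpha>) \<in> admissible (\<lambda>_. 1) {0..t} m\<^sub>0"
    and adm2: "(n, \<beta>) \<in> admissible (\<lambda>s. exp (- \<delta> * s)) {0..} (m t)" and "\<delta> > 0" "t > 0"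
  shows "(concat_at t m n, concat_at t \<alpha> \<beta>) \<in> admissible (\<lambda>s. exp (- \<delta> * s)) {0..} m\<^sub>0"
proof -
  note D1 = admissibleD[OF adm1] and D2 = admissibleD[OF adm2]
  let ?m = "concat_at t m n" and ?\<alpha> = "concat_at t \<alpha> \<beta>"
  have late: "?m (t + s) = n s" if "s \<ge> 0" for s
    using that D2(2) by (auto simp: concat_at_def)
  have late': "?\<alpha> (t + s) = \<beta> s" if "s > 0" for s using that by (auto simp: concat_at_def)
  have cont: "continuous_on {0..} ?m"
  proof -
    have "continuous_on ({0..t} \<union> {t..}) (\<lambda>s. if s \<le> t then m s else n (s - t))"
      by (rule continuous_on_If)
         (use D1(1) D2(1,2) in \<open>auto intro!: continuous_on_compose2[OF D2(1)] continuous_intros\<close>)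
    also have "{0..t} \<union> {t..} = {0..}" using \<open>t > 0\<close> by auto
    finally show ?thesis by (simp add: concat_at_def[abs_def])
  qed
  have meas: "(\<lambda>(s, x). ?\<alpha> s x) \<in> borel_measurable (restrict_space borel {0..} \<Otimes>\<^sub>M borel)"
  proof -
    have 1: "(\<lambda>(s, x). \<alpha> (min t s) x) \<in> borel_measurable (restrict_space borel {0..} \<Otimes>\<^sub>M borel)"
      by (rule measurable_time_restrict[OF D1(3)]) (use \<open>t > 0\<close> in auto)
    have 2: "(\<lambda>(s, x). \<beta> (max 0 (s - t)) x) \<in> borel_measurable (restrict_space borel {0..} \<Otimes>\<^sub>M borel)"
      by (rule measurable_time_restrict[OF D2(3)]) auto
    have fst: "fst \<in> borel_measurable (restrict_space borel {0::real..} \<Otimes>\<^sub>M borel)"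
      by (rule measurable_compose[OF measurable_fst measurable_restrict_space1[OF measurable_ident_sets[OF refl]]])
    have "(\<lambda>z. if fst z \<le> t then (\<lambda>(s, x). \<alpha> (min t s) x) z else (\<lambda>(s, x). \<beta> (max 0 (s - t)) x) z)
        \<in> borel_measurable (restrict_space borel {0..} \<Otimes>\<^sub>M borel)"
      using measurable_sets[OF fst, of "{..t}"]
      by (intro measurable_If 1 2) (simp_all add: vimage_def Int_def conj_commute)
    also have "(\<lambda>z. if fst z \<le> t then (\<lambda>(s, x). \<alpha> (min t s) x) z else (\<lambda>(s, x). \<beta> (max 0 (s - t)) x) z)
        = (\<lambda>(s, x). ?\<alpha> s x)"
      by (auto simp: fun_eq_iff concat_at_def min_def max_def)
    finally show ?thesis .
  qed
  define A where "A s = (\<integral>\<^sup>+x. ennreal ((norm (?\<alpha> s x))\<^sup>2) \<partial>meas (?m s))" for s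
  define B where "B s = (\<integral>\<^sup>+x. ennreal ((norm (\<beta> s x))\<^sup>2) \<partial>meas (n s))" for s
  have fin: "(\<integral>\<^sup>+s\<in>{0..}. ennreal (exp (- \<delta> * s)) * A s \<partial>lborel) < \<infinity>"
  proof -
    have Am: "(\<lambda>s. A s * indicator {0..} s) \<in> borel_measurable borel"
      unfolding A_def by (rule curve_energy_measurable[OF cont _ meas]) simp
    have wA: "(\<lambda>s. ennreal (exp (- \<delta> * s)) * A s * indicator {0..} s * indicator J s) \<in> borel_measurable borel"
      if "J \<in> sets borel" for J
    proof -
      have "(\<lambda>s. ennreal (exp (- \<delta> * s)) * (A s * indicator {0..} s) * indicator J s) \<in> borel_measurable borel"
        using Am that by measurable
      then show ?thesis by (simp add: mult.assoc)
    qed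
    have "(\<integral>\<^sup>+s\<in>{0..}. ennreal (exp (- \<delta> * s)) * A s \<partial>lborel) =
       (\<integral>\<^sup>+s. ennreal (exp (- \<delta> * s)) * A s * indicator {0..} s * indicator {..t} s
         + ennreal (exp (- \<delta> * s)) * A s * indicator {0..} s * indicator {t<..} s \<partial>lborel)"
      by (rule nn_integral_cong) (auto simp: indicator_def)
    also have "\<dots> = (\<integral>\<^sup>+s. ennreal (exp (- \<delta> * s)) * A s * indicator {0..} s * indicator {..t} s \<partial>lborel)
         + (\<integral>\<^sup>+s. ennreal (exp (- \<delta> * s)) * A s * indicator {0..} s * indicator {t<..} s \<partial>lborel)"
      by (rule nn_integral_add) (use wA in auto)
    finally have sum: "(\<integral>\<^sup>+s\<in>{0..}. ennreal (exp (- \<delta> * s)) * A s \<partial>lborel) =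
       (\<integral>\<^sup>+s. ennreal (exp (- \<delta> * s)) * A s * indicator {0..} s * indicator {..t} s \<partial>lborel)
         + (\<integral>\<^sup>+s. ennreal (exp (- \<delta> * s)) * A s * indicator {0..} s * indicator {t<..} s \<partial>lborel)" .
    have "(\<integral>\<^sup>+s. ennreal (exp (- \<delta> * s)) * A s * indicator {0..} s * indicator {t<..} s \<partial>lborel)
       = (\<integral>\<^sup>+s. ennreal (exp (- \<delta> * (t + s))) * A (t + s) * indicator {0..} (t + s) * indicator {t<..} (t + s) \<partial>lborel)"
      using nn_integral_real_affine[of _ 1 t, OF wA[of "{t<..}"]] by simp
    also have "\<dots> \<le> (\<integral>\<^sup>+s\<in>{0..}. ennreal (exp (- \<delta> * s)) * B s \<partial>lborel)"
    proof (rule nn_integral_mono)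
      fix s
      have "A (t + s) = B s" if "s > 0" using that late[of s] late'[of s] by (simp add: A_def B_def)
      moreover have "ennreal (exp (- \<delta> * (t + s))) \<le> ennreal (exp (- \<delta> * s))"
        using assms(3,4) by (intro ennreal_leI) simp
      ultimately show "ennreal (exp (- \<delta> * (t + s))) * A (t + s) * indicator {0..} (t + s) * indicator {t<..} (t + s)
         \<le> ennreal (exp (- \<delta> * s)) * B s * indicator {0..} s"
        by (auto simp: indicator_def intro!: mult_right_mono)
    qed
    finally have late_fin: "(\<integral>\<^sup>+s. ennreal (exp (- \<delta> * s)) * A s * indicator {0..} s * indicator {t<..} s \<partial>lborel) < \<infinity>"
      using D2(4) by (simp add: B_def)
    have "(\<integral>\<^sup>+s. ennreal (exp (- \<delta> * s)) * A s * indicator {0..} s * indicator {..t} s \<partial>lborel)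
       \<le> (\<integral>\<^sup>+s\<in>{0..t}. ennreal 1 * (\<integral>\<^sup>+x. ennreal ((norm (\<alpha> s x))\<^sup>2) \<partial>meas (m s)) \<partial>lborel)"
    proof (rule nn_integral_mono)
      fix s
      have "ennreal (exp (- \<delta> * s)) * A s \<le> ennreal 1 * A s" if "s \<ge> 0"
        using assms(3) that by (intro mult_right_mono ennreal_leI) auto
      moreover have "A s = (\<integral>\<^sup>+x. ennreal ((norm (\<alpha> s x))\<^sup>2) \<partial>meas (m s))" if "s \<le> t"
        using that by (simp add: A_def concat_at_def)
      ultimately show "ennreal (exp (- \<delta> * s)) * A s * indicator {0..} s * indicator {..t} s
         \<le> ennreal 1 * (\<integral>\<^sup>+x. ennreal ((norm (\<alpha> s x))\<^sup>2) \<partial>meas (m s)) * indicator {0..t} s"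
        by (cases "0 \<le> s \<and> s \<le> t") (auto simp: indicator_def)
    qed
    also have "\<dots> < \<infinity>" using D1(4) .
    finally show ?thesis using late_fin unfolding sum by simp
  qed
  have weak: "(LINT s:{0..}|lborel. \<integral>x. fp_gen \<phi> s x (?\<alpha> s x) \<partial>meas (?m s)) + (\<integral>x. \<phi> 0 x \<partial>meas m\<^sub>0) = 0"
    if \<phi>: "test_fun {0..} \<phi>" for \<phi>
  proof -
    obtain a where a: "a > 0" "\<And>s x. s \<ge> a \<Longrightarrow> \<phi> s x = 0" using test_fun_vanish[OF \<phi>] by auto
    note sm = test_fun_smooth[OF \<phi>]
    define \<psi> where "\<psi> = (\<lambda>s. \<phi> (s + t))"
    have sm': "smooth_fun (tlift \<psi>)" unfolding \<psi>_def by (rule smooth_shift[OF sm])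
    have \<psi>: "test_fun {0..} \<psi>"
      unfolding test_fun_def using sm' a \<open>t > 0\<close> by (auto simp: \<psi>_def intro!: bexI[of _ a])
    define G where "G s = (\<integral>x. fp_gen \<phi> s x (?\<alpha> s x) \<partial>meas (?m s))" for s
    define G2 where "G2 s = (\<integral>x. fp_gen \<psi> s x (\<beta> s x) \<partial>meas (n s))" for s
    have G1: "G s = (\<integral>x. fp_gen \<phi> s x (\<alpha> s x) \<partial>meas (m s))" if "s \<in> {0..t}" for s
      using that by (simp add: G_def concat_at_def)
    have i1: "set_integrable lborel {0..t} G"
      by (rule set_integrable_cong[OF refl refl G1, THEN iffD2, OF _ fp_gen_integrable(1)[OF adm1 sm]])
    have v1: "(LINT s:{0..t}|lborel. G s) + (\<integral>x. \<phi> 0 x \<partial>meas m\<^sub>0) = (\<integral>x. \<phi> t x \<partial>meas (m t))"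
    proof -
      have "(LINT s:{0..t}|lborel. G s) = (LINT s:{0..t}|lborel. \<integral>x. fp_gen \<phi> s x (\<alpha> s x) \<partial>meas (m s))"
        by (rule set_lebesgue_integral_cong) (use G1 in auto)
      then show ?thesis using fp_terminal[OF adm1 \<open>t > 0\<close> sm] by simp
    qed
    have G2: "G (t + s) = G2 s" if "s > 0" for s
      using that late[of s] late'[of s] fp_gen_shift[of \<phi> t s] by (simp add: G_def G2_def \<psi>_def add.commute)
    have van: "G2 s = 0" if "s > a" for s
      using fp_gen_vanish[of a \<psi>, OF _ that] a \<open>t > 0\<close> by (simp add: G2_def \<psi>_def)
    have i2: "set_integrable lborel {0..} G2"
    proof -
      have "set_integrable lborel {0..a} G2"
        unfolding G2_def[abs_def]
        by (rule fp_gen_integrable(1)[OF admissible_restrict[OF adm2 \<open>\<delta> > 0\<close> a(1)] sm'])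
      then show ?thesis using set_integral_vanish(1)[of "{0..a}" "{0..}" G2] van by auto
    qed
    have v2: "(LINT s:{0..}|lborel. G2 s) = - (\<integral>x. \<phi> t x \<partial>meas (m t))"
      using D2(5)[OF \<psi>] by (simp add: G2_def \<psi>_def)
    have "set_integrable lborel {0..} (\<lambda>s. G (t + s)) \<and> (LINT s:{0..}|lborel. G (t + s)) = (LINT s:{0..}|lborel. G2 s)"
    proof -
      have eq: "(\<lambda>s. indicator {0..} s *\<^sub>R G (t + s))
          = (\<lambda>s. indicator {0..} s *\<^sub>R G2 s + indicator {0} s * (G t - G2 0))"
        using G2 by (auto simp: fun_eq_iff indicator_def)
      have z: "integrable lborel (\<lambda>s. indicator {0::real} s * (G t - G2 0))"
        "(LINT s|lborel. indicator {0::real} s * (G t - G2 0)) = 0" by simp_all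
      show ?thesis
        using i2 z unfolding set_integrable_def set_lebesgue_integral_def eq by simp
    qed
    then have i3: "set_integrable lborel {t..} G" and v3: "(LINT s:{t..}|lborel. G s) = - (\<integral>x. \<phi> t x \<partial>meas (m t))"
      using set_integral_shift[of "{0..}" G t] v2 by simp_all
    have u: "{0..t} \<union> {t..} = {0..}" "{0..t} \<inter> {t..} = {t}" using \<open>t > 0\<close> by auto
    show ?thesis
      using set_integral_glue(2)[OF i1 i3 u(2)] u(1) v1 v3 by (simp add: G_def)
  qed
  show ?thesis
    unfolding admissible_def fp_solution_gen
    using cont meas fin weak D1(2) \<open>t > 0\<close> by (simp add: A_def concat_at_def[of t m n 0])
qed

section \<open>The Legendre transform\<close>

lemma hess_vector:
  fixes f :: "real ^ 'n::finite \<Rightarrow> real"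
  assumes f: "\<And>v. (f has_derivative f' v) (at v)"
    and f': "\<And>i. ((\<lambda>v. f' v (axis i 1)) has_derivative g i) (at v)"
  shows "hess f v *v h = (\<chi> i. g i h)"
  using fun_cong[OF matrix_vector_mul(2)[OF has_derivative_linear[OF hess_eq(2)[OF f f']]], of h]
  unfolding hess_def jacobian_def frechet_derivative_at[OF hess_eq(2)[OF f f'], symmetric] .

text \<open>Taylor expansion along the ray from \<open>0\<close> to \<open>p\<close>: the second derivative is at least
  \<open>|p|\<^sup>2 / C\<close>, and the value and the gradient at momentum \<open>0\<close> are bounded because the torus is
  compact.\<close>

lemma hamiltonian_bounds:
  fixes H :: "'n::finite torus \<Rightarrow> real ^ 'n \<Rightarrow> real"
  assumes H_C2: "C2_fun (\<lambda>(v, p). H (torus_proj v) p)"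
    and convex: "C > 0" "\<And>x p. matrix_le ((1 / C) *\<^sub>R mat 1) (D_pp H x p)"
  shows "continuous_on UNIV (\<lambda>(v, p). H (torus_proj v) p)"
    and "\<exists>K>0. \<forall>x p. \<bar>H x 0\<bar> \<le> K \<and> H x p \<ge> (norm p)\<^sup>2 / (2 * C) - K * norm p - K"
proof -
  let ?h = "\<lambda>(v, p). H (torus_proj v) p"
  obtain f' :: "(real ^ 'n) \<times> (real ^ 'n) \<Rightarrow> ((real ^ 'n) \<times> (real ^ 'n)) \<Rightarrow>\<^sub>L real"
    and f'' :: "(real ^ 'n) \<times> (real ^ 'n) \<Rightarrow> ((real ^ 'n) \<times> (real ^ 'n)) \<Rightarrow>\<^sub>L (((real ^ 'n) \<times> (real ^ 'n)) \<Rightarrow>\<^sub>L real)"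
    where f': "\<And>z. (?h has_derivative blinfun_apply (f' z)) (at z)"
      and f'': "\<And>z. (f' has_derivative blinfun_apply (f'' z)) (at z)"
    using H_C2 unfolding C2_fun_def by blast
  show cont: "continuous_on UNIV ?h"
    by (intro continuous_at_imp_continuous_on ballI) (rule has_derivative_continuous[OF f'])
  have contf': "continuous_on UNIV f'"
    by (intro continuous_at_imp_continuous_on ballI) (rule has_derivative_continuous[OF f''])
  have slice: "((\<lambda>q. (v, q)) has_derivative (\<lambda>e. (0, e))) (at q)" for v q :: "real ^ 'n"
    by (rule has_derivative_Pair[OF has_derivative_const has_derivative_ident])
  have d1: "(H (torus_proj v) has_derivative (\<lambda>e. f' (v, q) (0, e))) (at q)" for v q
    using has_derivative_compose[OF slice f'] by simp
  have d2: "((\<lambda>q. f' (v, q) w) has_derivative (\<lambda>e. f'' (v, q) (0, e) w)) (at q)" for v q w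
    using has_derivative_compose[OF has_derivative_compose[OF slice f'']
        bounded_linear_imp_has_derivative[OF blinfun.bounded_linear_left]] by simp
  have conv: "(norm p)\<^sup>2 / C \<le> f'' (v, q) (0, p) (0, p)" for v q p
  proof -
    have "D_pp H (torus_proj v) q *v p = (\<chi> i. f'' (v, q) (0, p) (0, axis i 1))"
      unfolding D_pp_def by (rule hess_vector[OF d1 d2])
    moreover have "p \<bullet> (\<chi> i. f'' (v, q) (0, p) (0, axis i 1)) = f'' (v, q) (0, p) (0, p)"
    proof -
      interpret linear "\<lambda>e. f'' (v, q) (0, p) (0, e)"
      proof (rule linearI)
        fix r and x y :: "real ^ 'n"
        show "f'' (v, q) (0, p) (0, x + y) = f'' (v, q) (0, p) (0, x) + f'' (v, q) (0, p) (0, y)"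
          using blinfun.add_right[of "f'' (v, q) (0, p)" "(0, x)" "(0, y)"] by simp
        show "f'' (v, q) (0, p) (0, r *\<^sub>R x) = r *\<^sub>R f'' (v, q) (0, p) (0, x)"
          using blinfun.scaleR_right[of "f'' (v, q) (0, p)" r "(0, x)"] by simp
      qed
      have "f'' (v, q) (0, p) (0, p) = f'' (v, q) (0, p) (0, \<Sum>i\<in>UNIV. (p $ i) *\<^sub>R axis i 1)"
        using basis_expansion[of p] by (simp add: scalar_mult_eq_scaleR)
      also have "\<dots> = (\<Sum>i\<in>UNIV. p $ i * f'' (v, q) (0, p) (0, axis i 1))"
        by (simp add: sum scale)
      finally show ?thesis by (simp add: inner_vec_def)
    qed
    ultimately show ?thesis
      using convex(2)[of "torus_proj v" q] unfolding matrix_le_def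
      by (metis (no_types, lifting) divide_inverse inner_scaleR_right matrix_vector_mul_lid
          mult.commute mult.right_neutral power2_norm_eq_inner scaleR_matrix_vector_assoc inverse_eq_divide)
  qed
  have taylor: "H (torus_proj v) p \<ge> H (torus_proj v) 0 + f' (v, 0) (0, p) + (norm p)\<^sup>2 / (2 * C)" for v p
  proof -
    define b where "b = (norm p)\<^sup>2 / C"
    have line: "((\<lambda>r. r *\<^sub>R p) has_derivative (\<lambda>h. h *\<^sub>R p)) (at r)" for r
      by (rule bounded_linear_imp_has_derivative[OF bounded_linear_scaleR_left])
    have g1: "((\<lambda>r. H (torus_proj v) (r *\<^sub>R p)) has_real_derivative f' (v, r *\<^sub>R p) (0, p)) (at r)" for r
    proof -
      have "(\<lambda>h. f' (v, r *\<^sub>R p) (0, h *\<^sub>R p)) = (*) (f' (v, r *\<^sub>R p) (0, p))"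
        using blinfun.scaleR_right[of "f' (v, r *\<^sub>R p)" _ "(0, p)"] by (auto simp: fun_eq_iff mult.commute)
      then show ?thesis
        unfolding has_field_derivative_def
        by (intro has_derivative_eq_rhs[OF has_derivative_compose[OF line d1]])
    qed
    have g2: "((\<lambda>r. f' (v, r *\<^sub>R p) (0, p)) has_real_derivative f'' (v, r *\<^sub>R p) (0, p) (0, p)) (at r)" for r
    proof -
      have "(\<lambda>h. f'' (v, r *\<^sub>R p) (0, h *\<^sub>R p) (0, p)) = (*) (f'' (v, r *\<^sub>R p) (0, p) (0, p))"
        using blinfun.scaleR_right[of "f'' (v, r *\<^sub>R p)" _ "(0, p)"]
        by (auto simp: fun_eq_iff mult.commute blinfun.scaleR_left)
      then show ?thesis
        unfolding has_field_derivative_def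
        by (intro has_derivative_eq_rhs[OF has_derivative_compose[OF line d2]])
    qed
    have k1: "f' (v, 0) (0, p) + b * r \<le> f' (v, r *\<^sub>R p) (0, p)" if "r \<ge> 0" for r
    proof -
      have "f' (v, 0 *\<^sub>R p) (0, p) - b * 0 \<le> f' (v, r *\<^sub>R p) (0, p) - b * r"
      proof (rule DERIV_nonneg_imp_nondecreasing[OF that])
        fix x :: real
        have "((\<lambda>r. f' (v, r *\<^sub>R p) (0, p) - b * r) has_real_derivative f'' (v, x *\<^sub>R p) (0, p) (0, p) - b) (at x)"
          by (rule DERIV_diff[OF g2]) (auto intro!: derivative_eq_intros)
        then show "\<exists>y. ((\<lambda>r. f' (v, r *\<^sub>R p) (0, p) - b * r) has_real_derivative y) (at x) \<and> 0 \<le> y"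
          using conv[of p v "x *\<^sub>R p"] by (auto simp: b_def)
      qed
      then show ?thesis by simp
    qed
    have "H (torus_proj v) (0 *\<^sub>R p) - f' (v, 0) (0, p) * 0 - b / 2 * 0\<^sup>2
        \<le> H (torus_proj v) (1 *\<^sub>R p) - f' (v, 0) (0, p) * 1 - b / 2 * 1\<^sup>2"
    proof (rule DERIV_nonneg_imp_nondecreasing[of 0 1
          "\<lambda>r. H (torus_proj v) (r *\<^sub>R p) - f' (v, 0) (0, p) * r - b / 2 * r\<^sup>2"])
      fix x :: real assume x: "0 \<le> x" "x \<le> 1"
      have "((\<lambda>r. H (torus_proj v) (r *\<^sub>R p) - f' (v, 0) (0, p) * r - b / 2 * r\<^sup>2)
          has_real_derivative f' (v, x *\<^sub>R p) (0, p) - f' (v, 0) (0, p) - b * x) (at x)"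
        by (intro DERIV_diff g1) (auto intro!: derivative_eq_intros)
      then show "\<exists>y. ((\<lambda>r. H (torus_proj v) (r *\<^sub>R p) - f' (v, 0) (0, p) * r - b / 2 * r\<^sup>2)
          has_real_derivative y) (at x) \<and> 0 \<le> y"
        using k1[OF x(1)] by (auto simp: algebra_simps)
    qed simp
    then show ?thesis by (simp add: b_def)
  qed
  obtain B0 where B0: "B0 > 0" "\<And>x. \<bar>H x 0\<bar> \<le> B0"
  proof -
    have "continuous_on ({0::real} \<times> UNIV) (\<lambda>(s, v). H (torus_proj v) 0)"
    proof -
      have "continuous_on ({0::real} \<times> UNIV) (\<lambda>z. (\<lambda>(v, p). H (torus_proj v) p) (snd z, 0))"
        by (rule continuous_on_compose2[OF cont]) (auto intro!: continuous_intros)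
      then show ?thesis by (simp add: split_beta)
    qed
    from lift_bounded[where f = "\<lambda>s x. H x 0", OF this] that show thesis by auto
  qed
  let ?C = "cbox (0::real^'n) (\<Sum>b\<in>Basis. b)"
  have "continuous_on ?C (\<lambda>v. f' (v, 0))"
    by (rule continuous_on_compose2[OF contf']) (auto intro!: continuous_on_Pair continuous_on_id continuous_on_const)
  then have "bounded ((\<lambda>v. f' (v, 0)) ` ?C)"
    by (rule compact_imp_bounded[OF compact_continuous_image[OF _ compact_cbox]])
  then obtain B1 where B1: "B1 > 0" "\<And>v. v \<in> ?C \<Longrightarrow> norm (f' (v, 0)) \<le> B1"
    unfolding bounded_pos by blast
  show "\<exists>K>0. \<forall>x p. \<bar>H x 0\<bar> \<le> K \<and> H x p \<ge> (norm p)\<^sup>2 / (2 * C) - K * norm p - K"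
  proof (intro exI[of _ "B0 + B1"] conjI allI)
    fix x p
    obtain v where v: "v \<in> ?C" "torus_proj v = x" using torus_proj_cube by blast
    have "\<bar>f' (v, 0) (0, p)\<bar> \<le> norm (f' (v, 0)) * norm p"
      using norm_blinfun[of "f' (v, 0)" "(0, p)"] by (simp add: norm_Pair)
    also have "\<dots> \<le> B1 * norm p" by (intro mult_right_mono B1(2) v) auto
    finally have "\<bar>f' (v, 0) (0, p)\<bar> \<le> B1 * norm p" .
    moreover have "B1 * norm p \<le> (B0 + B1) * norm p" using B0(1) by (intro mult_right_mono) auto
    ultimately show "H x p \<ge> (norm p)\<^sup>2 / (2 * C) - (B0 + B1) * norm p - (B0 + B1)"
      using taylor[of v p] v(2) B0(2)[of x] B1(1) by (simp add: abs_le_iff)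
    show "\<bar>H x 0\<bar> \<le> B0 + B1" using B0(2)[of x] B1(1) by simp
  qed (use B0(1) B1(1) in simp)
qed

text \<open>The lower bound is the choice \<open>p = 0\<close> in the supremum, and the upper bound is Young's inequality
  \<open>|p| y \<le> |p|\<^sup>2 / (2 C) + C y\<^sup>2 / 2\<close> for \<open>y = |q| + K\<close>.\<close>

lemma Hstar_bounds:
  fixes H :: "'n::finite torus \<Rightarrow> real ^ 'n \<Rightarrow> real"
  assumes C: "C > 0" and K: "K > 0"
    and H: "\<And>x. \<bar>H x 0\<bar> \<le> K" "\<And>x p. H x p \<ge> (norm p)\<^sup>2 / (2 * C) - K * norm p - K"
  shows "bdd_above (range (\<lambda>p. p \<bullet> q - H x p))"
    and "- K \<le> Hstar H x q"
    and "Hstar H x q \<le> (K + C + C * K\<^sup>2) * (1 + (norm q)\<^sup>2)"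
proof -
  have up: "p \<bullet> q - H x p \<le> (K + C + C * K\<^sup>2) * (1 + (norm q)\<^sup>2)" for p
  proof -
    define y where "y = norm q + K"
    have "p \<bullet> q \<le> norm p * norm q" by (rule norm_cauchy_schwarz)
    then have "p \<bullet> q - H x p \<le> norm p * y - (norm p)\<^sup>2 / (2 * C) + K"
      using H(2)[where p = p and x = x] by (simp add: y_def algebra_simps)
    also have "norm p * y - (norm p)\<^sup>2 / (2 * C) \<le> C * y\<^sup>2 / 2"
    proof -
      have "0 \<le> (norm p - C * y)\<^sup>2 / (2 * C)" using C by simp
      also have "\<dots> = (norm p)\<^sup>2 / (2 * C) - norm p * y + C * y\<^sup>2 / 2"
        using C by (simp add: power2_eq_square field_simps)
      finally show ?thesis by simp
    qed
    also have "C * y\<^sup>2 / 2 \<le> C * ((norm q)\<^sup>2 + K\<^sup>2)"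
    proof -
      have "y\<^sup>2 \<le> 2 * ((norm q)\<^sup>2 + K\<^sup>2)"
        using zero_le_power2[of "norm q - K"] by (simp add: y_def power2_eq_square algebra_simps)
      then have "C * y\<^sup>2 \<le> C * (2 * ((norm q)\<^sup>2 + K\<^sup>2))" using C by (intro mult_left_mono) auto
      then show ?thesis by (simp add: algebra_simps)
    qed
    also have "C * ((norm q)\<^sup>2 + K\<^sup>2) + K \<le> (K + C + C * K\<^sup>2) * (1 + (norm q)\<^sup>2)"
    proof -
      have "0 \<le> C + K * (norm q)\<^sup>2 + C * K\<^sup>2 * (norm q)\<^sup>2" using C K by simp
      then show ?thesis by (simp add: algebra_simps)
    qed
    finally show ?thesis by simp
  qed
  then show bdd: "bdd_above (range (\<lambda>p. p \<bullet> q - H x p))" by (rule bdd_aboveI2)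
  show "Hstar H x q \<le> (K + C + C * K\<^sup>2) * (1 + (norm q)\<^sup>2)"
    unfolding Hstar_def by (rule cSUP_least) (use up in auto)
  have "0 \<bullet> q - H x 0 \<le> Hstar H x q"
    unfolding Hstar_def by (rule cSUP_upper[OF _ bdd]) simp
  then show "- K \<le> Hstar H x q" using H(1)[of x] by simp
qed

text \<open>By continuity of \<open>H\<close> the supremum may be taken over a countable dense set of momenta.\<close>

lemma Hstar_measurable:
  fixes H :: "'n::finite torus \<Rightarrow> real ^ 'n \<Rightarrow> real"
  assumes cont: "continuous_on UNIV (\<lambda>(v, p). H (torus_proj v) p)"
    and bdd: "\<And>x q. bdd_above (range (\<lambda>p. p \<bullet> q - H x p))"
  shows "(\<lambda>(x, q). Hstar H x q) \<in> borel_measurable (borel \<Otimes>\<^sub>M borel)"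
proof -
  obtain D :: "(real ^ 'n) set" where D: "countable D" "\<And>X. open X \<Longrightarrow> X \<noteq> {} \<Longrightarrow> \<exists>d\<in>D. d \<in> X"
    using countable_dense_exists by metis
  have cx: "continuous_on UNIV (\<lambda>x. H x p)" for p
  proof (rule continuous_on_lift1)
    have "continuous_on UNIV (\<lambda>v. (\<lambda>(v, p). H (torus_proj v) p) (v, p))"
      by (rule continuous_on_compose2[OF cont]) (auto intro!: continuous_intros)
    then show "continuous_on UNIV (\<lambda>v. H (torus_proj v) p)" by simp
  qed
  have cp: "continuous_on UNIV (H x)" for x
  proof -
    have "continuous_on UNIV (\<lambda>p. (\<lambda>(v, p). H (torus_proj v) p) (torus_rep x, p))"
      by (rule continuous_on_compose2[OF cont]) (auto intro!: continuous_intros)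
    then show ?thesis by simp
  qed
  have [measurable]: "(\<lambda>x. H x p) \<in> borel_measurable borel" for p
    by (rule borel_measurable_continuous_onI[OF cx])
  have iff: "a < Hstar H x q \<longleftrightarrow> (\<exists>p\<in>D. a < p \<bullet> q - H x p)" for a x q
  proof -
    have "open {p. a < p \<bullet> q - H x p}"
      by (intro open_Collect_less continuous_intros cp)
    with D(2)[of "{p. a < p \<bullet> q - H x p}"]
    have "(\<exists>p. a < p \<bullet> q - H x p) \<longleftrightarrow> (\<exists>p\<in>D. a < p \<bullet> q - H x p)" by auto
    then show ?thesis unfolding Hstar_def by (subst less_cSUP_iff[OF _ bdd]) auto
  qed
  show ?thesis
    unfolding borel_measurable_iff_greater
  proof
    fix a
    have "{z \<in> space (borel \<Otimes>\<^sub>M borel). a < (\<lambda>(x, q). Hstar H x q) z} =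
        (\<Union>p\<in>D. {z \<in> space (borel \<Otimes>\<^sub>M borel). a < p \<bullet> snd z - H (fst z) p})"
      by (auto simp: iff space_pair_measure)
    also have "\<dots> \<in> sets (borel \<Otimes>\<^sub>M borel)"
      by (intro sets.countable_UN'' D(1)) measurable
    finally show "{z \<in> space (borel \<Otimes>\<^sub>M borel). a < (\<lambda>(x, q). Hstar H x q) z} \<in> sets (borel \<Otimes>\<^sub>M borel)" .
  qed
qed

section \<open>Regularity of the coupling cost\<close>

lemma frechet_derivative_periodic:
  assumes diff: "\<And>v. f differentiable (at v)" and per: "\<And>v. f (v + c) = f v"
  shows "frechet_derivative f (at (v + c)) = frechet_derivative f (at v)"
proof -
  have "((\<lambda>v. v + c) has_derivative (\<lambda>h. h)) (at v)" by (auto intro!: derivative_eq_intros)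
  from has_derivative_compose[OF this, of f "frechet_derivative f (at (v + c))"]
  have "((\<lambda>v. f (v + c)) has_derivative frechet_derivative f (at (v + c))) (at v)"
    using diff frechet_derivative_works by blast
  then show ?thesis unfolding per by (rule frechet_derivative_at)
qed

text \<open>Along each coordinate direction the lift has period \<open>1\<close>, so by Rolle's theorem its partial
  derivative vanishes within distance \<open>1\<close> of every point. The bound on the second derivatives then bounds
  the partial derivatives by \<open>K\<close>.\<close>

lemma bounded_hess_lipschitz:
  fixes f :: "'n::finite torus \<Rightarrow> real"
  assumes diff: "twice_differentiable f" and K: "\<And>x. norm (thess f x) \<le> K"
  shows "\<bar>f x - f y\<bar> \<le> (real CARD('n) * K) * dist x y"
proof -
  let ?f = "\<lambda>v. f (torus_proj v)"
  have d1: "\<And>v. ?f differentiable (at v)" and d2: "\<And>v. grad ?f differentiable (at v)"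
    using diff by (auto simp: twice_differentiable_def)
  have per: "?f (v + c) = ?f v" if "int_congruent c 0" for v c
  proof -
    have "torus_proj (v + c) = torus_proj v" using that by (simp add: torus_proj_eq_iff int_congruent_def)
    then show ?thesis by simp
  qed
  have gper: "grad ?f (v + c) = grad ?f v" if "int_congruent c 0" for v c
    unfolding grad_def using frechet_derivative_periodic[OF d1 per[OF that]] by simp
  have hess: "norm (hess ?f v) \<le> K" for v
  proof -
    define c where "c = torus_rep (torus_proj v) - v"
    have "int_congruent (torus_rep (torus_proj v)) v" by (simp flip: torus_proj_eq_iff)
    then have "int_congruent c 0" by (simp add: c_def int_congruent_def)
    from frechet_derivative_periodic[OF d2 gper[OF this], of v]
    have "hess ?f v = thess f (torus_proj v)"
      by (simp add: hess_def jacobian_def thess_def c_def)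
    then show ?thesis using K by simp
  qed
  have g1: "((\<lambda>r. ?f (v + r *\<^sub>R axis i 1)) has_real_derivative grad ?f (v + r *\<^sub>R axis i 1) $ i) (at r)" for v i r
  proof -
    have line: "((\<lambda>r. v + r *\<^sub>R axis i 1) has_derivative (\<lambda>h. h *\<^sub>R axis i 1)) (at r)"
      by (auto intro!: derivative_eq_intros)
    have D: "(?f has_derivative frechet_derivative ?f (at (v + r *\<^sub>R axis i 1))) (at (v + r *\<^sub>R axis i 1))"
      using d1 frechet_derivative_works by blast
    interpret linear "frechet_derivative ?f (at (v + r *\<^sub>R axis i 1))" by (rule has_derivative_linear[OF D])
    show ?thesis
      unfolding has_field_derivative_def
      by (rule has_derivative_eq_rhs[OF has_derivative_compose[OF line D]])
         (simp add: fun_eq_iff grad_def scale mult.commute)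
  qed
  have g2: "((\<lambda>r. grad ?f (v + r *\<^sub>R axis i 1) $ i) has_real_derivative hess ?f (v + r *\<^sub>R axis i 1) $ i $ i) (at r)" for v i r
  proof -
    have line: "((\<lambda>r. v + r *\<^sub>R axis i 1) has_derivative (\<lambda>h. h *\<^sub>R axis i 1)) (at r)"
      by (auto intro!: derivative_eq_intros)
    have D: "(grad ?f has_derivative frechet_derivative (grad ?f) (at (v + r *\<^sub>R axis i 1))) (at (v + r *\<^sub>R axis i 1))"
      using d2 frechet_derivative_works by blast
    interpret linear "frechet_derivative (grad ?f) (at (v + r *\<^sub>R axis i 1))" by (rule has_derivative_linear[OF D])
    show ?thesis
      unfolding has_field_derivative_def
      by (rule has_derivative_eq_rhs[OF bounded_linear.has_derivative[OF bounded_linear_vec_nth has_derivative_compose[OF line D]]])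
         (simp add: fun_eq_iff hess_def jacobian_def matrix_def scale mult.commute)
  qed
  have grad: "\<bar>grad ?f v $ i\<bar> \<le> K" for v i
  proof -
    have ends: "?f (v + 0 *\<^sub>R axis i 1) = ?f (v + 1 *\<^sub>R axis i 1)"
      using per[of "axis i 1" v] by (simp add: int_congruent_def axis_def)
    have "\<exists>z. 0 < z \<and> z < 1 \<and> ((\<lambda>r. ?f (v + r *\<^sub>R axis i 1)) has_real_derivative 0) (at z)"
      using Rolle[of 0 1 "\<lambda>r. ?f (v + r *\<^sub>R axis i 1)", OF _ ends] g1
      by (metis DERIV_continuous_on DERIV_unique has_field_derivative_at_within real_differentiable_def zero_less_one
          Rolle_deriv)
    then obtain z where z: "0 < z" "z < 1" "((\<lambda>r. ?f (v + r *\<^sub>R axis i 1)) has_real_derivative 0) (at z)" by blast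
    then have "grad ?f (v + z *\<^sub>R axis i 1) $ i = 0" using g1 DERIV_unique by blast
    moreover have "norm (grad ?f (v + 0 *\<^sub>R axis i 1) $ i - grad ?f (v + z *\<^sub>R axis i 1) $ i) \<le> K * norm (0 - z)"
    proof (rule field_differentiable_bound[of UNIV])
      show "norm (hess ?f (v + r *\<^sub>R axis i 1) $ i $ i) \<le> K" for r
        using hess[of "v + r *\<^sub>R axis i 1"] Finite_Cartesian_Product.norm_nth_le order_trans by metis
    qed (use g2 in auto)
    moreover have "K * z \<le> K"
      using z order_trans[OF norm_ge_zero K[of undefined]] by (intro mult_left_le) auto
    ultimately show ?thesis using z by simp
  qed
  obtain u where u: "torus_proj u = x" using torus_proj_surj by blast
  obtain v where v: "torus_proj v = y" "dist u v = dist x y" using torus_proj_lift_near u by blast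
  have "norm (?f u - ?f v) \<le> (real CARD('n) * K) * norm (u - v)"
  proof (rule differentiable_bound[of UNIV])
    fix v
    have D: "(?f has_derivative frechet_derivative ?f (at v)) (at v)"
      using d1 frechet_derivative_works by blast
    then show "(?f has_derivative frechet_derivative ?f (at v)) (at v within UNIV)" by simp
    interpret linear "frechet_derivative ?f (at v)" by (rule has_derivative_linear[OF D])
    show "onorm (frechet_derivative ?f (at v)) \<le> real CARD('n) * K"
    proof (rule onorm_le)
      fix h :: "real ^ 'n"
      have "frechet_derivative ?f (at v) h = frechet_derivative ?f (at v) (\<Sum>i\<in>UNIV. (h $ i) *\<^sub>R axis i 1)"
        using basis_expansion[of h] by (simp add: scalar_mult_eq_scaleR)
      also have "\<dots> = (\<Sum>i\<in>UNIV. h $ i * grad ?f v $ i)"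
        by (simp add: sum scale grad_def)
      also have "norm \<dots> \<le> (\<Sum>i\<in>(UNIV::'n set). norm h * K)"
        by (rule order_trans[OF norm_sum], rule sum_mono)
           (auto simp: abs_mult intro!: mult_mono grad component_le_norm_cart)
      finally show "norm (frechet_derivative ?f (at v) h) \<le> real CARD('n) * K * norm h"
        by (simp add: mult_ac)
    qed
  qed auto
  then show ?thesis using u v by (simp add: dist_norm)
qed

text \<open>The integrand of the formula for \<open>\<F> \<mu> - \<F> \<nu>\<close> is bounded by \<open>L\<close> times the distance at every
  time, and an integral that does not exist has the value \<open>0\<close>.\<close>

lemma flat_deriv_lipschitz:
  fixes \<F> :: "'n::finite torus_prob \<Rightarrow> real"
  assumes deriv: "is_flat_deriv \<F> D" and L: "L > 0" "\<And>m x y. \<bar>D m x - D m y\<bar> \<le> L * dist x y"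
  shows "\<bar>\<F> \<mu> - \<F> \<nu>\<bar> \<le> L * dist \<mu> \<nu>"
proof -
  let ?g = "\<lambda>t. (\<integral>x. D (mix t \<nu> \<mu>) x \<partial>meas \<mu>) - (\<integral>x. D (mix t \<nu> \<mu>) x \<partial>meas \<nu>)"
  have bd: "\<bar>?g t\<bar> \<le> L * dist \<mu> \<nu>" for t by (rule lipschitz_integral_diff(2)[OF L(2,1)])
  have "\<F> \<mu> - \<F> \<nu> = (LINT t:{0..1}|lborel. ?g t)"
    using deriv unfolding is_flat_deriv_def by blast
  also have "\<bar>\<dots>\<bar> \<le> L * dist \<mu> \<nu>"
  proof (cases "set_integrable lborel {0..1} ?g")
    case True
    have c: "set_integrable lborel {0..1::real} (\<lambda>_. L * dist \<mu> \<nu>)"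
      by (intro borel_integrable_atLeastAtMost' continuous_intros)
    have "\<bar>LINT t:{0..1}|lborel. ?g t\<bar> \<le> (LINT t:{0..1::real}|lborel. L * dist \<mu> \<nu>)"
      unfolding set_lebesgue_integral_def
      by (rule integral_abs_bound[THEN order_trans], rule integral_mono)
         (use True c bd in \<open>auto simp: set_integrable_def indicator_def\<close>)
    also have "\<dots> = L * dist \<mu> \<nu>" by (simp add: set_lebesgue_integral_def)
    finally show ?thesis .
  next
    case False
    then show ?thesis
      using L(1) by (simp add: set_integrable_def set_lebesgue_integral_def not_integrable_integral_eq)
  qed
  finally show ?thesis .
qed

text \<open>The derivative of \<open>\<F>\<close> is Lipschitz in space uniformly in the measure, which makes \<open>\<F>\<close> Lipschitz;
  it is bounded because the space of probability measures is.\<close>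

lemma coupling_cost_regular:
  fixes \<F> :: "'n::finite torus_prob \<Rightarrow> real"
  assumes F_deriv: "is_flat_deriv \<F> (\<lambda>m x. F x m)"
    and F_diff: "\<And>m. twice_differentiable (\<lambda>x. F x m)"
    and F_bounded: "\<And>x m. norm (thess (\<lambda>y. F y m) x) \<le> K"
  shows "continuous_on UNIV \<F>" and "\<exists>B>0. \<forall>\<mu>. \<bar>\<F> \<mu>\<bar> \<le> B"
proof -
  define L where "L = real CARD('n) * K + 1"
  have K: "K \<ge> 0" using F_bounded[of undefined undefined] norm_ge_zero order_trans by blast
  then have L: "L > 0" by (simp add: L_def add_nonneg_pos)
  have "\<bar>F x m - F y m\<bar> \<le> L * dist x y" for x y m
    using bounded_hess_lipschitz[OF F_diff F_bounded, of x m y]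
      zero_le_dist[of x y] unfolding L_def distrib_right mult_1 by linarith
  note lip = flat_deriv_lipschitz[OF F_deriv L this]
  have "L-lipschitz_on UNIV \<F>" using lip L by (simp add: lipschitz_on_def dist_real_def)
  then show "continuous_on UNIV \<F>" by (rule lipschitz_on_continuous_on)
  show "\<exists>B>0. \<forall>\<mu>. \<bar>\<F> \<mu>\<bar> \<le> B"
  proof (intro exI[of _ "\<bar>\<F> undefined\<bar> + L * (2 * real CARD('n)) + 1"] conjI allI)
    fix \<mu> :: "'n torus_prob"
    have "dist \<mu> undefined \<le> 2 * real CARD('n)" by (rule dist_torus_prob_leI) (rule lip1_bound)
    then have "L * dist \<mu> undefined \<le> L * (2 * real CARD('n))" using L by (intro mult_left_mono) auto
    then show "\<bar>\<F> \<mu>\<bar> \<le> \<bar>\<F> undefined\<bar> + L * (2 * real CARD('n)) + 1"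
      using lip[of \<mu> undefined] by linarith
  qed (use L in \<open>simp add: add_nonneg_pos\<close>)
qed

section \<open>Dynamic programming\<close>

lemma exp_weight_integrable:
  fixes \<delta> :: real
  assumes "\<delta> > 0"
  shows "set_integrable lborel {0..} (\<lambda>s. exp (- \<delta> * s))"
proof -
  have "set_integrable lborel {0<..} (\<lambda>s. exp (- (s * \<delta>)))"
    by (rule integrable_I0i_exp_mscale[OF assms])
  then show ?thesis
    unfolding set_integrable_def
    by (rule integrable_discrete_difference[where X = "{0}", THEN iffD1, rotated 4])
       (auto simp: indicator_def mult.commute)
qed

text \<open>What the dynamic programming argument uses of the Hamiltonian and of the coupling cost.\<close>

locale control_cost =
  fixes H :: "'n::finite torus \<Rightarrow> real ^ 'n \<Rightarrow> real" and \<F> :: "'n torus_prob \<Rightarrow> real" and K :: real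
  assumes K_pos: "K > 0"
    and Hstar_lower: "\<And>x q. - K \<le> Hstar H x q"
    and Hstar_upper: "\<And>x q. Hstar H x q \<le> K * (1 + (norm q)\<^sup>2)"
    and Hstar_meas: "(\<lambda>(x, q). Hstar H x q) \<in> borel_measurable (borel \<Otimes>\<^sub>M borel)"
    and F_cont: "continuous_on UNIV \<F>"
    and F_bound: "\<And>\<mu>. \<bar>\<F> \<mu>\<bar> \<le> K"
begin

text \<open>When \<open>H\<^sup>*\<close> is not integrable along \<open>a\<close>, its integral has the value \<open>0\<close>, which also exceeds
  \<open>- K\<close>.\<close>

lemma running_cost_lower: "- 2 * K \<le> running_cost H \<F> \<mu> a"
proof -
  interpret prob_space "meas \<mu>" by (rule prob_space_meas)
  have "- K \<le> (\<integral>x. Hstar H x (a x) \<partial>meas \<mu>)"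
  proof (cases "integrable (meas \<mu>) (\<lambda>x. Hstar H x (a x))")
    case True
    have "(\<integral>x. - K \<partial>meas \<mu>) \<le> (\<integral>x. Hstar H x (a x) \<partial>meas \<mu>)"
      by (rule integral_mono) (use True Hstar_lower in auto)
    then show ?thesis using prob_space by simp
  qed (use K_pos in \<open>simp add: not_integrable_integral_eq\<close>)
  then show ?thesis using F_bound[of \<mu>] unfolding running_cost_def by linarith
qed

lemma running_cost_integrable:
  assumes adm: "(m, \<alpha>) \<in> admissible w I m\<^sub>0" and I [measurable]: "I \<in> sets borel"
    and w: "\<And>s. s \<in> I \<Longrightarrow> w s > 0" "set_integrable lborel I w"
  shows "set_integrable lborel I (\<lambda>s. w s * running_cost H \<F> (m s) (\<alpha> s))"
proof -
  note D = admissibleD[OF adm]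
  have meas: "(\<lambda>(s, x). Hstar H x (\<alpha> s x)) \<in> borel_measurable (restrict_space borel I \<Otimes>\<^sub>M borel)"
    using measurable_compose[OF measurable_Pair[OF measurable_snd D(3)] Hstar_meas]
    by (simp add: split_beta)
  have bound: "\<bar>Hstar H x (\<alpha> s x)\<bar> \<le> K * (1 + (norm (\<alpha> s x))\<^sup>2)" for s x
  proof -
    have "K * 1 \<le> K * (1 + (norm (\<alpha> s x))\<^sup>2)" using K_pos by (intro mult_left_mono) auto
    then show ?thesis using Hstar_lower[of x "\<alpha> s x"] Hstar_upper[of x "\<alpha> s x"] by linarith
  qed
  have "set_integrable lborel I (\<lambda>s. w s * (\<integral>x. Hstar H x (\<alpha> s x) \<partial>meas (m s)))"
    by (rule flow_integrable(1)[OF D(1) I D(3) meas bound w D(4)])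
  moreover have "set_integrable lborel I (\<lambda>s. w s * \<F> (m s))"
    unfolding set_integrable_def
  proof (rule Bochner_Integration.integrable_bound)
    have "continuous_on I (\<lambda>s. \<F> (m s))"
      by (rule continuous_on_compose2[OF F_cont D(1)]) auto
    from borel_measurable_continuous_on_restrict[OF this]
    have "(\<lambda>s. indicator I s *\<^sub>R \<F> (m s)) \<in> borel_measurable borel"
      by (simp add: borel_measurable_restrict_space_iff)
    with borel_measurable_integrable[OF w(2)[unfolded set_integrable_def]]
    have "(\<lambda>s. (indicator I s *\<^sub>R w s) * (indicator I s *\<^sub>R \<F> (m s))) \<in> borel_measurable lborel"
      by simp
    also have "(\<lambda>s. (indicator I s *\<^sub>R w s) * (indicator I s *\<^sub>R \<F> (m s))) = (\<lambda>s. indicator I s *\<^sub>R (w s * \<F> (m s)))"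
      by (auto simp: fun_eq_iff indicator_def)
    finally show "(\<lambda>s. indicator I s *\<^sub>R (w s * \<F> (m s))) \<in> borel_measurable lborel" .
    show "integrable lborel (\<lambda>s. K * (indicator I s *\<^sub>R w s))"
      using w(2) unfolding set_integrable_def by simp
    show "AE s in lborel. norm (indicator I s *\<^sub>R (w s * \<F> (m s))) \<le> norm (K * (indicator I s *\<^sub>R w s))"
      using F_bound K_pos
      by (intro AE_I2) (auto simp: indicator_def abs_mult mult.commute[of K] intro!: mult_left_mono)
  qed
  ultimately show ?thesis
    unfolding running_cost_def distrib_left by (rule set_integral_add(1))
qed

definition cost :: "real \<Rightarrow> (real \<Rightarrow> 'n torus_prob) \<Rightarrow> (real \<Rightarrow> 'n torus \<Rightarrow> real ^ 'n) \<Rightarrow> real" where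
  "cost \<delta> m \<alpha> = (LINT s:{0..}|lborel. exp (- \<delta> * s) * running_cost H \<F> (m s) (\<alpha> s))"

lemma value_fun_cost:
  "value_fun H \<F> \<delta> m\<^sub>0 = (INF (m, \<alpha>) \<in> admissible (\<lambda>s. exp (- \<delta> * s)) {0..} m\<^sub>0. ereal (cost \<delta> m \<alpha>))"
  by (simp add: value_fun_def cost_def)

lemma value_fun_le:
  "(m, \<alpha>) \<in> admissible (\<lambda>s. exp (- \<delta> * s)) {0..} m\<^sub>0 \<Longrightarrow> value_fun H \<F> \<delta> m\<^sub>0 \<le> ereal (cost \<delta> m \<alpha>)"
  unfolding value_fun_cost by (rule INF_lower2) auto

lemma value_fun_near:
  assumes "value_fun H \<F> \<delta> m\<^sub>0 < ereal c"
  obtains m \<alpha> where "(m, \<alpha>) \<in> admissible (\<lambda>s. exp (- \<delta> * s)) {0..} m\<^sub>0" "cost \<delta> m \<alpha> < c"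
  using assms unfolding value_fun_cost INF_less_iff by auto

lemma cost_split:
  assumes adm: "(m, \<alpha>) \<in> admissible (\<lambda>s. exp (- \<delta> * s)) {0..} m\<^sub>0" and "\<delta> > 0" "t > 0"
  shows "cost \<delta> m \<alpha> = (LINT s:{0..t}|lborel. exp (- \<delta> * s) * running_cost H \<F> (m s) (\<alpha> s))
    + exp (- \<delta> * t) * cost \<delta> (\<lambda>s. m (t + s)) (\<lambda>s. \<alpha> (t + s))"
proof -
  let ?f = "\<lambda>s. exp (- \<delta> * s) * running_cost H \<F> (m s) (\<alpha> s)"
  have int: "set_integrable lborel {0..} ?f"
    by (rule running_cost_integrable[OF adm _ _ exp_weight_integrable[OF \<open>\<delta> > 0\<close>]]) auto
  have u: "{0..t} \<union> {t..} = {0..}" "{0..t} \<inter> {t..} = {t}" using \<open>t > 0\<close> by auto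
  have "(LINT s:{0..t} \<union> {t..}|lborel. ?f s) = (LINT s:{0..t}|lborel. ?f s) + (LINT s:{t..}|lborel. ?f s)"
    by (rule set_integral_glue(2)[OF set_integrable_subset[OF int] set_integrable_subset[OF int] u(2)])
       (use \<open>t > 0\<close> in auto)
  moreover have "(LINT s:{t..}|lborel. ?f s) = exp (- \<delta> * t) * cost \<delta> (\<lambda>s. m (t + s)) (\<lambda>s. \<alpha> (t + s))"
  proof -
    have "exp (- \<delta> * (t + s)) = exp (- \<delta> * t) * exp (- \<delta> * s)" for s
      by (simp add: distrib_left flip: exp_add)
    then have "?f (t + s) = exp (- \<delta> * t) * (exp (- \<delta> * s) * running_cost H \<F> (m (t + s)) (\<alpha> (t + s)))" for s
      by (simp only: mult.assoc)
    then have "(LINT s:{0..}|lborel. ?f (t + s)) = exp (- \<delta> * t) * cost \<delta> (\<lambda>s. m (t + s)) (\<lambda>s. \<alpha> (t + s))"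
      unfolding cost_def by (simp only: set_integral_mult_right)
    then show ?thesis using set_integral_shift(2)[of "{0..}" ?f t] by simp
  qed
  ultimately show ?thesis unfolding u(1) by (simp add: cost_def)
qed

text \<open>Follow the given curve up to time \<open>t\<close> and then a nearly optimal one from its end point.\<close>

lemma dpp_upper:
  assumes adm: "(m, \<alpha>) \<in> admissible (\<lambda>_. 1) {0..t} m\<^sub>0" and "\<delta> > 0" "t > 0"
    and v: "value_fun H \<F> \<delta> (m t) = ereal v"
  shows "value_fun H \<F> \<delta> m\<^sub>0
    \<le> ereal ((LINT s:{0..t}|lborel. exp (- \<delta> * s) * running_cost H \<F> (m s) (\<alpha> s)) + exp (- \<delta> * t) * v)"
proof (rule ereal_le_epsilon2)
  fix e :: real assume "e > 0"
  then have "value_fun H \<F> \<delta> (m t) < ereal (v + e)" using v by simp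
  then obtain n \<beta> where n: "(n, \<beta>) \<in> admissible (\<lambda>s. exp (- \<delta> * s)) {0..} (m t)" "cost \<delta> n \<beta> < v + e"
    by (rule value_fun_near)
  note c = admissible_concat[OF adm n(1) \<open>\<delta> > 0\<close> \<open>t > 0\<close>]
  have "(LINT s:{0..t}|lborel. exp (- \<delta> * s) * running_cost H \<F> (concat_at t m n s) (concat_at t \<alpha> \<beta> s))
     = (LINT s:{0..t}|lborel. exp (- \<delta> * s) * running_cost H \<F> (m s) (\<alpha> s))"
    by (rule set_lebesgue_integral_cong) (auto simp: concat_at_def)
  moreover have "cost \<delta> (\<lambda>s. concat_at t m n (t + s)) (\<lambda>s. concat_at t \<alpha> \<beta> (t + s)) = cost \<delta> n \<beta>"
    unfolding cost_def set_lebesgue_integral_def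
    by (rule integral_discrete_difference[where X = "{0}"]) (auto simp: indicator_def concat_at_def)
  ultimately have "cost \<delta> (concat_at t m n) (concat_at t \<alpha> \<beta>)
    = (LINT s:{0..t}|lborel. exp (- \<delta> * s) * running_cost H \<F> (m s) (\<alpha> s)) + exp (- \<delta> * t) * cost \<delta> n \<beta>"
    using cost_split[OF c \<open>\<delta> > 0\<close> \<open>t > 0\<close>] by simp
  also have "exp (- \<delta> * t) * cost \<delta> n \<beta> \<le> exp (- \<delta> * t) * (v + e)" using n(2) by (intro mult_left_mono) auto
  also have "\<dots> \<le> exp (- \<delta> * t) * v + e"
    using \<open>e > 0\<close> \<open>\<delta> > 0\<close> \<open>t > 0\<close> by (simp add: distrib_left mult_left_le_one_le)
  finally show "value_fun H \<F> \<delta> m\<^sub>0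
    \<le> ereal ((LINT s:{0..t}|lborel. exp (- \<delta> * s) * running_cost H \<F> (m s) (\<alpha> s)) + exp (- \<delta> * t) * v) + ereal e"
    using order_trans[OF value_fun_le[OF c]] by simp
qed

text \<open>Since \<open>L + 2 K \<ge> 0\<close> for the running cost \<open>L\<close>, the discount decreases \<open>L + 2 K\<close> at most by the factor
  \<open>e\<^sup>-\<^sup>\<delta>\<^sup>t\<close>. Both this factor and the additive error depend on \<open>\<delta>\<close>, \<open>t\<close> and \<open>K\<close> only, which
  allows for curves that vary with \<open>\<delta>\<close>.\<close>

lemma undiscounted_cost_le:
  assumes adm: "(m, \<alpha>) \<in> admissible (\<lambda>_. 1) {0..t} m\<^sub>0" and "\<delta> > 0" "t > 0"
  shows "exp (- \<delta> * t) * ((LINT s:{0..t}|lborel. running_cost H \<F> (m s) (\<alpha> s)) + 2 * K * t) - 2 * K * t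
    \<le> (LINT s:{0..t}|lborel. exp (- \<delta> * s) * running_cost H \<F> (m s) (\<alpha> s))"
proof -
  let ?L = "\<lambda>s. running_cost H \<F> (m s) (\<alpha> s)"
  have one: "set_integrable lborel {0..t} (\<lambda>_. c)" for c :: real
    by (intro borel_integrable_atLeastAtMost' continuous_intros)
  have L: "set_integrable lborel {0..t} ?L"
    using running_cost_integrable[OF adm _ _ one] by simp
  have eL: "set_integrable lborel {0..t} (\<lambda>s. exp (- \<delta> * s) * ?L s)"
    unfolding set_integrable_def
  proof (rule Bochner_Integration.integrable_bound)
    show "integrable lborel (\<lambda>s. indicator {0..t} s *\<^sub>R ?L s)" using L by (simp add: set_integrable_def)
    have "(\<lambda>s. exp (- \<delta> * s) * (indicator {0..t} s *\<^sub>R ?L s)) \<in> borel_measurable lborel"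
      using borel_measurable_integrable[OF L[unfolded set_integrable_def]] by simp
    then show "(\<lambda>s. indicator {0..t} s *\<^sub>R (exp (- \<delta> * s) * ?L s)) \<in> borel_measurable lborel"
      by (simp add: mult.left_commute)
    show "AE s in lborel. norm (indicator {0..t} s *\<^sub>R (exp (- \<delta> * s) * ?L s)) \<le> norm (indicator {0..t} s *\<^sub>R ?L s)"
      using \<open>\<delta> > 0\<close> by (intro AE_I2) (auto simp: indicator_def abs_mult mult_left_le_one_le)
  qed
  have "exp (- \<delta> * t) * ((LINT s:{0..t}|lborel. ?L s) + 2 * K * t) - 2 * K * t
     = (LINT s:{0..t}|lborel. exp (- \<delta> * t) * (?L s + 2 * K) - 2 * K)"
  proof -
    have "(LINT s:{0..t}|lborel. c) = c * t" for c :: real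
      using \<open>t > 0\<close> by (simp add: set_lebesgue_integral_def)
    then show ?thesis using L one by (simp add: set_integral_diff(2) set_integral_add)
  qed
  also have "\<dots> \<le> (LINT s:{0..t}|lborel. exp (- \<delta> * s) * ?L s)"
  proof (rule set_integral_mono)
    show "set_integrable lborel {0..t} (\<lambda>s. exp (- \<delta> * t) * (?L s + 2 * K) - 2 * K)"
      by (intro set_integral_diff(1) set_integrable_mult_right set_integral_add(1) L one)
    fix s assume s: "s \<in> {0..t}"
    have "exp (- \<delta> * t) * (?L s + 2 * K) \<le> exp (- \<delta> * s) * (?L s + 2 * K)"
      using running_cost_lower[of "m s" "\<alpha> s"] s \<open>\<delta> > 0\<close> by (intro mult_right_mono) auto
    moreover have "exp (- \<delta> * s) * (2 * K) \<le> 1 * (2 * K)"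
      using K_pos s \<open>\<delta> > 0\<close> by (intro mult_right_mono) auto
    ultimately show "exp (- \<delta> * t) * (?L s + 2 * K) - 2 * K \<le> exp (- \<delta> * s) * ?L s"
      by (simp add: distrib_left)
  qed (rule eL)
  finally show ?thesis .
qed

section \<open>The vanishing discount limit\<close>

lemma discounted_cost_limit:
  assumes adm: "(m, \<alpha>) \<in> admissible (\<lambda>_. 1) {0..t} m\<^sub>0" and "\<And>n. \<delta> n > 0" "\<delta> \<longlonglongrightarrow> 0"
  shows "(\<lambda>n. LINT s:{0..t}|lborel. exp (- \<delta> n * s) * running_cost H \<F> (m s) (\<alpha> s))
    \<longlonglongrightarrow> (LINT s:{0..t}|lborel. running_cost H \<F> (m s) (\<alpha> s))"
proof -
  let ?L = "\<lambda>s. running_cost H \<F> (m s) (\<alpha> s)"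
  have one: "set_integrable lborel {0..t} (\<lambda>_. 1 :: real)"
    by (intro borel_integrable_atLeastAtMost' continuous_intros)
  have L: "integrable lborel (\<lambda>s. indicator {0..t} s *\<^sub>R ?L s)"
    using running_cost_integrable[OF adm _ _ one] by (simp add: set_integrable_def)
  show ?thesis
    unfolding set_lebesgue_integral_def
  proof (rule integral_dominated_convergence[where w = "\<lambda>s. norm (indicator {0..t} s *\<^sub>R ?L s)"])
    show "(\<lambda>s. indicator {0..t} s *\<^sub>R ?L s) \<in> borel_measurable lborel"
      using L by (rule borel_measurable_integrable)
    have "(\<lambda>s. exp (- \<delta> n * s) * (indicator {0..t} s *\<^sub>R ?L s)) \<in> borel_measurable lborel" for n
      using borel_measurable_integrable[OF L] by simp
    then show "(\<lambda>s. indicator {0..t} s *\<^sub>R (exp (- \<delta> n * s) * ?L s)) \<in> borel_measurable lborel" for n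
      by (simp add: mult.left_commute)
    show "integrable lborel (\<lambda>s. norm (indicator {0..t} s *\<^sub>R ?L s))" using L by (rule integrable_norm)
    show "AE s in lborel. norm (indicator {0..t} s *\<^sub>R (exp (- \<delta> n * s) * ?L s)) \<le> norm (indicator {0..t} s *\<^sub>R ?L s)" for n
      using assms(2)[of n] by (intro AE_I2) (auto simp: indicator_def abs_mult mult_left_le_one_le)
    show "AE s in lborel. (\<lambda>n. indicator {0..t} s *\<^sub>R (exp (- \<delta> n * s) * ?L s)) \<longlonglongrightarrow> indicator {0..t} s *\<^sub>R ?L s"
    proof (intro AE_I2)
      fix s
      have "(\<lambda>n. indicator {0..t} s *\<^sub>R (exp (- \<delta> n * s) * ?L s)) \<longlonglongrightarrow> indicator {0..t} s *\<^sub>R (exp (- 0 * s) * ?L s)"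
        by (intro tendsto_intros assms(3))
      then show "(\<lambda>n. indicator {0..t} s *\<^sub>R (exp (- \<delta> n * s) * ?L s)) \<longlonglongrightarrow> indicator {0..t} s *\<^sub>R ?L s" by simp
    qed
  qed
qed

text \<open>The limit of the dynamic programming principle after subtraction of \<open>V\<^sub>\<delta>(\<eta>)\<close>.\<close>

lemma ergodic_dpp:
  fixes \<delta> :: "nat \<Rightarrow> real" and chi :: "'n torus_prob \<Rightarrow> real" and lam t :: real
  assumes \<delta>_pos: "\<And>n. \<delta> n > 0" and \<delta>_lim: "\<delta> \<longlonglongrightarrow> 0"
    and conv_chi: "uniformly_converges (\<lambda>n m. value_fun H \<F> (\<delta> n) m - value_fun H \<F> (\<delta> n) \<eta>) chi"
    and conv_lam: "uniformly_converges (\<lambda>n m. ereal (\<delta> n) * value_fun H \<F> (\<delta> n) m) (\<lambda>_. - lam)"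
    and t: "t > 0"
  shows "ereal (chi m\<^sub>0) =
    (INF (m, \<alpha>) \<in> admissible (\<lambda>_. 1) {0..t} m\<^sub>0.
       ereal ((LINT s:{0..t}|lborel. running_cost H \<F> (m s) (\<alpha> s)) + chi (m t)))
    + ereal (lam * t)"
proof -
  define v where "v n m = real_of_ereal (value_fun H \<F> (\<delta> n) m)" for n m
  \<comment> \<open>In the extended reals a difference with an infinite term is infinite, and so it is not within
    distance \<open>1\<close> of a real number.\<close>
  have fin: "\<forall>\<^sub>F n in sequentially. \<forall>m. value_fun H \<F> (\<delta> n) m = ereal (v n m)"
  proof -
    have "\<forall>\<^sub>F n in sequentially. \<forall>m. \<bar>value_fun H \<F> (\<delta> n) m - value_fun H \<F> (\<delta> n) \<eta> - ereal (chi m)\<bar> < ereal 1"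
      using conv_chi by (simp add: uniformly_converges_def)
    then show ?thesis
    proof eventually_elim
      case (elim n)
      obtain a where a: "value_fun H \<F> (\<delta> n) \<eta> = ereal a"
        using elim[rule_format, of \<eta>] by (cases "value_fun H \<F> (\<delta> n) \<eta>") auto
      show ?case
      proof
        fix m
        show "value_fun H \<F> (\<delta> n) m = ereal (v n m)"
          using elim[rule_format, of m] by (cases "value_fun H \<F> (\<delta> n) m") (auto simp: a v_def)
      qed
    qed
  qed
  have chi_unif: "\<forall>\<^sub>F n in sequentially. \<forall>m. \<bar>v n m - v n \<eta> - chi m\<bar> < e" if "e > 0" for e
  proof -
    have "\<forall>\<^sub>F n in sequentially. \<forall>m. \<bar>value_fun H \<F> (\<delta> n) m - value_fun H \<F> (\<delta> n) \<eta> - ereal (chi m)\<bar> < ereal e"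
      using conv_chi that by (simp add: uniformly_converges_def)
    with fin show ?thesis by eventually_elim simp
  qed
  have chi_lim: "(\<lambda>n. v n m - v n \<eta>) \<longlonglongrightarrow> chi m" for m
    unfolding tendsto_iff dist_real_def
    by (intro allI impI, drule chi_unif, erule eventually_mono) blast
  have lam_lim: "(\<lambda>n. \<delta> n * v n \<eta>) \<longlonglongrightarrow> - lam"
    unfolding tendsto_iff dist_real_def
  proof (intro allI impI)
    fix e :: real assume "e > 0"
    then have "\<forall>\<^sub>F n in sequentially. \<forall>m. \<bar>ereal (\<delta> n) * value_fun H \<F> (\<delta> n) m - ereal (- lam)\<bar> < ereal e"
      using conv_lam by (simp add: uniformly_converges_def)
    with fin show "\<forall>\<^sub>F n in sequentially. \<bar>\<delta> n * v n \<eta> - - lam\<bar> < e"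
    proof eventually_elim
      case (elim n)
      show ?case using elim(2)[rule_format, of \<eta>] elim(1) by simp
    qed
  qed
  have exp_lim: "(\<lambda>n. exp (- \<delta> n * t)) \<longlonglongrightarrow> 1"
    using tendsto_exp[OF tendsto_mult[OF tendsto_minus[OF \<delta>_lim] tendsto_const[of t]]] by simp
  \<comment> \<open>What the subtraction of \<open>v n \<eta>\<close> leaves behind; its limit is the source of \<open>lam * t\<close>.\<close>
  define c where "c n = (1 - exp (- \<delta> n * t)) * v n \<eta>" for n
  have c_lim: "c \<longlonglongrightarrow> - lam * t"
  proof -
    have "((\<lambda>x. exp (- x * t)) has_real_derivative - t) (at 0)"
      by (auto intro!: derivative_eq_intros)
    then have "((\<lambda>x. (exp (- x * t) - 1) / x) \<longlongrightarrow> - t) (at 0)"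
      by (simp add: has_field_derivative_iff)
    moreover have "filterlim \<delta> (at 0) sequentially"
      using \<delta>_lim \<delta>_pos by (simp add: filterlim_at less_imp_neq[symmetric])
    ultimately have "(\<lambda>n. (exp (- \<delta> n * t) - 1) / \<delta> n) \<longlonglongrightarrow> - t"
      by (rule filterlim_compose)
    from tendsto_mult[OF tendsto_minus[OF this] lam_lim]
    have "(\<lambda>n. - ((exp (- \<delta> n * t) - 1) / \<delta> n) * (\<delta> n * v n \<eta>)) \<longlonglongrightarrow> - (- t) * - lam" .
    moreover have "- ((exp (- \<delta> n * t) - 1) / \<delta> n) * (\<delta> n * v n \<eta>) = c n" for n
      using \<delta>_pos[of n] by (simp add: c_def field_simps)
    ultimately show ?thesis by (simp add: mult.commute)
  qed
  have upper: "chi m\<^sub>0 - lam * t \<le> (LINT s:{0..t}|lborel. running_cost H \<F> (m s) (\<alpha> s)) + chi (m t)"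
    if adm: "(m, \<alpha>) \<in> admissible (\<lambda>_. 1) {0..t} m\<^sub>0" for m \<alpha>
  proof -
    let ?I = "\<lambda>n. LINT s:{0..t}|lborel. exp (- \<delta> n * s) * running_cost H \<F> (m s) (\<alpha> s)"
    have "\<forall>\<^sub>F n in sequentially. v n m\<^sub>0 - v n \<eta> \<le> ?I n + exp (- \<delta> n * t) * (v n (m t) - v n \<eta>) - c n"
      using fin
    proof eventually_elim
      case (elim n)
      have "v n m\<^sub>0 \<le> ?I n + exp (- \<delta> n * t) * v n (m t)"
        using dpp_upper[OF adm \<delta>_pos t, of n "v n (m t)"] elim by simp
      then show ?case by (simp add: c_def algebra_simps)
    qed
    moreover have "(\<lambda>n. ?I n + exp (- \<delta> n * t) * (v n (m t) - v n \<eta>) - c n)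
      \<longlonglongrightarrow> (LINT s:{0..t}|lborel. running_cost H \<F> (m s) (\<alpha> s)) + 1 * chi (m t) - (- lam * t)"
      by (intro tendsto_intros discounted_cost_limit[OF adm] \<delta>_pos \<delta>_lim exp_lim chi_lim c_lim)
    ultimately have "chi m\<^sub>0 \<le> (LINT s:{0..t}|lborel. running_cost H \<F> (m s) (\<alpha> s)) + 1 * chi (m t) - (- lam * t)"
      using chi_lim[of m\<^sub>0] by (intro tendsto_le[OF sequentially_bot])
    then show ?thesis by simp
  qed
  have lower: "\<exists>m \<alpha>. (m, \<alpha>) \<in> admissible (\<lambda>_. 1) {0..t} m\<^sub>0 \<and>
      (LINT s:{0..t}|lborel. running_cost H \<F> (m s) (\<alpha> s)) + chi (m t) < chi m\<^sub>0 - lam * t + 3 * e"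
    if e: "e > 0" for e
  proof -
    \<comment> \<open>The lower dynamic programming inequality for an \<open>e\<close>-optimal curve, solved for its undiscounted
      cost, gives the upper bound \<open>B n\<close>.\<close>
    define B where "B n = (v n m\<^sub>0 - v n \<eta> + e + 2 * K * t + c n) / exp (- \<delta> n * t) - 2 * K * t + e" for n
    have "B \<longlonglongrightarrow> (chi m\<^sub>0 + e + 2 * K * t + - lam * t) / 1 - 2 * K * t + e"
      unfolding B_def by (intro tendsto_intros chi_lim c_lim exp_lim) simp
    moreover have "(chi m\<^sub>0 + e + 2 * K * t + - lam * t) / 1 - 2 * K * t + e < chi m\<^sub>0 - lam * t + 3 * e"
      using e by simp
    ultimately have "\<forall>\<^sub>F n in sequentially. B n < chi m\<^sub>0 - lam * t + 3 * e"
      by (rule order_tendstoD(2))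
    from eventually_conj[OF this eventually_conj[OF fin chi_unif[OF e]]]
    obtain n where n: "B n < chi m\<^sub>0 - lam * t + 3 * e" "\<And>m. value_fun H \<F> (\<delta> n) m = ereal (v n m)"
      "\<And>m. \<bar>v n m - v n \<eta> - chi m\<bar> < e"
      using eventually_happens'[OF sequentially_bot] by (metis (mono_tags, lifting))
    have "value_fun H \<F> (\<delta> n) m\<^sub>0 < ereal (v n m\<^sub>0 + e)" using n(2) e by simp
    then obtain m \<alpha> where m: "(m, \<alpha>) \<in> admissible (\<lambda>s. exp (- \<delta> n * s)) {0..} m\<^sub>0" "cost (\<delta> n) m \<alpha> < v n m\<^sub>0 + e"
      by (rule value_fun_near)
    have adm: "(m, \<alpha>) \<in> admissible (\<lambda>_. 1) {0..t} m\<^sub>0" by (rule admissible_restrict[OF m(1) \<delta>_pos t])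
    let ?J = "LINT s:{0..t}|lborel. running_cost H \<F> (m s) (\<alpha> s)"
    let ?E = "exp (- \<delta> n * t)"
    have "v n (m t) \<le> cost (\<delta> n) (\<lambda>s. m (t + s)) (\<lambda>s. \<alpha> (t + s))"
      using value_fun_le[OF admissible_shift[OF m(1) \<delta>_pos t]] n(2) by simp
    then have "?E * (v n \<eta> + chi (m t) - e) \<le> ?E * cost (\<delta> n) (\<lambda>s. m (t + s)) (\<lambda>s. \<alpha> (t + s))"
      using n(3)[of "m t"] by (intro mult_left_mono) auto
    then have "?E * (?J + 2 * K * t) - 2 * K * t + ?E * (v n \<eta> + chi (m t) - e) < v n m\<^sub>0 + e"
      using undiscounted_cost_le[OF adm \<delta>_pos[of n] t] cost_split[OF m(1) \<delta>_pos t] m(2) by linarith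
    then have "(?J + chi (m t) + 2 * K * t - e) * ?E < v n m\<^sub>0 - v n \<eta> + e + 2 * K * t + c n"
      by (simp add: c_def algebra_simps)
    then have "?J + chi (m t) + 2 * K * t - e < (v n m\<^sub>0 - v n \<eta> + e + 2 * K * t + c n) / ?E"
      by (simp add: pos_less_divide_eq)
    then have "?J + chi (m t) < B n" by (simp add: B_def)
    then show ?thesis using adm n(1) by (intro exI[of _ m] exI[of _ \<alpha>]) auto
  qed
  let ?X = "INF (m, \<alpha>) \<in> admissible (\<lambda>_. 1) {0..t} m\<^sub>0.
       ereal ((LINT s:{0..t}|lborel. running_cost H \<F> (m s) (\<alpha> s)) + chi (m t))"
  have "?X = ereal (chi m\<^sub>0 - lam * t)"
  proof (rule antisym)
    show "ereal (chi m\<^sub>0 - lam * t) \<le> ?X"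
      by (rule INF_greatest) (use upper in auto)
    show "?X \<le> ereal (chi m\<^sub>0 - lam * t)"
    proof (rule ereal_le_epsilon2)
      fix e :: real assume "e > 0"
      then obtain m \<alpha> where m: "(m, \<alpha>) \<in> admissible (\<lambda>_. 1) {0..t} m\<^sub>0"
        "(LINT s:{0..t}|lborel. running_cost H \<F> (m s) (\<alpha> s)) + chi (m t) < chi m\<^sub>0 - lam * t + 3 * (e / 3)"
        using lower[of "e / 3"] by auto
      show "?X \<le> ereal (chi m\<^sub>0 - lam * t) + ereal e"
        by (rule INF_lower2[OF m(1)]) (use m(2) in simp)
    qed
  qed
  then show ?thesis by simp
qed

end

theorem lemma1p7:
  fixes H :: "'n::finite torus \<Rightarrow> real ^ 'n \<Rightarrow> real"
    and \<F> :: "'n torus_prob \<Rightarrow> real"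
    and F :: "'n torus \<Rightarrow> 'n torus_prob \<Rightarrow> real"
    and \<eta> m\<^sub>0 :: "'n torus_prob"
    and \<delta> :: "nat \<Rightarrow> real"
    and chi :: "'n torus_prob \<Rightarrow> real"
    and lam t :: real
  assumes H_C2: "C2_fun (\<lambda>(v, p). H (torus_proj v) p)"
    and H_pp_Lipschitz: "\<exists>L. \<forall>x. L-lipschitz_on UNIV (\<lambda>p. D_pp H x p)"
    and H_convex: "\<exists>C>0. \<forall>x p. matrix_le ((1 / C) *\<^sub>R mat 1) (D_pp H x p) \<and>
                               matrix_le (D_pp H x p) (C *\<^sub>R mat 1)"
    and H_growth: "\<exists>\<theta> C. 0 < \<theta> \<and> \<theta> < 1 \<and> C > 0 \<and>
                     (\<forall>x p. norm (D_xx H x p) \<le> C * (1 + norm p) powr (1 + \<theta>) \<and>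
                            norm (D_xp H x p) \<le> C * (1 + norm p) powr \<theta>)"
    and F_C2: "flat_C2 \<F>"
    and F_deriv: "is_flat_deriv \<F> (\<lambda>m x. F x m)"
    and F_diff: "\<forall>m. twice_differentiable (\<lambda>x. F x m)"
    and F_bounded: "\<exists>K. \<forall>x m. norm (thess (\<lambda>y. F y m) x) \<le> K"
    and \<delta>_pos: "\<forall>n. \<delta> n > 0"
    and \<delta>_lim: "\<delta> \<longlonglongrightarrow> 0"
    and conv_chi: "uniformly_converges
                 (\<lambda>n m. value_fun H \<F> (\<delta> n) m - value_fun H \<F> (\<delta> n) \<eta>) chi"
    and conv_lam: "uniformly_converges (\<lambda>n m. ereal (\<delta> n) * value_fun H \<F> (\<delta> n) m) (\<lambda>_. - lam)"
    and t_pos: "t > 0"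
  shows "ereal (chi m\<^sub>0) =
    (INF (m, \<alpha>) \<in> admissible (\<lambda>_. 1) {0..t} m\<^sub>0.
       ereal ((LINT s:{0..t}|lborel. running_cost H \<F> (m s) (\<alpha> s)) + chi (m t)))
    + ereal (lam * t)"
proof -
  obtain C where C: "C > 0" "\<And>x p. matrix_le ((1 / C) *\<^sub>R mat 1) (D_pp H x p)"
    using H_convex by blast
  obtain K where K: "K > 0" "\<And>x. \<bar>H x 0\<bar> \<le> K"
    "\<And>x p. H x p \<ge> (norm p)\<^sup>2 / (2 * C) - K * norm p - K"
    using hamiltonian_bounds(2)[OF H_C2 C] by blast
  note star = Hstar_bounds[OF C(1) K(1), of H, OF K(2,3)]
  obtain K' where K': "\<And>x m. norm (thess (\<lambda>y. F y m) x) \<le> K'" using F_bounded by blast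
  note reg = coupling_cost_regular[OF F_deriv F_diff[rule_format] K']
  obtain B where B: "B > 0" "\<And>\<mu>. \<bar>\<F> \<mu>\<bar> \<le> B" using reg(2) by blast
  define M where "M = K + C + C * K\<^sup>2 + B"
  have M: "K + C + C * K\<^sup>2 \<le> M" "K \<le> M" "B \<le> M" "M > 0"
    using K(1) C(1) B(1) by (auto simp: M_def add_pos_nonneg)
  interpret control_cost H \<F> M
  proof
    show "Hstar H x q \<le> M * (1 + (norm q)\<^sup>2)" for x q
      by (rule order_trans[OF star(3) mult_right_mono[OF M(1)]]) simp
    show "- M \<le> Hstar H x q" for x q using star(2)[of x q] M(2) by linarith
    show "\<bar>\<F> \<mu>\<bar> \<le> M" for \<mu> using B(2)[of \<mu>] M(3) by linarith
  qed (use M(4) reg(1) Hstar_measurable[OF hamiltonian_bounds(1)[OF H_C2 C] star(1)] in auto)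
  show ?thesis
    by (rule ergodic_dpp[OF \<delta>_pos[rule_format] \<delta>_lim conv_chi conv_lam t_pos])
qed

end
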